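(* Let $p>1$ be an integer and let $V$ be an irreducible module of intermediate series over the gap-$p$ Virasoro algebra $\mathfrak{g}$. Then $V$ must be the irreducible subquotient of $V(\alpha,\beta,F)$ for some $\alpha,\beta\in\mathbb{C}$ and some $(p-1)\times p$ complex matrix $F$ satisfying conditions (I)–(III) listed in the context.
   Context: Fix an integer $p>1$; for $r\in\mathbb{Z}$ let $\overline{r}\in\{0,\dots,p-1\}$ be its residue modulo $p$. Let $\mathfrak{g}'$ be the complex Lie algebra with basis $\{L_m\mid m\in\mathbb{Z}\}$ and brackets $[L_m,L_n]=(n-m)L_{m+n}$, $[L_m,L_r]=rL_{m+r}$, $[L_r,L_s]=0$ for $m,n\in p\mathbb{Z}$ and $r,s\notin p\mathbb{Z}$. The gap-$p$ Virasoro algebra $\mathfrak{g}$ is the universal central extension of $\mathfrak{g}'$, described as having a $p$-dimensional center $\mathrm{span}_{\mathbb{C}}\{C_i\mid 0\le i\le p-1\}$ and brackets $$[L_m,L_n]=(n-m)L_{m+n}+\delta_{m+n,0}\tfrac{1}{12}\left(\left(\tfrac{m}{p}\right)^3-\tfrac{m}{p}\right)C_0,\quad [L_m,L_r]=rL_{m+r},\quad [L_r,L_s]=\delta_{r+s,0}\,r\,C_{\overline{r}}$$ for $m,n\in p\mathbb{Z}$ and $r,s\notin p\mathbb{Z}$. Put $\mathfrak{g}_0=\mathrm{span}_{\mathbb{C}}\{L_0,C_0,\dots,C_{p-1}\}$. A module of intermediate series over $\mathfrak{g}$ is a $\mathfrak{g}$-module on which $\mathfrak{g}_0$ acts diagonalizably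 with all weight spaces (simultaneous eigenspaces of $\mathfrak{g}_0$) of dimension at most $1$. Let $\alpha,\beta\in\mathbb{C}$ and let $F=(F_{i,j})$ be a $(p-1)\times p$ complex matrix with index $1\le i\le p-1$, $0\le j\le p-1$. The conditions are: (I) $0\in o(F)=\{j\mid F_{i,j}\ne0\text{ for some }i\}$; (II) if $F_{i,j}\ne0$ then $F_{s,\overline{i+j}}\ne0$ for some $1\le s\le p-1$; (III) $F_{r,\overline{i+s}}F_{s,i}=F_{s,\overline{i+r}}F_{r,i}$ for any $0\le i\le p-1$ and $1\le r,s\le p-1$. For $j\in o(F)$ let $V_{(j)}=\mathrm{span}_{\mathbb{C}}\{v_{j+pk}\mid k\in\mathbb{Z}\}$. The $\mathfrak{g}$-module $V(\alpha,\beta,F)=\bigoplus_{j\in o(F)}V_{(j)}$ has the action $$L_mv_{j+n}=(\alpha+j+n+m\beta)v_{j+n+m},\quad L_sv_{j+n}=F_{\overline{s},j}\,v_{j+n+s},\quad C_iv_{j+n}=0\ (0\le i\le p-1)$$ for $m,n\in p\mathbb{Z}$, $s\notin p\mathbb{Z}$, $j\in o(F)$. If $o(F)=\{0\}$, then $V(\alpha,\beta,F)=V_0(\alpha,\beta)$, where $V_0(\alpha,\beta)$ has basis $\{v_{pk}\mid k\in\mathbb{Z}\}$ with $L_mv_{pk}=(\alpha+pk+m\beta)v_{pk+m}$ for $m\in p\mathbb{Z}$ and $C_0v_{pk}=0$.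
   Formalization: The formal statement sets o(F)={0} when F=0, so that V_0(α,β) is V(α,β,0); with the literal o(F), (I) and (II) exclude V_0 and the claim fails (e.g. p=2). The center satisfies C_i=C_{p-i}, as skew-symmetry of the displayed brackets forces. *)

theory Defs
  imports Complex_Main "HOL-Library.Poly_Mapping"
begin

section \<open>Complex vector spaces with a given basis\<close>

definition cscale :: "complex \<Rightarrow> ('a \<Rightarrow>\<^sub>0 complex) \<Rightarrow> ('a \<Rightarrow>\<^sub>0 complex)" where
  "cscale c = Poly_Mapping.map ((*) c)"

lemma lookup_cscale [simp]: "Poly_Mapping.lookup (cscale c x) k = c * Poly_Mapping.lookup x k"
  by (simp add: cscale_def Poly_Mapping.map.rep_eq when_def)

interpretation pm: vector_space cscale
  by unfold_locales (auto intro!: poly_mapping_eqI simp: lookup_add algebra_simps)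

definition bilin ::
    "('a \<Rightarrow> 'b \<Rightarrow> ('c \<Rightarrow>\<^sub>0 complex)) \<Rightarrow> ('a \<Rightarrow>\<^sub>0 complex) \<Rightarrow> ('b \<Rightarrow>\<^sub>0 complex) \<Rightarrow> ('c \<Rightarrow>\<^sub>0 complex)" where
  "bilin f x y = (\<Sum>a\<in>Poly_Mapping.keys x. \<Sum>b\<in>Poly_Mapping.keys y. cscale (Poly_Mapping.lookup x a * Poly_Mapping.lookup y b) (f a b))"

lemma bilin_eq:
  assumes "finite A" "finite B" "Poly_Mapping.keys x \<subseteq> A" "Poly_Mapping.keys y \<subseteq> B"
  shows "bilin f x y = (\<Sum>a\<in>A. \<Sum>b\<in>B. cscale (Poly_Mapping.lookup x a * Poly_Mapping.lookup y b) (f a b))"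
proof -
  have "(\<Sum>b\<in>Poly_Mapping.keys y. cscale (Poly_Mapping.lookup x a * Poly_Mapping.lookup y b) (f a b)) =
        (\<Sum>b\<in>B. cscale (Poly_Mapping.lookup x a * Poly_Mapping.lookup y b) (f a b))" for a
    using assms by (intro sum.mono_neutral_left) (auto simp: in_keys_iff)
  then show ?thesis
    unfolding bilin_def using assms
    by simp (intro sum.mono_neutral_left, auto simp: in_keys_iff)
qed

lemma keys_cscale: "Poly_Mapping.keys (cscale c x) \<subseteq> Poly_Mapping.keys x"
  by (auto simp: in_keys_iff)

lemma bilin_add_left: "bilin f (x + x') y = bilin f x y + bilin f x' y"
  using Poly_Mapping.keys_add[of x x']
  by (simp add: bilin_eq[of "Poly_Mapping.keys x \<union> Poly_Mapping.keys x'" "Poly_Mapping.keys y"] lookup_add algebra_simps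
      pm.scale_left_distrib sum.distrib)

lemma bilin_add_right: "bilin f x (y + y') = bilin f x y + bilin f x y'"
  using Poly_Mapping.keys_add[of y y']
  by (simp add: bilin_eq[of "Poly_Mapping.keys x" "Poly_Mapping.keys y \<union> Poly_Mapping.keys y'"] lookup_add algebra_simps
      pm.scale_left_distrib sum.distrib)

lemma bilin_scale_left: "bilin f (cscale c x) y = cscale c (bilin f x y)"
  using keys_cscale[of c x]
  by (simp add: bilin_eq[of "Poly_Mapping.keys x" "Poly_Mapping.keys y"] pm.scale_sum_right mult.assoc)

lemma bilin_scale_right: "bilin f x (cscale c y) = cscale c (bilin f x y)"
  using keys_cscale[of c y]
  by (simp add: bilin_eq[of "Poly_Mapping.keys x" "Poly_Mapping.keys y"] pm.scale_sum_right mult_ac)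

lemma bilin_0 [simp]: "bilin f 0 y = 0" "bilin f x 0 = 0"
  by (simp_all add: bilin_def)

lemma bilin_minus:
  "bilin f (- x) y = - bilin f x y" "bilin f x (- y) = - bilin f x y"
  using bilin_scale_left[of f "-1" x y] bilin_scale_right[of f x "-1" y] by simp_all

lemma bilin_diff:
  "bilin f (x - x') y = bilin f x y - bilin f x' y"
  "bilin f x (y - y') = bilin f x y - bilin f x y'"
  using bilin_add_left[of f x "- x'" y] bilin_add_right[of f x y "- y'"]
  by (simp_all add: bilin_minus)

lemma bilin_single [simp]:
  "bilin f (Poly_Mapping.single a 1) (Poly_Mapping.single b 1) = f a b"
  by (simp add: bilin_def)

lemma single_conv_cscale: "Poly_Mapping.single a c = cscale c (Poly_Mapping.single a 1)"
  by (auto intro!: poly_mapping_eqI simp: lookup_single when_def)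

lemma basis_induct:
  assumes "P 0" "\<And>x y. P x \<Longrightarrow> P y \<Longrightarrow> P (x + y)" "\<And>c x. P x \<Longrightarrow> P (cscale c x)"
    and "\<And>a. P (Poly_Mapping.single a 1)"
  shows "P x"
proof (induction x rule: Poly_Mapping.update_induct)
  case (update f a b)
  then have "Poly_Mapping.update a b f = f + cscale b (Poly_Mapping.single a 1)"
    by (auto intro!: poly_mapping_eqI simp: lookup_update lookup_add lookup_single when_def in_keys_iff)
  then show ?case using assms update by simp
qed (rule assms(1))


section \<open>The gap-\<open>p\<close> Virasoro algebra\<close>

text \<open>
  The bracket \<open>[L\<^sub>r, L\<^sub>s] = \<delta>\<^bsub>r+s,0\<^esub> r C\<^bsub>r mod p\<^esub>\<close> is skew-symmetric only if
  \<open>C\<^sub>i = C\<^bsub>p-i\<^esub>\<close> for \<open>1 \<le> i \<le> p - 1\<close>. The elements \<open>Cg p i\<close>, \<open>0 \<le> i \<le> p - 1\<close>,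
  therefore satisfy exactly this relation: the basis vector representing both is
  \<open>CC (min i (p - i))\<close>. On a module the relation holds automatically, since
  \<open>[L\<^sub>r, L\<^bsub>-r\<^esub>]\<close> and \<open>- [L\<^bsub>-r\<^esub>, L\<^sub>r]\<close> act by the same operator.
\<close>

datatype gen = LL int | CC int

type_synonym galg = "gen \<Rightarrow>\<^sub>0 complex"

definition Lg :: "int \<Rightarrow> galg" where
  "Lg m = Poly_Mapping.single (LL m) 1"

definition Cg :: "int \<Rightarrow> int \<Rightarrow> galg" where
  "Cg p i = Poly_Mapping.single (CC (min i (p - i))) 1"

definition gap_virasoro :: "int \<Rightarrow> galg set" where
  "gap_virasoro p = pm.span (range Lg \<union> Cg p ` {0..p - 1})"

fun basis_bracket :: "int \<Rightarrow> gen \<Rightarrow> gen \<Rightarrow> galg" where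
  "basis_bracket p (LL m) (LL n) =
     (if p dvd m \<and> p dvd n then
        cscale (of_int (n - m)) (Lg (m + n))
        + (if m + n = 0
           then cscale ((1 / 12) * ((of_int m / of_int p) ^ 3 - of_int m / of_int p)) (Cg p 0)
           else 0)
      else if p dvd m then cscale (of_int n) (Lg (m + n))
      else if p dvd n then - cscale (of_int m) (Lg (n + m))
      else if m + n = 0 then cscale (of_int m) (Cg p (m mod p))
      else 0)"
| "basis_bracket p _ _ = 0"

definition bracket :: "int \<Rightarrow> galg \<Rightarrow> galg \<Rightarrow> galg" where
  "bracket p = bilin (basis_bracket p)"

lemma bracket_displayed:
  assumes "p > 1"
  shows "p dvd m \<Longrightarrow> p dvd n \<Longrightarrow> bracket p (Lg m) (Lg n) =
           cscale (of_int (n - m)) (Lg (m + n)) + (if m + n = 0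
             then cscale ((1 / 12) * ((of_int m / of_int p) ^ 3 - of_int m / of_int p)) (Cg p 0) else 0)"
    and "p dvd m \<Longrightarrow> \<not> p dvd r \<Longrightarrow> bracket p (Lg m) (Lg r) = cscale (of_int r) (Lg (m + r))"
    and "\<not> p dvd r \<Longrightarrow> \<not> p dvd s \<Longrightarrow> bracket p (Lg r) (Lg s) =
           (if r + s = 0 then cscale (of_int r) (Cg p (r mod p)) else 0)"
    and "bracket p (Cg p i) x = 0" and "bracket p x (Cg p i) = 0"
proof -
  show "bracket p (Cg p i) x = 0" "bracket p x (Cg p i) = 0"
    by (simp_all add: bracket_def bilin_def Cg_def)
qed (simp_all add: bracket_def Lg_def)

lemma Cg_sym: "Cg p (- r mod p) = Cg p (r mod p)" if "p > 1" "\<not> p dvd r"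
  using that by (simp add: Cg_def zmod_zminus1_eq_if dvd_eq_mod_eq_0 min.commute)

lemma basis_bracket_skew: "p > 1 \<Longrightarrow> basis_bracket p b a = - basis_bracket p a b"
proof -
  assume p: "p > 1"
  show ?thesis
  proof (cases a; cases b)
    fix m n assume [simp]: "a = LL m" "b = LL n"
    show ?thesis
    proof (cases "m + n = 0")
      case True
      then have [simp]: "n = - m" by simp
      show ?thesis using p Cg_sym[OF p, of m]
        by (auto intro!: poly_mapping_eqI simp: lookup_add algebra_simps)
    next
      case False
      then show ?thesis
        by (auto intro!: poly_mapping_eqI simp: lookup_add algebra_simps)
    qed
  qed auto
qed

lemma bracket_skew: "p > 1 \<Longrightarrow> bracket p y x = - bracket p x y"
proof (induction x rule: basis_induct)
  case (4 a)
  then show ?case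
    by (induction y rule: basis_induct)
      (simp_all add: bracket_def bilin_add_left bilin_add_right bilin_scale_left
        bilin_scale_right basis_bracket_skew[of p _ a])
qed (simp_all add: bracket_def bilin_add_left bilin_add_right bilin_scale_left bilin_scale_right)

lemma bracket_alternating: "p > 1 \<Longrightarrow> bracket p x x = 0"
proof -
  assume "p > 1"
  from bracket_skew[OF this, of x x] have "cscale 2 (bracket p x x) = 0"
    by (metis add.right_inverse one_add_one pm.scale_left_distrib pm.scale_one)
  then show ?thesis by simp
qed

lemmas bilin_simps = bilin_add_left bilin_add_right bilin_scale_left bilin_scale_right bilin_minus bilin_diff

lemma bracket_jacobi_basis:
  assumes p: "p > 1"
  shows "bracket p (Poly_Mapping.single a 1) (bracket p (Poly_Mapping.single b 1) (Poly_Mapping.single c 1)) =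
         bracket p (bracket p (Poly_Mapping.single a 1) (Poly_Mapping.single b 1)) (Poly_Mapping.single c 1)
       + bracket p (Poly_Mapping.single b 1) (bracket p (Poly_Mapping.single a 1) (Poly_Mapping.single c 1))"
proof -
  have CC: "bracket p (Poly_Mapping.single (CC i) 1) x = 0"
    "bracket p x (Poly_Mapping.single (CC i) 1) = 0" for i x
    by (simp_all add: bracket_def bilin_def)
  have LL: "Poly_Mapping.single (LL m) 1 = Lg m" for m
    by (simp add: Lg_def)
  have mixed: "bracket p (Lg r) (Lg m) = - cscale (of_int r) (Lg (m + r))"
    if "\<not> p dvd r" "p dvd m" for r m
    using that by (simp add: bracket_def Lg_def)
  note br = bracket_displayed[OF p] mixed
  have bl: "bracket p (x + y) z = bracket p x z + bracket p y z"
    "bracket p z (x + y) = bracket p z x + bracket p z y"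
    "bracket p (cscale d x) z = cscale d (bracket p x z)"
    "bracket p z (cscale d x) = cscale d (bracket p z x)"
    "bracket p (- x) z = - bracket p x z"
    "bracket p z (- x) = - bracket p z x"
    "bracket p (x - y) z = bracket p x z - bracket p y z"
    "bracket p z (x - y) = bracket p z x - bracket p z y"
    "bracket p 0 z = 0" "bracket p z 0 = 0" for x y z d
    by (simp_all add: bracket_def bilin_simps)
  have main: "bracket p (Lg m) (bracket p (Lg n) (Lg k)) =
      bracket p (bracket p (Lg m) (Lg n)) (Lg k) + bracket p (Lg n) (bracket p (Lg m) (Lg k))"
    for m n k
  proof (cases "m + n + k = 0")
    case True
    then have k: "k = - m - n" by simp
    have sub: "p dvd - m - n \<longleftrightarrow> p dvd m + n"
      by (metis dvd_minus_iff minus_add_distrib uminus_add_conv_diff diff_conv_add_uminus)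
    consider "p dvd m" "p dvd n" "p dvd m + n" | "p dvd m" "\<not> p dvd n" "\<not> p dvd m + n"
      | "\<not> p dvd m" "p dvd n" "\<not> p dvd m + n"
      | "\<not> p dvd m" "\<not> p dvd n" "\<not> p dvd m + n"
      | "\<not> p dvd m" "\<not> p dvd n" "p dvd m + n"
      by (metis dvd_add dvd_add_right_iff dvd_add_left_iff)
    then show ?thesis
    proof cases
      case 1
      consider "n = - m" | "n = 0" "m \<noteq> 0" | "m = 0" "n \<noteq> 0" | "m + n \<noteq> 0" "n \<noteq> 0" "m \<noteq> 0" by linarith
      then show ?thesis unfolding k using 1 p
        by cases (auto intro!: poly_mapping_eqI
            simp: br bl sub lookup_add lookup_minus power3_eq_cube field_simps)
    next
      case 2
      then show ?thesis unfolding k using p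
        by (auto intro!: poly_mapping_eqI simp: br bl sub lookup_add lookup_minus algebra_simps)
    next
      case 3
      then show ?thesis unfolding k using p
        by (auto intro!: poly_mapping_eqI simp: br bl sub lookup_add lookup_minus algebra_simps)
    next
      case 4
      then show ?thesis unfolding k using p
        by (auto intro!: poly_mapping_eqI simp: br bl sub lookup_add lookup_minus algebra_simps)
    next
      case 5
      then have "n mod p = - m mod p" by (simp add: mod_eq_dvd_iff add.commute)
      then have "Cg p (n mod p) = Cg p (m mod p)" using Cg_sym[OF p] 5 by simp
      then show ?thesis unfolding k using 5 p
        by (auto intro!: poly_mapping_eqI simp: br bl sub lookup_add lookup_minus algebra_simps)
    qed
  next
    case False
    then have F: "m + (n + k) \<noteq> 0" "n + (m + k) \<noteq> 0" "m + n + k \<noteq> 0" "k + (m + n) \<noteq> 0" by auto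
    show ?thesis using F
      by (cases "p dvd m"; cases "p dvd n"; cases "p dvd k";
          cases "p dvd m + n"; cases "p dvd m + k"; cases "p dvd n + k")
        (auto intro!: poly_mapping_eqI
          simp: br bl dvd_add_right_iff dvd_add_left_iff lookup_add lookup_minus algebra_simps)
  qed
  show ?thesis
  proof (cases a; cases b; cases c)
    fix m n k assume "a = LL m" "b = LL n" "c = LL k"
    then show ?thesis using main[of m n k] by (simp only: LL)
  qed (simp_all add: CC bl)
qed

lemma bracket_jacobi:
  assumes "p > 1"
  shows "bracket p x (bracket p y z) = bracket p (bracket p x y) z + bracket p y (bracket p x z)"
proof (induction x rule: basis_induct)
  case (4 a)
  show ?case
  proof (induction y rule: basis_induct)
    case (4 b)
    show ?case
    proof (induction z rule: basis_induct)
      case (4 c)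
      show ?case by (rule bracket_jacobi_basis[OF assms])
    qed (simp_all add: bracket_def bilin_simps algebra_simps pm.scale_right_distrib)
  qed (simp_all add: bracket_def bilin_simps algebra_simps pm.scale_right_distrib)
qed (simp_all add: bracket_def bilin_simps algebra_simps pm.scale_right_distrib)

lemma bilin_span:
  assumes "\<And>a b. a \<in> A \<Longrightarrow> b \<in> B \<Longrightarrow> bilin f a b \<in> pm.span C"
    and "x \<in> pm.span A" "y \<in> pm.span B"
  shows "bilin f x y \<in> pm.span C"
proof -
  have "bilin f a y \<in> pm.span C" if "a \<in> A" for a
    using assms(3)
    by (rule pm.span_induct)
      (auto simp: assms(1) that bilin_simps pm.subspace_def intro: pm.span_zero pm.span_add pm.span_scale)
  then show ?thesis using assms(2)
    by (elim pm.span_induct)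
      (auto simp: bilin_simps pm.subspace_def intro: pm.span_zero pm.span_add pm.span_scale)
qed

lemma bracket_closed:
  assumes "p > 1" "x \<in> gap_virasoro p" "y \<in> gap_virasoro p"
  shows "bracket p x y \<in> gap_virasoro p"
  unfolding gap_virasoro_def bracket_def
proof (rule bilin_span)
  show "x \<in> pm.span (range Lg \<union> Cg p ` {0..p - 1})" "y \<in> pm.span (range Lg \<union> Cg p ` {0..p - 1})"
    using assms by (simp_all add: gap_virasoro_def)
next
  have L: "Lg n \<in> pm.span (range Lg \<union> Cg p ` {0..p - 1})" for n
    by (simp add: pm.span_base)
  have C: "Cg p i \<in> pm.span (range Lg \<union> Cg p ` {0..p - 1})" if "0 \<le> i" "i < p" for i
    using that by (simp add: pm.span_base)
  have LL: "bilin (basis_bracket p) (Lg m) (Lg n) \<in> pm.span (range Lg \<union> Cg p ` {0..p - 1})" for m n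
    using L C assms(1)
    by (auto simp: Lg_def[of m] Lg_def[of n] intro!: pm.span_add pm.span_scale pm.span_neg pm.span_zero)
  fix a b assume "a \<in> range Lg \<union> Cg p ` {0..p - 1}" "b \<in> range Lg \<union> Cg p ` {0..p - 1}"
  then show "bilin (basis_bracket p) a b \<in> pm.span (range Lg \<union> Cg p ` {0..p - 1})"
    using LL bracket_displayed(4,5)[OF assms(1)] by (auto simp: bracket_def pm.span_zero)
qed

definition cartan :: "int \<Rightarrow> galg set" where
  "cartan p = pm.span (insert (Lg 0) (Cg p ` {0..p - 1}))"


section \<open>Modules\<close>

text \<open>
  A module is a subspace \<open>V\<close> of an ambient complex vector space (with scalar multiplication
  \<open>scale\<close>) together with an action of the algebra; the action is only relevant on
  \<open>gap_virasoro p\<close> and \<open>V\<close>.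
\<close>

definition gv_module ::
    "int \<Rightarrow> (complex \<Rightarrow> 'v::ab_group_add \<Rightarrow> 'v) \<Rightarrow> 'v set \<Rightarrow> (galg \<Rightarrow> 'v \<Rightarrow> 'v) \<Rightarrow> bool" where
  "gv_module p scale V act \<longleftrightarrow>
     vector_space scale \<and> module.subspace scale V \<and>
     (\<forall>x\<in>gap_virasoro p. \<forall>v\<in>V. act x v \<in> V) \<and>
     (\<forall>x\<in>gap_virasoro p. \<forall>y\<in>gap_virasoro p. \<forall>v\<in>V. act (x + y) v = act x v + act y v) \<and>
     (\<forall>c. \<forall>x\<in>gap_virasoro p. \<forall>v\<in>V. act (cscale c x) v = scale c (act x v)) \<and>
     (\<forall>x\<in>gap_virasoro p. \<forall>v\<in>V. \<forall>w\<in>V. act x (v + w) = act x v + act x w) \<and>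
     (\<forall>c. \<forall>x\<in>gap_virasoro p. \<forall>v\<in>V. act x (scale c v) = scale c (act x v)) \<and>
     (\<forall>x\<in>gap_virasoro p. \<forall>y\<in>gap_virasoro p. \<forall>v\<in>V.
        act (bracket p x y) v = act x (act y v) - act y (act x v))"

definition submodule ::
    "int \<Rightarrow> (complex \<Rightarrow> 'v::ab_group_add \<Rightarrow> 'v) \<Rightarrow> 'v set \<Rightarrow> (galg \<Rightarrow> 'v \<Rightarrow> 'v) \<Rightarrow> 'v set \<Rightarrow> bool" where
  "submodule p scale V act W \<longleftrightarrow>
     W \<subseteq> V \<and> module.subspace scale W \<and> (\<forall>x\<in>gap_virasoro p. \<forall>w\<in>W. act x w \<in> W)"

definition irreducible_module ::
    "int \<Rightarrow> (complex \<Rightarrow> 'v::ab_group_add \<Rightarrow> 'v) \<Rightarrow> 'v set \<Rightarrow> (galg \<Rightarrow> 'v \<Rightarrow> 'v) \<Rightarrow> bool" where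
  "irreducible_module p scale V act \<longleftrightarrow>
     gv_module p scale V act \<and> V \<noteq> {0} \<and>
     (\<forall>W. submodule p scale V act W \<longrightarrow> W = {0} \<or> W = V)"

definition weight_space ::
    "int \<Rightarrow> (complex \<Rightarrow> 'v::ab_group_add \<Rightarrow> 'v) \<Rightarrow> 'v set \<Rightarrow> (galg \<Rightarrow> 'v \<Rightarrow> 'v) \<Rightarrow>
     (galg \<Rightarrow> complex) \<Rightarrow> 'v set" where
  "weight_space p scale V act \<mu> = {v \<in> V. \<forall>x\<in>cartan p. act x v = scale (\<mu> x) v}"

text \<open>
  \<open>dim\<close> is not used for the bound on the weight spaces because it is \<open>0\<close> on
  infinite-dimensional spaces.
\<close>

definition intermediate_series ::
    "int \<Rightarrow> (complex \<Rightarrow> 'v::ab_group_add \<Rightarrow> 'v) \<Rightarrow> 'v set \<Rightarrow> (galg \<Rightarrow> 'v \<Rightarrow> 'v) \<Rightarrow> bool" where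
  "intermediate_series p scale V act \<longleftrightarrow>
     gv_module p scale V act \<and>
     module.span scale (\<Union>\<mu>. weight_space p scale V act \<mu>) = V \<and>
     (\<forall>\<mu>. \<exists>w. weight_space p scale V act \<mu> \<subseteq> module.span scale {w})"

definition coset :: "'w::ab_group_add set \<Rightarrow> 'w \<Rightarrow> 'w set" where
  "coset N x = (\<lambda>n. x + n) ` N"

text \<open>\<open>iso_quotient p scale V act scale' M act' N\<close>: the module \<open>V\<close> is isomorphic to \<open>M / N\<close>.\<close>

definition iso_quotient ::
    "int \<Rightarrow> (complex \<Rightarrow> 'v::ab_group_add \<Rightarrow> 'v) \<Rightarrow> 'v set \<Rightarrow> (galg \<Rightarrow> 'v \<Rightarrow> 'v) \<Rightarrow>
     (complex \<Rightarrow> 'w::ab_group_add \<Rightarrow> 'w) \<Rightarrow> 'w set \<Rightarrow> (galg \<Rightarrow> 'w \<Rightarrow> 'w) \<Rightarrow> 'w set \<Rightarrow> bool" where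
  "iso_quotient p scale V act scale' M act' N \<longleftrightarrow>
     (\<exists>h. bij_betw h (coset N ` M) V \<and>
        (\<forall>x\<in>M. \<forall>y\<in>M. h (coset N (x + y)) = h (coset N x) + h (coset N y)) \<and>
        (\<forall>c. \<forall>x\<in>M. h (coset N (scale' c x)) = scale c (h (coset N x))) \<and>
        (\<forall>g\<in>gap_virasoro p. \<forall>x\<in>M. h (coset N (act' g x)) = act g (h (coset N x))))"

definition iso_subquotient ::
    "int \<Rightarrow> (complex \<Rightarrow> 'v::ab_group_add \<Rightarrow> 'v) \<Rightarrow> 'v set \<Rightarrow> (galg \<Rightarrow> 'v \<Rightarrow> 'v) \<Rightarrow>
     (complex \<Rightarrow> 'w::ab_group_add \<Rightarrow> 'w) \<Rightarrow> 'w set \<Rightarrow> (galg \<Rightarrow> 'w \<Rightarrow> 'w) \<Rightarrow> bool" where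
  "iso_subquotient p scale V act scale' X act' \<longleftrightarrow>
     (\<exists>M N. submodule p scale' X act' M \<and> submodule p scale' X act' N \<and> N \<subseteq> M \<and>
        iso_quotient p scale V act scale' M act' N)"


section \<open>The modules \<open>V(\<alpha>, \<beta>, F)\<close>\<close>

text \<open>
  A matrix is a function \<open>F\<close> of which only the entries \<open>F i j\<close> with \<open>1 \<le> i \<le> p - 1\<close> and
  \<open>0 \<le> j \<le> p - 1\<close> matter.

  With \<open>o(F) = {j. \<exists>i. F i j \<noteq> 0}\<close> for every \<open>F\<close>, conditions (I) and (II) would rule out
  \<open>o(F) = {0}\<close> (if \<open>F i 0 \<noteq> 0\<close> then \<open>i \<in> o(F)\<close>), although the modules
  \<open>V(\<alpha>, \<beta>, F) = V\<^sub>0(\<alpha>, \<beta>)\<close> with \<open>o(F) = {0}\<close> belong to the family, and the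
  classification fails without them. In \<open>V\<^sub>0(\<alpha>, \<beta>)\<close> every \<open>L\<^sub>s\<close> with \<open>s\<close> not divisible
  by \<open>p\<close> acts by zero, that is, \<open>F = 0\<close>; so the convention is \<open>o(0) = {0}\<close>.
\<close>

definition zero_matrix :: "int \<Rightarrow> (int \<Rightarrow> int \<Rightarrow> complex) \<Rightarrow> bool" where
  "zero_matrix p F \<longleftrightarrow> (\<forall>i\<in>{1..p - 1}. \<forall>j\<in>{0..p - 1}. F i j = 0)"

definition oF :: "int \<Rightarrow> (int \<Rightarrow> int \<Rightarrow> complex) \<Rightarrow> int set" where
  "oF p F = (if zero_matrix p F then {0} else {j\<in>{0..p - 1}. \<exists>i\<in>{1..p - 1}. F i j \<noteq> 0})"

definition cond_I :: "int \<Rightarrow> (int \<Rightarrow> int \<Rightarrow> complex) \<Rightarrow> bool" where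
  "cond_I p F \<longleftrightarrow> 0 \<in> oF p F"

definition cond_II :: "int \<Rightarrow> (int \<Rightarrow> int \<Rightarrow> complex) \<Rightarrow> bool" where
  "cond_II p F \<longleftrightarrow> (\<forall>i\<in>{1..p - 1}. \<forall>j\<in>{0..p - 1}. F i j \<noteq> 0 \<longrightarrow>
     (\<exists>s\<in>{1..p - 1}. F s ((i + j) mod p) \<noteq> 0))"

definition cond_III :: "int \<Rightarrow> (int \<Rightarrow> int \<Rightarrow> complex) \<Rightarrow> bool" where
  "cond_III p F \<longleftrightarrow> (\<forall>i\<in>{0..p - 1}. \<forall>r\<in>{1..p - 1}. \<forall>s\<in>{1..p - 1}.
     F r ((i + s) mod p) * F s i = F s ((i + r) mod p) * F r i)"

definition VF :: "int \<Rightarrow> (int \<Rightarrow> int \<Rightarrow> complex) \<Rightarrow> (int \<Rightarrow>\<^sub>0 complex) set" where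
  "VF p F = pm.span {Poly_Mapping.single (j + p * k) 1 | j k. j \<in> oF p F}"

fun VF_basis_act ::
    "int \<Rightarrow> complex \<Rightarrow> complex \<Rightarrow> (int \<Rightarrow> int \<Rightarrow> complex) \<Rightarrow> gen \<Rightarrow> int \<Rightarrow> (int \<Rightarrow>\<^sub>0 complex)" where
  "VF_basis_act p \<alpha> \<beta> F (LL m) k =
     (if p dvd m then Poly_Mapping.single (k + m) (\<alpha> + of_int k + of_int m * \<beta>)
      else Poly_Mapping.single (k + m) (F (m mod p) (k mod p)))"
| "VF_basis_act p \<alpha> \<beta> F (CC i) k = 0"

definition VF_act ::
    "int \<Rightarrow> complex \<Rightarrow> complex \<Rightarrow> (int \<Rightarrow> int \<Rightarrow> complex) \<Rightarrow> galg \<Rightarrow> (int \<Rightarrow>\<^sub>0 complex) \<Rightarrow> (int \<Rightarrow>\<^sub>0 complex)" where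
  "VF_act p \<alpha> \<beta> F = bilin (VF_basis_act p \<alpha> \<beta> F)"

lemma residue_range:
  assumes "(p::int) > 1"
  shows "i mod p \<in> {0..p - 1}" "\<not> p dvd i \<Longrightarrow> i mod p \<in> {1..p - 1}"
proof -
  have "0 \<le> i mod p" "i mod p < p" using assms by simp_all
  then show "i mod p \<in> {0..p - 1}" "\<not> p dvd i \<Longrightarrow> i mod p \<in> {1..p - 1}"
    unfolding dvd_eq_mod_eq_0 atLeastAtMost_iff by linarith+
qed

lemma VF_act_bracket:
  assumes p: "p > 1" and III: "cond_III p F"
  shows "VF_act p \<alpha> \<beta> F (bracket p x y) v =
    VF_act p \<alpha> \<beta> F x (VF_act p \<alpha> \<beta> F y v) - VF_act p \<alpha> \<beta> F y (VF_act p \<alpha> \<beta> F x v)"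
proof -
  let ?A = "VF_act p \<alpha> \<beta> F"
  have C: "?A (Poly_Mapping.single (CC i) c) v = 0" for i c v
    by (simp add: VF_act_def bilin_def)
  have sgl: "?A (Poly_Mapping.single (LL m) 1) (Poly_Mapping.single k c) =
      cscale c (VF_basis_act p \<alpha> \<beta> F (LL m) k)" for m k c
    by (subst single_conv_cscale) (simp add: VF_act_def bilin_scale_right)
  have III': "F (r mod p) ((i + s) mod p) * F (s mod p) (i mod p) =
      F (s mod p) ((i + r) mod p) * F (r mod p) (i mod p)"
    if "\<not> p dvd r" "\<not> p dvd s" for r s i
  proof -
    have "r mod p \<in> {1..p - 1}" "s mod p \<in> {1..p - 1}" "i mod p \<in> {0..p - 1}"
      using residue_range[OF p] that by blast+
    from III[unfolded cond_III_def, rule_format, OF this(3,1,2)] show ?thesis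
      by (simp add: mod_add_eq)
  qed
  have mixed: "bracket p (Lg r) (Lg m) = - cscale (of_int r) (Lg (m + r))"
    if "\<not> p dvd r" "p dvd m" for r m
    using that by (simp add: bracket_def Lg_def)
  have LLL: "?A (bracket p (Lg m) (Lg n)) (Poly_Mapping.single k 1) =
      ?A (Lg m) (?A (Lg n) (Poly_Mapping.single k 1)) - ?A (Lg n) (?A (Lg m) (Poly_Mapping.single k 1))"
    for m n k
  proof -
    have AL: "?A (Lg m) (Poly_Mapping.single k c) = cscale c (VF_basis_act p \<alpha> \<beta> F (LL m) k)" for m k c
      by (simp add: Lg_def sgl)
    have AC: "?A (Cg p i) v = 0" for i v by (simp add: Cg_def C)
    have lin: "?A (x + y) v = ?A x v + ?A y v" "?A (cscale c x) v = cscale c (?A x v)"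
      "?A (- x) v = - ?A x v" "?A (x - y) v = ?A x v - ?A y v" "?A 0 v = 0" for x y v c
      by (simp_all add: VF_act_def bilin_simps)
    have md: "(i + m) mod p = i mod p" if "p dvd m" for i m
      using that by (metis dvd_eq_mod_eq_0 add.right_neutral mod_add_right_eq)
    note br = bracket_displayed(1-3)[OF p] mixed
    consider "p dvd m" "p dvd n" | "p dvd m" "\<not> p dvd n" | "\<not> p dvd m" "p dvd n"
      | "\<not> p dvd m" "\<not> p dvd n" by blast
    then show ?thesis
    proof cases
      case 1
      show ?thesis using 1
        by (cases "n = - m") (auto intro!: poly_mapping_eqI simp: br AL AC lin lookup_add lookup_minus
            lookup_single when_def algebra_simps)
    next
      case 2
      then show ?thesis using md[of m n]
        by (auto intro!: poly_mapping_eqI simp: br AL AC lin md lookup_add lookup_minus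
            lookup_single when_def algebra_simps)
    next
      case 3
      then show ?thesis using md[of n m]
        by (auto intro!: poly_mapping_eqI simp: br AL AC lin md lookup_add lookup_minus
            lookup_single when_def algebra_simps)
    next
      case 4
      then show ?thesis using III'[of m n k]
        by (auto intro!: poly_mapping_eqI simp: br AL AC lin lookup_minus
            lookup_single when_def ac_simps)
    qed
  qed
  have basis: "?A (bracket p (Poly_Mapping.single a 1) (Poly_Mapping.single b 1)) (Poly_Mapping.single k 1) =
      ?A (Poly_Mapping.single a 1) (?A (Poly_Mapping.single b 1) (Poly_Mapping.single k 1))
    - ?A (Poly_Mapping.single b 1) (?A (Poly_Mapping.single a 1) (Poly_Mapping.single k 1))" for a b k
  proof (cases a; cases b)
    fix m n assume "a = LL m" "b = LL n"
    then show ?thesis using LLL[of m n k] by (simp add: Lg_def)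
  qed (simp_all add: C bracket_def, simp_all add: VF_act_def)
  show ?thesis
  proof (induction x rule: basis_induct)
    case (4 a)
    show ?case
    proof (induction y rule: basis_induct)
      case (4 b)
      show ?case
      proof (induction v rule: basis_induct)
        case (4 k)
        show ?case by (rule basis)
      qed (simp_all add: VF_act_def bilin_simps pm.scale_right_diff_distrib add_diff_add)
    qed (simp_all add: VF_act_def bracket_def bilin_simps pm.scale_right_diff_distrib add_diff_add)
  qed (simp_all add: VF_act_def bracket_def bilin_simps pm.scale_right_diff_distrib add_diff_add)
qed

lemma VF_module:
  assumes p: "p > 1" and II: "cond_II p F" and III: "cond_III p F"
  shows "gv_module p cscale (VF p F) (VF_act p \<alpha> \<beta> F)"
proof -
  define S :: "(int \<Rightarrow>\<^sub>0 complex) set" where "S = {Poly_Mapping.single (j + p * k) 1 | j k. j \<in> oF p F}"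
  have VF: "VF p F = pm.span S" by (simp add: VF_def S_def)
  have mem: "Poly_Mapping.single n c \<in> pm.span S" if "n mod p \<in> oF p F" for n c
  proof -
    have "n = n mod p + p * (n div p)" by simp
    then have "Poly_Mapping.single n 1 \<in> S" using that unfolding S_def by (smt (verit) mem_Collect_eq)
    then show ?thesis by (subst single_conv_cscale) (rule pm.span_scale, rule pm.span_base)
  qed
  have sub: "oF p F \<subseteq> {0..p - 1}" using p by (auto simp: oF_def)
  have "VF_act p \<alpha> \<beta> F x v \<in> VF p F" if "x \<in> gap_virasoro p" "v \<in> VF p F" for x v
    unfolding VF VF_act_def
  proof (rule bilin_span[OF _ that[unfolded VF gap_virasoro_def]])
    fix a b assume a: "a \<in> range Lg \<union> Cg p ` {0..p - 1}" and "b \<in> S"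
    then obtain j k where b: "b = Poly_Mapping.single (j + p * k) 1" and j: "j \<in> oF p F" unfolding S_def by blast
    have jm: "j mod p = j" using j sub p by (auto intro!: mod_pos_pos_trivial)
    show "bilin (VF_basis_act p \<alpha> \<beta> F) a b \<in> pm.span S"
    proof (cases "a \<in> range Lg")
      case True
      then obtain m where m: "a = Lg m" by blast
      show ?thesis
      proof (cases "p dvd m")
        case True
        then have "(j + p * k + m) mod p = j" using jm
          by (metis dvd_eq_mod_eq_0 add.right_neutral mod_add_right_eq mod_mult_self2)
        then show ?thesis using True j by (simp add: m b Lg_def mem)
      next
        case False
        show ?thesis
        proof (cases "F (m mod p) j = 0")
          case True
          then show ?thesis using False jm by (simp add: m b Lg_def pm.span_zero)
        next
          case nz: False
          have m1: "m mod p \<in> {1..p - 1}"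
            using residue_range[OF p] False by blast
          have "(j + p * k + m) mod p = (m mod p + j) mod p"
            by (metis add.commute mod_add_left_eq mod_mult_self2)
          moreover have "(m mod p + j) mod p \<in> oF p F"
          proof -
            obtain s where s: "s \<in> {1..p - 1}" "F s ((m mod p + j) mod p) \<noteq> 0"
              using II m1 nz j sub unfolding cond_II_def by blast
            moreover have "\<not> zero_matrix p F"
              using s residue_range(1)[OF p] unfolding zero_matrix_def by blast
            ultimately show ?thesis using residue_range(1)[OF p] unfolding oF_def by auto
          qed
          ultimately show ?thesis using False jm by (simp add: m b Lg_def mem)
        qed
      qed
    next
      case False
      then show ?thesis using a by (auto simp: Cg_def b pm.span_zero)
    qed
  qed
  then show ?thesis
    using VF_act_bracket[OF p III]
    by (auto simp: gv_module_def VF VF_act_def bilin_simps pm.vector_space_axioms)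
qed

end

theory Submission
  imports Defs "HOL-Computational_Algebra.Polynomial"
begin

text \<open>
  Choose a vector \<open>e\<^sub>k\<close> in each weight space \<open>h + k\<close>; a module of the series becomes an array of
  scalars \<open>L\<^sub>m e\<^sub>k = \<phi> m k e\<^bsub>k+m\<^esub>\<close>, and irreducibility says that the graph of nonzero \<open>\<phi> m k\<close> is
  strongly connected. The key point is that operators of degree \<open>0\<close> act by scalars on the \<open>e\<^sub>k\<close> and
  hence commute. Let \<open>T\<close> be the span of the \<open>L\<^sub>r\<close>, \<open>r \<notin> p\<int>\<close>. Heisenberg ladders show that the \<open>C\<^sub>i\<close>,
  \<open>i \<noteq> 0\<close>, act by \<open>0\<close>, so \<open>T\<close> acts by commuting operators, and a monomial
  \<open>L\<^sub>a\<^bsup>x\<^esup> L\<^sub>b\<^bsup>y\<^esup>\<close> of degree \<open>0\<close> with \<open>L\<^sub>a\<close> not injective must vanish. Applying \<open>ad L\<^bsub>b-a\<^esub>\<close>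
  repeatedly gives \<open>L\<^sub>b\<^bsup>N\<^esup> = 0\<close> and then kills the whole class of \<open>a\<close> modulo \<open>p\<close>. So every class
  acts by \<open>0\<close> or bijectively between weight spaces.

  If some class is nonzero, the shift operator \<open>L\<^bsub>s+p\<^esub> L\<^sub>s\<^sup>-\<^sup>1\<close> commutes with \<open>T\<close>, which forces
  \<open>L\<^sub>m e\<^sub>k = (\<alpha> + k + m \<beta>) e\<^bsub>k+m\<^esub>\<close> and periodicity of the other coefficients after rescaling the
  \<open>e\<^sub>k\<close>. If \<open>T\<close> acts by \<open>0\<close>, the module is a Virasoro module with one-dimensional weight spaces: by
  \<open>sl\<^sub>2\<close>-theory it is trivial or has all weights on a ray, the action far out on the ray is that of
  a density module, and reading off \<open>L\<^sub>n x\<close> for large \<open>n\<close> embeds the whole module into it. In all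
  cases \<open>V\<close> is isomorphic to a submodule of \<open>V(\<alpha>, \<beta>, F)\<close>.
\<close>

section \<open>Virasoro modules with one-dimensional weight spaces\<close>

lemma poly_vanishing_on_ray:
  fixes P :: "complex poly"
  assumes "\<And>k::int. k \<ge> k1 \<Longrightarrow> poly P (z + of_int k) = 0"
  shows "P = 0"
proof (rule ccontr)
  assume "P \<noteq> 0"
  then have "finite {x. poly P x = 0}" by (rule poly_roots_finite)
  moreover have "(\<lambda>k. z + of_int k) ` {k1..} \<subseteq> {x. poly P x = 0}" using assms by auto
  ultimately have "finite ((\<lambda>k. z + of_int k) ` {k1..})" by (rule finite_subset[rotated])
  then have "finite {k1..}" by (rule finite_imageD) (auto simp: inj_on_def)
  then show False by (simp add: infinite_Ici)
qed

text \<open>Rescaling the weight vectors by \<open>g\<close> divides the coefficient of the step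
  from \<open>k\<close> to \<open>k + 1\<close> by \<open>\<rho> k\<close>; this is how nonzero
  coefficients of such steps are given prescribed values.\<close>

lemma multiplicative_primitive:
  fixes \<rho> :: "int \<Rightarrow> complex"
  assumes "\<And>k. \<rho> k \<noteq> 0"
  obtains g where "\<And>k. g k \<noteq> 0" "\<And>k. g (k + 1) = \<rho> k * g k"
proof
  define g where "g k = (if k \<ge> 0 then \<Prod>i<nat k. \<rho> (int i) else 1 / (\<Prod>i<nat (- k). \<rho> (- 1 - int i)))" for k :: int
  show "g k \<noteq> 0" for k using assms by (simp add: g_def)
  show "g (k + 1) = \<rho> k * g k" for k
  proof (cases "k \<ge> 0")
    case True
    then have "nat (k + 1) = Suc (nat k)" by simp
    then show ?thesis using True by (simp add: g_def)
  next
    case False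
    define j where "j = nat (- k) - 1"
    have j: "nat (- k) = Suc j" "nat (- (k + 1)) = j" "k = - 1 - int j" using False by (auto simp: j_def)
    show ?thesis
    proof (cases "k = -1")
      case True
      then show ?thesis using assms by (simp add: g_def)
    next
      case False
      then have "\<not> k + 1 \<ge> 0" using \<open>\<not> k \<ge> 0\<close> by simp
      then show ?thesis using \<open>\<not> k \<ge> 0\<close> j assms[of k] by (simp add: g_def)
    qed
  qed
qed

lemma multiplicative_primitive_step:
  fixes \<rho> :: "int \<Rightarrow> complex"
  assumes "p > 0" "\<And>k. \<rho> k \<noteq> 0"
  obtains g where "\<And>k. g k \<noteq> 0" "\<And>k. g (k + p) = \<rho> k * g k"
proof -
  have "\<exists>G. (\<forall>n. G n \<noteq> 0) \<and> (\<forall>n. G (n + 1) = \<rho> (j + p * n) * G n)" for j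
    using multiplicative_primitive[of "\<lambda>n. \<rho> (j + p * n)"] assms by metis
  then obtain G where G: "\<And>j n. G j n \<noteq> 0" "\<And>j n. G j (n + 1) = \<rho> (j + p * n) * G j n" by metis
  show ?thesis
  proof
    show "G (k mod p) (k div p) \<noteq> 0" for k by (rule G)
    show "G ((k + p) mod p) ((k + p) div p) = \<rho> k * G (k mod p) (k div p)" for k
      using G(2)[of "k mod p" "k div p"] assms by simp
  qed
qed

text \<open>The relation \<open>6 [e\<^sub>2, e\<^sub>3] = [e\<^sub>1, [e\<^sub>1, [e\<^sub>1, e\<^sub>2]]]\<close> on a ray, for \<open>e\<^sub>1\<close> and \<open>e\<^sub>2\<close> as in
  \<open>germ_on_ray\<close> below: it leaves two values for the free constant \<open>D\<close>, one for \<open>\<beta>\<close> and one for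
  \<open>1 - \<beta>\<close>.\<close>

lemma germ_identity:
  fixes t b D :: complex
  assumes "t + 1 \<noteq> 0" "t + 2 \<noteq> 0" "t + 3 \<noteq> 0" "t + 4 \<noteq> 0" "t + 5 \<noteq> 0"
  defines "a \<equiv> \<lambda>i::int. t + of_int i + 2 * b"
    and "x \<equiv> \<lambda>i::int. t + of_int i + 3 * b + D / ((t + of_int i + 1) * (t + of_int i + 2))"
  defines "y \<equiv> \<lambda>i. a (i + 2) * x i - x (i + 1) * a i"
  shows "6 * (x 3 * y 0 - y 2 * x 0) - (a 4 * (a 3 * y 0 - y 1 * a 0) - (a 4 * y 1 - y 2 * a 1) * a 0) =
    - 48 * D * (D - 2 * b * (1 - b) * (2 * b - 1)) / ((t + 1) * (t + 2) * (t + 3) * (t + 4) * (t + 5))"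
  unfolding y_def a_def x_def using assms(1-5)
  apply (simp add: add.assoc)
  apply (simp add: divide_simps)
  apply algebra
  done

text \<open>\<open>e m k\<close> is the coefficient of the vector of weight \<open>a + k + m\<close> in the image under \<open>L\<^sub>m\<close> of the vector
  of weight \<open>a + k\<close>; \<open>S\<close> is the set of occurring \<open>k\<close>. Invariant subsets of \<open>S\<close> correspond to
  submodules because all submodules are graded.\<close>

locale vir_weights =
  fixes S :: "int set" and e :: "int \<Rightarrow> int \<Rightarrow> complex" and a c :: complex
  assumes supp: "e m k \<noteq> 0 \<Longrightarrow> k \<in> S \<and> k + m \<in> S"
    and weight: "k \<in> S \<Longrightarrow> e 0 k = a + of_int k"
    and comm: "k \<in> S \<Longrightarrow> e m (k + n) * e n k - e n (k + m) * e m k =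
        of_int (n - m) * e (m + n) k + (if m + n = 0 then (of_int m ^ 3 - of_int m) * c else 0)"
    and irr: "U \<subseteq> S \<Longrightarrow> U \<noteq> {} \<Longrightarrow> (\<And>k m. k \<in> U \<Longrightarrow> e m k \<noteq> 0 \<Longrightarrow> k + m \<in> U) \<Longrightarrow> U = S"
    and nonempty: "S \<noteq> {}"
begin

section \<open>Symmetries of the weight coefficients, and extension from a ray\<close>

text \<open>Every composite from \<open>k\<close> to \<open>k + (m + n)\<close> acquires the same
  factor \<open>g k / g (k + (m + n))\<close>. It is 1 for \<open>m + n = 0\<close>, so the central
  term is unchanged.\<close>

lemma gauge:
  assumes g: "\<And>k. g k \<noteq> 0"
  shows "vir_weights S (\<lambda>m k. e m k * g k / g (k + m)) a c"
proof
  fix k m n assume k: "k \<in> S"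
  have "e m (k + n) * g (k + n) / g (k + n + m) * (e n k * g k / g (k + n)) -
      e n (k + m) * g (k + m) / g (k + m + n) * (e m k * g k / g (k + m)) =
      (e m (k + n) * e n k - e n (k + m) * e m k) * (g k / g (k + (m + n)))"
    using g by (simp add: field_simps add_ac)
  also have "\<dots> = of_int (n - m) * (e (m + n) k * g k / g (k + (m + n))) +
      (if m + n = 0 then (of_int m ^ 3 - of_int m) * c else 0)"
    unfolding comm[OF k] using g by (simp add: field_simps)
  finally show "e m (k + n) * g (k + n) / g (k + n + m) * (e n k * g k / g (k + n)) -
      e n (k + m) * g (k + m) / g (k + m + n) * (e m k * g k / g (k + m)) =
      of_int (n - m) * (e (m + n) k * g k / g (k + (m + n))) +
      (if m + n = 0 then (of_int m ^ 3 - of_int m) * c else 0)" .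
next
  fix U assume "U \<subseteq> S" "U \<noteq> {}" "\<And>k m. k \<in> U \<Longrightarrow> e m k * g k / g (k + m) \<noteq> 0 \<Longrightarrow> k + m \<in> U"
  then show "U = S" using g by (intro irr) auto
qed (use g supp weight nonempty in auto)

text \<open>Twist by the automorphism sending \<open>L_m\<close> to \<open>- L_(-m)\<close> and the
  centre to its negative; it turns a left ray of weights into a right ray.\<close>

lemma reflect: "vir_weights (uminus ` S) (\<lambda>m k. - e (- m) (- k)) (- a) (- c)"
proof
  fix k m n assume "k \<in> uminus ` S"
  then have k: "- k \<in> S" by auto
  show "- e (- m) (- (k + n)) * - e (- n) (- k) - - e (- n) (- (k + m)) * - e (- m) (- k) =
      of_int (n - m) * - e (- (m + n)) (- k) + (if m + n = 0 then (of_int m ^ 3 - of_int m) * - c else 0)"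
    using comm[OF k, of "- m" "- n"] by (auto simp: algebra_simps)
next
  fix U assume U: "U \<subseteq> uminus ` S" "U \<noteq> {}" "\<And>k m. k \<in> U \<Longrightarrow> - e (- m) (- k) \<noteq> 0 \<Longrightarrow> k + m \<in> U"
  have "uminus ` U = S"
  proof (rule irr)
    fix k m assume "k \<in> uminus ` U" "e m k \<noteq> 0"
    then have "- k + (- m) \<in> U" using U(3)[of "- k" "- m"] by auto
    then have "- (- k + (- m)) \<in> uminus ` U" by (rule imageI)
    then show "k + m \<in> uminus ` U" by (simp add: add.commute)
  qed (use U in auto)
  then have "uminus ` uminus ` U = uminus ` S" by simp
  then show "U = uminus ` S" by (simp add: image_image)
next
  fix m k assume "- e (- m) (- k) \<noteq> 0"
  then have "- k \<in> S" "- (k + m) \<in> S" using supp[of "- m" "- k"] by auto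
  then have "- (- k) \<in> uminus ` S" "- (- (k + m)) \<in> uminus ` S" by blast+
  then show "k \<in> uminus ` S \<and> k + m \<in> uminus ` S" by (simp only: minus_minus)
qed (use weight nonempty in auto)

text \<open>The factor \<open>\<zeta>\<close> with \<open>e n k = \<zeta> (a + k + n \<beta>)\<close> for all large \<open>n\<close> is the coordinate of the vector
  of weight \<open>a + k\<close> in the density module.\<close>

lemma extend_from_tail:
  assumes b: "\<beta> \<noteq> 0"
    and pos: "\<And>k n. k \<ge> k1 \<Longrightarrow> n \<ge> 1 \<Longrightarrow> e n k = a + of_int k + of_int n * \<beta>"
    and ev: "\<And>j. \<exists>N. \<forall>k\<ge>N. e j k = a + of_int k + of_int j * \<beta>"
    and k1: "k1 \<in> S"
  shows "\<exists>g. (\<forall>k. g k \<noteq> 0) \<and> (\<forall>k\<in>S. \<forall>m. e m k * g k / g (k + m) = a + of_int k + of_int m * \<beta>)"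
proof -
  define Q where "Q k \<zeta> \<longleftrightarrow> (\<exists>N. \<forall>n\<ge>N. e n k = \<zeta> * (a + of_int k + of_int n * \<beta>))" for k \<zeta>
  have large: "\<exists>n\<ge>N. x + of_int n * \<beta> \<noteq> 0" for x and N :: int
  proof (rule ccontr)
    assume "\<not> ?thesis"
    then have "x + of_int N * \<beta> = 0" "x + of_int (N + 1) * \<beta> = 0"
      by (auto simp del: of_int_add)
    then show False using b by (simp add: algebra_simps)
  qed
  have Q_unique: "\<zeta> = \<zeta>'" if "Q k \<zeta>" "Q k \<zeta>'" for k \<zeta> \<zeta>'
  proof -
    from that obtain N N' where "\<forall>n\<ge>N. e n k = \<zeta> * (a + of_int k + of_int n * \<beta>)"
      "\<forall>n\<ge>N'. e n k = \<zeta>' * (a + of_int k + of_int n * \<beta>)" unfolding Q_def by blast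
    moreover obtain n where "n \<ge> max N N'" "a + of_int k + of_int n * \<beta> \<noteq> 0" using large by blast
    ultimately show ?thesis by auto
  qed
  have step: "\<exists>N. \<forall>n\<ge>N. e n (k + j) * e j k =
      \<zeta> * (a + of_int k + of_int j * \<beta>) * (a + of_int (k + j) + of_int n * \<beta>)"
    if k: "k \<in> S" and q: "Q k \<zeta>" for k j \<zeta>
  proof -
    from q obtain N where N: "\<And>n. n \<ge> N \<Longrightarrow> e n k = \<zeta> * (a + of_int k + of_int n * \<beta>)"
      unfolding Q_def by blast
    from ev[of j] obtain M where M: "\<And>k. k \<ge> M \<Longrightarrow> e j k = a + of_int k + of_int j * \<beta>" by blast
    \<comment> \<open>Evaluate \<open>[L_n, L_j]\<close> at \<open>k\<close>. The bounds on
      \<open>n\<close> make the other three coefficients known from \<open>Q\<close> and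
      \<open>ev\<close>, and \<open>n + j \<ge> 1\<close> removes the central term.\<close>
    have "e n (k + j) * e j k =
      \<zeta> * (a + of_int k + of_int j * \<beta>) * (a + of_int (k + j) + of_int n * \<beta>)"
      if n: "n \<ge> max (max N (N - j)) (max (M - k) (1 - j))" for n
    proof -
      have "e n (k + j) * e j k - e j (k + n) * e n k = of_int (j - n) * e (n + j) k"
        using comm[OF k, of n j] n by auto
      then show ?thesis using N[of n] N[of "n + j"] M[of "k + n"] n by (simp add: algebra_simps)
    qed
    then show ?thesis by blast
  qed
  have "{k\<in>S. \<exists>\<zeta>. Q k \<zeta>} = S"
  proof (rule irr)
    have "Q k1 1" unfolding Q_def using pos[of k1] by (intro exI[of _ 1]) auto
    then show "{k\<in>S. \<exists>\<zeta>. Q k \<zeta>} \<noteq> {}" using k1 by blast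
  next
    fix k j assume "k \<in> {k\<in>S. \<exists>\<zeta>. Q k \<zeta>}" and nz: "e j k \<noteq> 0"
    then obtain \<zeta> where k: "k \<in> S" and q: "Q k \<zeta>" by blast
    have "Q (k + j) (\<zeta> * (a + of_int k + of_int j * \<beta>) / e j k)"
      unfolding Q_def using step[OF k q, of j] nz by (simp add: field_simps)
    then show "k + j \<in> {k\<in>S. \<exists>\<zeta>. Q k \<zeta>}" using supp[OF nz] by blast
  qed auto
  then have "\<forall>k\<in>S. \<exists>\<zeta>. Q k \<zeta>" by blast
  then obtain Z where Z: "\<And>k. k \<in> S \<Longrightarrow> Q k (Z k)" by metis
  have rel: "Z k * (a + of_int k + of_int j * \<beta>) = Z (k + j) * e j k" if k: "k \<in> S" for k j
  proof -
    from step[OF k Z[OF k], of j] obtain N where N: "\<And>n. n \<ge> N \<Longrightarrow> e n (k + j) * e j k =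
      Z k * (a + of_int k + of_int j * \<beta>) * (a + of_int (k + j) + of_int n * \<beta>)" by blast
    show ?thesis
    proof (cases "e j k = 0")
      case True
      obtain n where "n \<ge> N" "a + of_int (k + j) + of_int n * \<beta> \<noteq> 0" using large by blast
      then show ?thesis using N[of n] True by simp
    next
      case False
      have "Q (k + j) (Z k * (a + of_int k + of_int j * \<beta>) / e j k)"
        unfolding Q_def using N False by (simp add: field_simps) blast
      from Q_unique[OF this Z] supp[OF False] False show ?thesis by (auto simp: field_simps)
    qed
  qed
  have Z1: "Z k1 = 1"
    using Q_unique[OF Z[OF k1], of 1] pos[of k1] unfolding Q_def by (metis order_refl mult_1)
  have nz: "Z k \<noteq> 0" if "k \<in> S" for k
  proof
    assume "Z k = 0"
    have "{k\<in>S. Z k = 0} = S"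
    proof (rule irr)
      fix k j assume "k \<in> {k\<in>S. Z k = 0}" "e j k \<noteq> 0"
      then show "k + j \<in> {k\<in>S. Z k = 0}" using rel[of k j] supp[of j k] by auto
    qed (use that \<open>Z k = 0\<close> in auto)
    then have "Z k1 = 0" using k1 by blast
    then show False using Z1 by simp
  qed
  \<comment> \<open>The value 1 outside \<open>S\<close> is a placeholder: if \<open>k + m\<close>
    is outside \<open>S\<close>, then \<open>e m k = 0\<close>, and \<open>rel\<close> makes the
    density coefficient vanish too.\<close>
  show ?thesis
  proof (intro exI[of _ "\<lambda>k. if k \<in> S then 1 / Z k else 1"] conjI allI ballI)
    fix k m assume k: "k \<in> S"
    show "e m k * (if k \<in> S then 1 / Z k else 1) / (if k + m \<in> S then 1 / Z (k + m) else 1) =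
        a + of_int k + of_int m * \<beta>"
      using rel[OF k, of m] nz[OF k] k supp[of m k] by (auto simp: field_simps)
  qed (use nz in auto)
qed

section \<open>The density form on a right ray of weights\<close>

text \<open>The modes of degree 1 and 2 generate all positive ones, those of degree -1 and -2 all
  negative ones. Here \<open>L_(-2)\<close> is not given: \<open>[L_1, L_(-2)]\<close> fixes it up
  to one constant \<open>Y\<close>, and \<open>[L_2, L_(-2)]\<close> forces
  \<open>Y = 0\<close>.\<close>

lemma coefficients_from_generators:
  assumes S: "\<And>k. k \<ge> k1 \<Longrightarrow> k \<in> S"
    and re: "\<And>k. k \<ge> k1 \<Longrightarrow> Re (a + of_int k) > 10 + cmod \<beta>"
    and e1: "\<And>k. k \<ge> k1 \<Longrightarrow> e 1 k = a + of_int k + \<beta>"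
    and em1: "\<And>k. k \<ge> k1 \<Longrightarrow> e (-1) (k + 1) = a + of_int k + 1 - \<beta>"
    and e2: "\<And>k. k \<ge> k1 \<Longrightarrow> e 2 k = a + of_int k + 2 * \<beta>"
  shows "\<And>k n. k \<ge> k1 \<Longrightarrow> n \<ge> 1 \<Longrightarrow> e n k = a + of_int k + of_int n * \<beta>"
    and "\<exists>N. \<forall>k\<ge>N. e j k = a + of_int k + of_int j * \<beta>"
proof -
  have pos: "e n k = a + of_int k + of_int n * \<beta>" if "n \<ge> 1" "k \<ge> k1" for n k
  proof (cases "n = 1")
    case True
    then show ?thesis using e1 that by simp
  next
    case False
    then have "n \<ge> 2" using that by simp
    then show ?thesis using \<open>k \<ge> k1\<close>
    proof (induction n arbitrary: k rule: int_ge_induct)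
      case base
      then show ?case using e2 by simp
    next
      case (step n)
      have "e 1 (k + n) * e n k - e n (k + 1) * e 1 k = of_int (n - 1) * e (1 + n) k"
        using comm[OF S[OF step.prems], of 1 n] step.hyps by simp
      then have "of_int (n - 1) * e (n + 1) k =
          of_int (n - 1) * (a + of_int k + of_int (n + 1) * \<beta>)"
        using step e1[of k] e1[of "k + n"] step.IH[of k] step.IH[of "k + 1"] by (simp add: algebra_simps)
      then show ?case using step.hyps by simp
    qed
  qed
  have nz: "a + of_int k + of_int i - \<beta> \<noteq> 0" "a + of_int k + of_int i + \<beta> \<noteq> 0" if "k \<ge> k1" "i \<ge> - 5" for k i
    using re[OF that(1)] that(2) abs_Re_le_cmod[of \<beta>] by (auto simp: complex_eq_iff)
  define d where "d k = e (-2) k" for k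
  define u where "u k = d k - (a + of_int k - 2 * \<beta>)" for k
  define Y where "Y = u (k1 + 2) * (a + of_int k1 + 1 + \<beta>) * (a + of_int k1 + \<beta>)"
  have u: "(a + of_int k - 2 + \<beta>) * u k = (a + of_int k + \<beta>) * u (k + 1)" if "k \<ge> k1 + 2" for k
  proof -
    have "e 1 (k - 2) * e (-2) k - e (-2) (k + 1) * e 1 k = - 3 * e (- 1) k"
      using comm[of k 1 "- 2"] S that by simp
    moreover have "e 1 (k - 2) = a + of_int k - 2 + \<beta>" "e 1 k = a + of_int k + \<beta>"
      "e (- 1) k = a + of_int k - \<beta>"
      using e1[of "k - 2"] e1[of k] em1[of "k - 1"] that by simp_all
    ultimately show ?thesis by (simp add: u_def d_def algebra_simps)
  qed
  have Y: "u k * (a + of_int k - 1 + \<beta>) * (a + of_int k - 2 + \<beta>) = Y" if "k \<ge> k1 + 2" for k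
    using that
  proof (induction k rule: int_ge_induct)
    case base
    then show ?case by (simp add: Y_def algebra_simps)
  next
    case (step k)
    have "u (k + 1) * (a + of_int (k + 1) - 1 + \<beta>) * (a + of_int (k + 1) - 2 + \<beta>) =
        ((a + of_int k + \<beta>) * u (k + 1)) * (a + of_int k - 1 + \<beta>)" by (simp add: algebra_simps)
    also have "\<dots> = Y" using u[of k] step by (simp add: algebra_simps)
    finally show ?case .
  qed
  have rel: "(a + of_int k - 2 + 2 * \<beta>) * u k - (a + of_int k + 2 * \<beta>) * u (k + 2) = 6 * c"
    if "k \<ge> k1 + 2" for k
  proof -
    have "e 2 (k - 2) * e (-2) k - e (-2) (k + 2) * e 2 k = - 4 * e 0 k + 6 * c"
      using comm[of k 2 "- 2"] S that by simp
    then show ?thesis using e2[of "k - 2"] e2[of k] weight[of k] S[of k] that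
      by (simp add: u_def d_def algebra_simps)
  qed
  \<comment> \<open>At \<open>t = a + \<beta> + k\<close>, \<open>P\<close> is \<open>rel\<close>
    with \<open>u\<close> expressed by \<open>Y\<close> and multiplied by
    \<open>(t - 1) (t - 2) (t + 1) t\<close>. The leading coefficient gives \<open>c = 0\<close>,
    then the quadratic one gives \<open>Y = 0\<close>.\<close>
  define P where "P = [: - 2 * \<beta> * Y, (4 * \<beta> - 4) * Y - 12 * c, 2 * Y + 6 * c, 12 * c, - 6 * c :]"
  have "P = 0"
  proof (rule poly_vanishing_on_ray)
    fix k :: int assume k: "k \<ge> k1 + 2"
    define t where "t = a + \<beta> + of_int k"
    have u1: "u k * ((t - 1) * (t - 2)) = Y" "u (k + 2) * ((t + 1) * t) = Y"
      using Y[OF k] Y[of "k + 2"] k by (simp_all add: t_def algebra_simps)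
    have "(t - 2 + \<beta>) * u k - (t + \<beta>) * u (k + 2) = 6 * c"
      using rel[OF k] by (simp add: t_def algebra_simps)
    then have "((t - 2 + \<beta>) * u k - (t + \<beta>) * u (k + 2)) * ((t - 1) * (t - 2) * ((t + 1) * t)) =
        6 * c * ((t - 1) * (t - 2) * ((t + 1) * t))" by simp
    moreover have "((t - 2 + \<beta>) * u k - (t + \<beta>) * u (k + 2)) * ((t - 1) * (t - 2) * ((t + 1) * t)) =
        (t - 2 + \<beta>) * (u k * ((t - 1) * (t - 2))) * ((t + 1) * t) -
        (t + \<beta>) * (u (k + 2) * ((t + 1) * t)) * ((t - 1) * (t - 2))" by (simp add: algebra_simps)
    ultimately have "(t - 2 + \<beta>) * Y * ((t + 1) * t) - (t + \<beta>) * Y * ((t - 1) * (t - 2)) =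
        6 * c * ((t - 1) * (t - 2) * ((t + 1) * t))" unfolding u1 by simp
    then have "poly P t = 0" unfolding P_def by simp algebra
    then show "poly P (a + \<beta> + of_int k) = 0" by (simp add: t_def)
  qed
  then have "Y = 0" by (auto simp: P_def)
  then have em2: "e (-2) k = a + of_int k - 2 * \<beta>" if "k \<ge> k1 + 2" for k
    using Y[OF that] nz(2)[of k "-1"] nz(2)[of k "-2"] that by (simp add: u_def d_def)
  have neg: "e (- n) k = a + of_int k - of_int n * \<beta>" if "n \<ge> 2" "k \<ge> k1 + n" for n k
    using that
  proof (induction n arbitrary: k rule: int_ge_induct)
    case base
    then show ?case using em2 by simp
  next
    case (step n)
    have "e (- 1) (k - n) * e (- n) k - e (- n) (k - 1) * e (- 1) k = of_int (1 - n) * e (- 1 - n) k"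
      using comm[of k "- 1" "- n"] S step by simp
    moreover have "e (- 1) k = a + of_int k - \<beta>" "e (- 1) (k - n) = a + of_int k - of_int n - \<beta>"
      using em1[of "k - 1"] em1[of "k - n - 1"] step by simp_all
    ultimately have "of_int (1 - n) * e (- (n + 1)) k =
        of_int (1 - n) * (a + of_int k - of_int (n + 1) * \<beta>)"
      using step.IH[of k] step.IH[of "k - 1"] step.prems by (simp add: algebra_simps)
    then show ?case using step.hyps by simp
  qed
  show "e n k = a + of_int k + of_int n * \<beta>" if "k \<ge> k1" "n \<ge> 1" for n k using pos[OF that(2,1)] .
  consider "j \<ge> 1" | "j = 0" | "j = - 1" | "j \<le> - 2" by linarith
  then show "\<exists>N. \<forall>k\<ge>N. e j k = a + of_int k + of_int j * \<beta>"
  proof cases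
    case 3
    then show ?thesis using em1[of "_ - 1"] by (intro exI[of _ "k1 + 1"]) auto
  next
    case 4
    then show ?thesis using neg[of "- j"] by (intro exI[of _ "k1 - j"]) auto
  qed (use pos weight S in \<open>auto intro: exI[of _ k1]\<close>)
qed

text \<open>The \<open>sl_2\<close> relation of \<open>L_1\<close> and \<open>L_(-1)\<close>; the
  cubic central term vanishes at \<open>m = 1\<close>.\<close>

lemma ray_step:
  assumes "k \<in> S"
  shows "e 1 k * e (- 1) (k + 1) = e 1 (k - 1) * e (- 1) k + 2 * (a + of_int k)"
  using comm[OF assms, of 1 "- 1"] weight[OF assms] by (simp add: algebra_simps)

text \<open>\<open>\<beta>\<close> is determined by the Casimir operator of \<open>sl\<^sub>2\<close> only up to \<open>\<beta> \<mapsto> 1 - \<beta>\<close>; the choice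
  between the two also serves to avoid \<open>\<beta> = 0\<close>, for which \<open>extend_from_tail\<close> fails.\<close>

lemma germ_on_ray:
  assumes ray: "\<And>k. k \<ge> k0 \<Longrightarrow> k \<in> S"
  obtains \<beta> g k1 where "\<And>k. g k \<noteq> 0" "k1 \<ge> k0"
    "\<And>k. k \<ge> k1 \<Longrightarrow> Re (a + of_int k) > 10 + cmod \<beta>"
    "\<And>k. k \<ge> k1 \<Longrightarrow> e 1 k * g k / g (k + 1) = a + of_int k + \<beta>"
    "\<And>k. k \<ge> k1 \<Longrightarrow> e (- 1) (k + 1) * g (k + 1) / g k = a + of_int k + 1 - \<beta>"
    "\<And>k. k \<ge> k1 \<Longrightarrow> e 2 k * g k / g (k + 2) = a + of_int k + 2 * \<beta>"
    "\<beta> \<noteq> 0"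
proof -
  \<comment> \<open>Since \<open>(t + \<beta>) (t + 1 - \<beta>) = t (t + 1) + \<beta> (1 -
    \<beta>)\<close>, the number \<open>x\<close> plays the part of the Casimir value, and
    \<open>\<beta>\<close> is chosen with \<open>\<beta> (1 - \<beta>) = x\<close>.\<close>
  define x where "x = e 1 k0 * e (- 1) (k0 + 1) - (a + of_int k0) * (a + of_int k0 + 1)"
  define \<beta> where "\<beta> = (1 + csqrt (1 - 4 * x)) / 2"
  have "2 * \<beta> - 1 = csqrt (1 - 4 * x)" unfolding \<beta>_def by (simp add: field_simps)
  then have "(2 * \<beta> - 1)\<^sup>2 = 1 - 4 * x" by simp
  then have "4 * x = 4 * (\<beta> * (1 - \<beta>))" by (simp add: power2_eq_square algebra_simps)
  then have bx: "x = \<beta> * (1 - \<beta>)" by simp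
  have f: "e 1 k * e (- 1) (k + 1) = (a + of_int k + \<beta>) * (a + of_int k + 1 - \<beta>)" if "k \<ge> k0" for k
    using that
  proof (induction k rule: int_ge_induct)
    case base
    then show ?case using bx by (simp add: x_def algebra_simps)
  next
    case (step k)
    then show ?case using ray_step[of "k + 1"] ray[of "k + 1"] by (simp add: algebra_simps)
  qed
  \<comment> \<open>Far enough to keep the linear factors below away from 0, with room for replacing
    \<open>\<beta>\<close> by \<open>1 - \<beta>\<close>.\<close>
  define k1 where "k1 = max k0 (\<lceil>12 + 2 * cmod \<beta> - Re a\<rceil>)"
  have k1: "k1 \<ge> k0" by (simp add: k1_def)
  have re: "Re (a + of_int k) > 11 + 2 * cmod \<beta>" if "k \<ge> k1" for k
    using that unfolding k1_def by (auto simp: ceiling_le_iff)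
  have nz: "a + of_int k + of_int i - \<beta> \<noteq> 0" "a + of_int k + of_int i + \<beta> \<noteq> 0" "a + of_int k \<noteq> 0"
    if "k \<ge> k1" "i \<ge> - 5" for k i
    using re[OF that(1)] that(2) abs_Re_le_cmod[of \<beta>] by (auto simp: complex_eq_iff)
  have nz0: "a + of_int k + \<beta> \<noteq> 0" "a + of_int k + 1 - \<beta> \<noteq> 0" if "k \<ge> k1" for k
    using nz(1)[OF that, of 1] nz(2)[OF that, of 0] by simp_all
  \<comment> \<open>The gauge prescribes \<open>L_1\<close>. It leaves the products
    \<open>e 1 k * e (- 1) (k + 1)\<close> unchanged, so \<open>f\<close> then determines
    \<open>L_(-1)\<close>.\<close>
  define \<rho> where "\<rho> k = (if k \<ge> k1 then e 1 k / (a + of_int k + \<beta>) else 1)" for k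
  have "\<rho> k \<noteq> 0" for k
    using f[of k] nz0[of k] k1 by (auto simp: \<rho>_def)
  then obtain g where g: "\<And>k. g k \<noteq> 0" and g1: "\<And>k. g (k + 1) = \<rho> k * g k"
    using multiplicative_primitive by metis
  define E where "E m k = e m k * g k / g (k + m)" for m k
  interpret G: vir_weights S E a c unfolding E_def by (rule gauge[OF g])
  have e1nz: "e 1 k \<noteq> 0" if "k \<ge> k1" for k using f[of k] nz0[OF that] k1 that by auto
  have E1: "E 1 k = a + of_int k + \<beta>" if "k \<ge> k1" for k
    using e1nz[OF that] g[of k] that g1[of k] by (simp add: E_def \<rho>_def)
  have Em1: "E (- 1) (k + 1) = a + of_int k + 1 - \<beta>" if "k \<ge> k1" for k
  proof -
    have "E 1 k * E (- 1) (k + 1) = e 1 k * e (- 1) (k + 1)" using g by (simp add: E_def)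
    then show ?thesis using f[of k] nz0[OF that] k1 that E1[OF that] by simp
  qed
  \<comment> \<open>The deviation of \<open>L_2\<close> from its density value:
    \<open>[L_(-1), L_2] = 3 L_1\<close> gives a recursion for it, which leaves the single constant
    \<open>D\<close> free.\<close>
  define u where "u k = E 2 k - (a + of_int k + 2 * \<beta>)" for k
  define D where "D = u k1 * ((a + of_int k1 + 1 - \<beta>) * (a + of_int k1 + 2 - \<beta>))"
  have u: "(a + of_int k + 3 - \<beta>) * u (k + 1) = (a + of_int k + 1 - \<beta>) * u k" if "k \<ge> k1" for k
  proof -
    have "E (- 1) (k + 1 + 2) * E 2 (k + 1) - E 2 (k + 1 + - 1) * E (- 1) (k + 1) = of_int (2 - (- 1)) * E (- 1 + 2) (k + 1)"
      using G.comm[of "k + 1" "- 1" 2] ray[of "k + 1"] k1 that by simp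
    then have "E (- 1) (k + 3) * E 2 (k + 1) - E 2 k * E (- 1) (k + 1) = 3 * E 1 (k + 1)"
      by (simp add: add_ac)
    moreover have "E (- 1) (k + 3) = a + of_int k + 3 - \<beta>" "E 1 (k + 1) = a + of_int k + 1 + \<beta>"
      using Em1[of "k + 2"] E1[of "k + 1"] that by (simp_all add: add_ac)
    ultimately have "(a + of_int k + 3 - \<beta>) * E 2 (k + 1) - E 2 k * (a + of_int k + 1 - \<beta>) =
        3 * (a + of_int k + 1 + \<beta>)" using Em1[OF that] by (simp only:)
    then show ?thesis by (simp add: u_def algebra_simps)
  qed
  have D: "u k * ((a + of_int k + 1 - \<beta>) * (a + of_int k + 2 - \<beta>)) = D" if "k \<ge> k1" for k
    using that
  proof (induction k rule: int_ge_induct)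
    case base
    then show ?case by (simp add: D_def)
  next
    case (step k)
    have "u (k + 1) * ((a + of_int (k + 1) + 1 - \<beta>) * (a + of_int (k + 1) + 2 - \<beta>)) =
        ((a + of_int k + 3 - \<beta>) * u (k + 1)) * (a + of_int k + 2 - \<beta>)" by (simp add: algebra_simps)
    also have "(a + of_int k + 3 - \<beta>) * u (k + 1) = (a + of_int k + 1 - \<beta>) * u k"
      by (rule u) (use step in simp)
    also have "(a + of_int k + 1 - \<beta>) * u k * (a + of_int k + 2 - \<beta>) = D"
      using step by (simp add: mult_ac)
    finally show ?case .
  qed
  have nzs: "a + of_int k + 1 - \<beta> \<noteq> 0" "a + of_int k + 2 - \<beta> \<noteq> 0" if "k \<ge> k1" for k
    using nz(1)[OF that, of 1] nz(1)[OF that, of 2] by simp_all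
  have E2: "E 2 k = a + of_int k + 2 * \<beta> + D / ((a + of_int k + 1 - \<beta>) * (a + of_int k + 2 - \<beta>))"
    if "k \<ge> k1" for k
  proof -
    have "u k = D / ((a + of_int k + 1 - \<beta>) * (a + of_int k + 2 - \<beta>))"
      using D[OF that] nzs[OF that] by (simp add: eq_divide_eq)
    then show ?thesis unfolding u_def by (simp only: diff_eq_eq) (simp only: add_ac)
  qed
  define D' where "D' = 2 * \<beta> * (1 - \<beta>) * (2 * \<beta> - 1)"
  \<comment> \<open>\<open>L_5\<close> is computed in two ways, \<open>L_5 = [L_2, L_3]\<close> and
    \<open>6 L_5 = [L_1, [L_1, L_3]]\<close>, with \<open>L_3 = [L_1, L_2]\<close>.\<close>
  have "D * (D - D') = 0"
  proof -
    define t where "t = a + of_int k1 - \<beta>"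
    have t: "t + of_int i \<noteq> 0" if "i \<ge> 0" for i using nz(1)[of k1 i] that by (simp add: t_def algebra_simps)
    have tn: "t + 1 \<noteq> 0" "t + 2 \<noteq> 0" "t + 3 \<noteq> 0" "t + 4 \<noteq> 0" "t + 5 \<noteq> 0"
      using t[of 1] t[of 2] t[of 3] t[of 4] t[of 5] by simp_all
    have kin: "k1 + i \<in> S" if "i \<ge> 0" for i using ray[of "k1 + i"] that k1 by simp
    have a1: "E 1 (k1 + i) = t + of_int i + 2 * \<beta>" if "i \<ge> 0" for i
      using E1[of "k1 + i"] that by (simp add: t_def algebra_simps)
    have a2: "E 2 (k1 + i) = t + of_int i + 3 * \<beta> + D / ((t + of_int i + 1) * (t + of_int i + 2))" if "i \<ge> 0" for i
      using E2[of "k1 + i"] that by (simp add: t_def algebra_simps)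
    have e3: "E 3 (k1 + i) = E 1 (k1 + (i + 2)) * E 2 (k1 + i) - E 2 (k1 + (i + 1)) * E 1 (k1 + i)" if "i \<ge> 0" for i
      using G.comm[OF kin[OF that], of 1 2] by (simp add: add_ac)
    have e4: "2 * E 4 (k1 + i) = E 1 (k1 + (i + 3)) * E 3 (k1 + i) - E 3 (k1 + (i + 1)) * E 1 (k1 + i)" if "i \<ge> 0" for i
      using G.comm[OF kin[OF that], of 1 3] by (simp add: add_ac)
    have e5: "3 * E 5 (k1 + i) = E 1 (k1 + (i + 4)) * E 4 (k1 + i) - E 4 (k1 + (i + 1)) * E 1 (k1 + i)" if "i \<ge> 0" for i
      using G.comm[OF kin[OF that], of 1 4] by (simp add: add_ac)
    have e5': "E 5 (k1 + i) = E 2 (k1 + (i + 3)) * E 3 (k1 + i) - E 3 (k1 + (i + 2)) * E 2 (k1 + i)" if "i \<ge> 0" for i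
      using G.comm[OF kin[OF that], of 2 3] by (simp add: add_ac)
    define A where "A i = t + of_int i + 2 * \<beta>" for i :: int
    define X where "X i = t + of_int i + 3 * \<beta> + D / ((t + of_int i + 1) * (t + of_int i + 2))" for i :: int
    define Y where "Y i = A (i + 2) * X i - X (i + 1) * A i" for i :: int
    have e3': "E 3 (k1 + i) = Y i" if "i \<ge> 0" for i
      using e3[OF that] a1[of i] a1[of "i + 2"] a2[of i] a2[of "i + 1"] that
      unfolding Y_def A_def X_def by simp
    have "6 * (X 3 * Y 0 - Y 2 * X 0) = 6 * E 5 (k1 + 0)"
      using e5'[of 0] a2[of 0] a2[of 3] e3'[of 0] e3'[of 2] by (simp add: X_def)
    also have "\<dots> = A 4 * (2 * E 4 (k1 + 0)) - 2 * E 4 (k1 + 1) * A 0"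
      using e5[of 0] a1[of 0] a1[of 4] by (simp add: A_def) algebra
    also have "\<dots> = A 4 * (A 3 * Y 0 - Y 1 * A 0) - (A 4 * Y 1 - Y 2 * A 1) * A 0"
      using e4[of 0] e4[of 1] a1[of 0] a1[of 1] a1[of 3] a1[of 4] e3'[of 0] e3'[of 1] e3'[of 2] by (simp add: A_def)
    finally have "- 48 * D * (D - 2 * \<beta> * (1 - \<beta>) * (2 * \<beta> - 1)) /
        ((t + 1) * (t + 2) * (t + 3) * (t + 4) * (t + 5)) = 0"
      using germ_identity[OF tn, of \<beta> D] unfolding Y_def X_def A_def by simp
    then show ?thesis using tn by (auto simp: D'_def)
  qed
  show ?thesis
  proof (cases "D = 0 \<and> \<beta> \<noteq> 0")
    case True
    show ?thesis
    proof (rule that[OF g, of k1 \<beta>])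
      show "Re (a + of_int k) > 10 + cmod \<beta>" if "k \<ge> k1" for k using re[OF that] norm_ge_zero[of \<beta>] by linarith
      show "e 1 k * g k / g (k + 1) = a + of_int k + \<beta>" if "k \<ge> k1" for k using E1[OF that] by (simp add: E_def)
      show "e (- 1) (k + 1) * g (k + 1) / g k = a + of_int k + 1 - \<beta>" if "k \<ge> k1" for k
        using Em1[OF that] by (simp add: E_def)
      show "e 2 k * g k / g (k + 2) = a + of_int k + 2 * \<beta>" if "k \<ge> k1" for k
        using E2[OF that] True by (simp add: E_def)
    qed (use True k1 in auto)
  next
    case False
    \<comment> \<open>If \<open>D = 0\<close>, then \<open>\<beta> = 0\<close> in this case, and
      \<open>D' = 0\<close> as well; otherwise \<open>D = D' \<noteq> 0\<close>, which excludes
      \<open>\<beta> = 1\<close>.\<close>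
    then have DD: "D = D'" and b1: "1 - \<beta> \<noteq> 0" using \<open>D * (D - D') = 0\<close> by (auto simp: D'_def)
    \<comment> \<open>The ratio of the \<open>L_1\<close> coefficients for \<open>\<beta>\<close>
      and for \<open>1 - \<beta>\<close>; rescaling by its primitive \<open>h\<close> exchanges the
      two normal forms, and for \<open>L_2\<close> this works because \<open>D = D'\<close>.\<close>
    define \<sigma> where "\<sigma> k = (if k \<ge> k1 then (a + of_int k + \<beta>) / (a + of_int k + 1 - \<beta>) else 1)" for k
    have "\<sigma> k \<noteq> 0" for k using nz0[of k] by (auto simp: \<sigma>_def)
    then obtain h where h: "\<And>k. h k \<noteq> 0" and h1: "\<And>k. h (k + 1) = \<sigma> k * h k"
      using multiplicative_primitive by metis
    have h2: "h (k + 2) = \<sigma> (k + 1) * \<sigma> k * h k" for k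
      using h1[of k] h1[of "k + 1"] by (simp add: add_ac)
    show ?thesis
    proof (rule that[of "\<lambda>k. g k * h k" k1 "1 - \<beta>"])
      show "g k * h k \<noteq> 0" for k using g h by simp
      show "Re (a + of_int k) > 10 + cmod (1 - \<beta>)" if "k \<ge> k1" for k
        using re[OF that] norm_triangle_ineq4[of 1 \<beta>] norm_ge_zero[of \<beta>] unfolding norm_one by linarith
      show "e 1 k * (g k * h k) / (g (k + 1) * h (k + 1)) = a + of_int k + (1 - \<beta>)" if "k \<ge> k1" for k
      proof -
        have "e 1 k * (g k * h k) / (g (k + 1) * h (k + 1)) = E 1 k / \<sigma> k"
          using h[of k] h1[of k] by (simp add: E_def)
        then show ?thesis using E1[OF that] nz0[OF that] that by (simp add: \<sigma>_def)
      qed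
      show "e (- 1) (k + 1) * (g (k + 1) * h (k + 1)) / (g k * h k) = a + of_int k + 1 - (1 - \<beta>)" if "k \<ge> k1" for k
      proof -
        have "e (- 1) (k + 1) * (g (k + 1) * h (k + 1)) / (g k * h k) = E (- 1) (k + 1) * \<sigma> k"
          using h[of k] h1[of k] by (simp add: E_def)
        then show ?thesis using Em1[OF that] nz0[OF that] that by (simp add: \<sigma>_def)
      qed
      show "e 2 k * (g k * h k) / (g (k + 2) * h (k + 2)) = a + of_int k + 2 * (1 - \<beta>)" if "k \<ge> k1" for k
      proof -
        have "e 2 k * (g k * h k) / (g (k + 2) * h (k + 2)) = E 2 k / (\<sigma> (k + 1) * \<sigma> k)"
          using h[of k] h2[of k] by (simp add: E_def)
        moreover have "E 2 k = (a + of_int k + 2 * (1 - \<beta>)) * (\<sigma> (k + 1) * \<sigma> k)"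
        proof -
          define t where "t = a + of_int k"
          have n: "t + 1 - \<beta> \<noteq> 0" "t + 2 - \<beta> \<noteq> 0" using nzs[OF that] by (simp_all add: t_def)
          have s: "\<sigma> k = (t + \<beta>) / (t + 1 - \<beta>)" "\<sigma> (k + 1) = (t + 1 + \<beta>) / (t + 2 - \<beta>)"
            using that by (simp_all add: \<sigma>_def t_def add_ac)
          have e: "E 2 k = t + 2 * \<beta> + D' / ((t + 1 - \<beta>) * (t + 2 - \<beta>))"
            using E2[OF that] DD by (simp add: t_def)
          have "E 2 k = (t + 2 * (1 - \<beta>)) * (\<sigma> (k + 1) * \<sigma> k)"
          proof -
            have "(t + 2 * \<beta>) * ((t + 1 - \<beta>) * (t + 2 - \<beta>)) + 2 * \<beta> * (1 - \<beta>) * (2 * \<beta> - 1) =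
              (t + (2 - 2 * \<beta>)) * ((t + 1 + \<beta>) * (t + \<beta>))" by algebra
            then show ?thesis unfolding s e D'_def using n by (simp add: divide_simps)
          qed
          then show ?thesis by (simp add: t_def)
        qed
        ultimately show ?thesis using nz0[OF that] nz0[of "k + 1"] that by (simp add: \<sigma>_def)
      qed
    qed (use k1 b1 in auto)
  qed
qed

lemma density_of_right_ray:
  assumes "\<And>k. k \<ge> k0 \<Longrightarrow> k \<in> S"
  shows "\<exists>\<beta> g. (\<forall>k. g k \<noteq> 0) \<and> (\<forall>k\<in>S. \<forall>m. e m k * g k / g (k + m) = a + of_int k + of_int m * \<beta>)"
proof -
  obtain \<beta> g k1 where g: "\<And>k. g k \<noteq> 0" and k1: "k1 \<ge> k0"
    and re: "\<And>k. k \<ge> k1 \<Longrightarrow> Re (a + of_int k) > 10 + cmod \<beta>"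
    and e: "\<And>k. k \<ge> k1 \<Longrightarrow> e 1 k * g k / g (k + 1) = a + of_int k + \<beta>"
    "\<And>k. k \<ge> k1 \<Longrightarrow> e (- 1) (k + 1) * g (k + 1) / g k = a + of_int k + 1 - \<beta>"
    "\<And>k. k \<ge> k1 \<Longrightarrow> e 2 k * g k / g (k + 2) = a + of_int k + 2 * \<beta>"
    and b: "\<beta> \<noteq> 0"
    by (rule germ_on_ray[OF assms]) blast+
  interpret G: vir_weights S "\<lambda>m k. e m k * g k / g (k + m)" a c by (rule gauge[OF g])
  have S: "k \<in> S" if "k \<ge> k1" for k using assms k1 that by simp
  have em1: "e (- 1) (k + 1) * g (k + 1) / g (k + 1 + - 1) = a + of_int k + 1 - \<beta>" if "k \<ge> k1" for k
    using e(2)[OF that] by simp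
  have "\<exists>h. (\<forall>k. h k \<noteq> 0) \<and> (\<forall>k\<in>S. \<forall>m. e m k * g k / g (k + m) * h k / h (k + m) = a + of_int k + of_int m * \<beta>)"
  proof (rule G.extend_from_tail[OF b])
    show "e n k * g k / g (k + n) = a + of_int k + of_int n * \<beta>" if "k \<ge> k1" "n \<ge> 1" for k n
      by (rule G.coefficients_from_generators(1)[where \<beta> = \<beta> and ?k1.0 = k1])
        (erule S re e(1) em1 e(3) | rule that)+
    show "\<exists>N. \<forall>k\<ge>N. e j k * g k / g (k + j) = a + of_int k + of_int j * \<beta>" for j
      by (rule G.coefficients_from_generators(2)[where \<beta> = \<beta> and ?k1.0 = k1])
        (erule S re e(1) em1 e(3))+
    show "k1 \<in> S" by (rule S) simp
  qed
  then obtain h where h: "\<And>k. h k \<noteq> 0"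
    "\<And>k m. k \<in> S \<Longrightarrow> e m k * g k / g (k + m) * h k / h (k + m) = a + of_int k + of_int m * \<beta>"
    by blast
  show ?thesis
  proof (intro exI conjI allI ballI)
    show "g k * h k \<noteq> 0" for k using g h by simp
    show "e m k * (g k * h k) / (g (k + m) * h (k + m)) = a + of_int k + of_int m * \<beta>" if "k \<in> S" for k m
      unfolding h(2)[OF that, symmetric] by simp
  qed
qed

lemma density_of_left_ray:
  assumes "\<And>k. k \<le> k0 \<Longrightarrow> k \<in> S"
  shows "\<exists>\<beta> g. (\<forall>k. g k \<noteq> 0) \<and> (\<forall>k\<in>S. \<forall>m. e m k * g k / g (k + m) = a + of_int k + of_int m * \<beta>)"
proof -
  interpret R: vir_weights "uminus ` S" "\<lambda>m k. - e (- m) (- k)" "- a" "- c" by (rule reflect)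
  have "k \<in> uminus ` S" if "k \<ge> - k0" for k
    using assms[of "- k"] that by (intro image_eqI[of _ _ "- k"]) auto
  then obtain \<beta> g where g: "\<And>k. g k \<noteq> 0"
    "\<And>k m. k \<in> uminus ` S \<Longrightarrow> - e (- m) (- k) * g k / g (k + m) = - a + of_int k + of_int m * \<beta>"
    using R.density_of_right_ray by blast
  have "e m k * g (- k) / g (- (k + m)) = a + of_int k + of_int m * \<beta>" if k: "k \<in> S" for k m
  proof -
    have "e m k * g (- k) / g (- k - m) = - (- e (- (- m)) (- (- k)) * g (- k) / g (- k + (- m)))" by simp
    also have "\<dots> = - (- a + of_int (- k) + of_int (- m) * \<beta>)" using k by (subst g(2)) auto
    finally show ?thesis by simp
  qed
  then show ?thesis using g(1) by (intro exI[of _ \<beta>] exI[of _ "\<lambda>k. g (- k)"]) auto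
qed

section \<open>Supports that contain no ray\<close>

text \<open>\<open>f k\<close> is the scalar of \<open>L_1 L_(-1)\<close>. It vanishes at both ends
  \<open>l\<close> and \<open>t + 1\<close>, so by \<open>ray_step\<close> the weights of the
  interval add up to 0, as in a finite-dimensional \<open>sl_2\<close>-module.\<close>

lemma bounded_component:
  assumes l: "l - 1 \<notin> S" and S: "\<And>k. l \<le> k \<Longrightarrow> k \<le> t \<Longrightarrow> k \<in> S" and t: "t + 1 \<notin> S" and lt: "l \<le> t"
  shows "2 * a + of_int l + of_int t = 0"
proof -
  define f where "f k = e 1 (k - 1) * e (- 1) k" for k
  have "f k = of_int (k - l) * (2 * a + of_int l + of_int k - 1)" if "k \<ge> l" "k \<le> t + 1" for k
    using that
  proof (induction k rule: int_ge_induct)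
    case base
    then show ?case using supp[of 1 "l - 1"] l by (auto simp: f_def)
  next
    case (step k)
    then show ?case using ray_step[of k] S[of k] by (simp add: f_def algebra_simps)
  qed
  then have "f (t + 1) = of_int (t + 1 - l) * (2 * a + of_int l + of_int (t + 1) - 1)" using lt by simp
  moreover have "f (t + 1) = 0" using supp[of "- 1" "t + 1"] t by (auto simp: f_def)
  ultimately have "of_int (t + 1 - l) * (2 * a + of_int l + of_int (t + 1) - 1) = 0" by (simp only:)
  moreover have "of_int (t + 1 - l) \<noteq> (0 :: complex)" using lt unfolding of_int_eq_0_iff by simp
  ultimately show ?thesis by (auto simp: add.assoc)
qed

text \<open>Each point of \<open>S\<close> lies in a bounded maximal interval. By
  \<open>bounded_component\<close> all these intervals have the same midpoint, and distinct maximal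
  intervals are disjoint, so there is only one.\<close>

lemma bounded_support:
  assumes right: "\<And>k0. \<exists>k\<ge>k0. k \<notin> S" and left: "\<And>k0. \<exists>k\<le>k0. k \<notin> S"
  shows "\<exists>l t. S \<subseteq> {l..t}"
proof -
  have comp: "\<exists>l t. l \<le> k \<and> k \<le> t \<and> l - 1 \<notin> S \<and> t + 1 \<notin> S \<and> (\<forall>i. l \<le> i \<and> i \<le> t \<longrightarrow> i \<in> S)"
    if k: "k \<in> S" for k
  proof -
    obtain r where r: "r \<ge> k" "r \<notin> S" using right by blast
    obtain q where q: "q \<le> k" "q \<notin> S" using left by blast
    define R where "R = Min ({k..r} - S)"
    define L where "L = Max ({q..k} - S)"
    have ne: "{k..r} - S \<noteq> {}" "{q..k} - S \<noteq> {}" using r q by auto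
    have "R \<in> {k..r} - S" unfolding R_def using ne by (intro Min_in) auto
    moreover have "L \<in> {q..k} - S" unfolding L_def using ne by (intro Max_in) auto
    moreover have "i \<in> S" if "L < i" "i < R" for i
    proof (rule ccontr)
      assume i: "i \<notin> S"
      show False
      proof (cases "i \<ge> k")
        case True
        then have "R \<le> i" unfolding R_def using i that \<open>R \<in> {k..r} - S\<close> by (intro Min_le) auto
        then show False using that by simp
      next
        case False
        then have "i \<le> L" unfolding L_def using i that \<open>L \<in> {q..k} - S\<close> by (intro Max_ge) auto
        then show False using that by simp
      qed
    qed
    moreover have "L \<noteq> k" "R \<noteq> k" using \<open>R \<in> _\<close> \<open>L \<in> _\<close> k by auto
    ultimately show ?thesis by (intro exI[of _ "L + 1"] exI[of _ "R - 1"]) auto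
  qed
  obtain k where k: "k \<in> S" using nonempty by blast
  obtain l t where lt: "l \<le> k" "k \<le> t" "l - 1 \<notin> S" "t + 1 \<notin> S" "\<And>i. l \<le> i \<Longrightarrow> i \<le> t \<Longrightarrow> i \<in> S"
    using comp[OF k] by blast
  have sum: "2 * a + of_int l + of_int t = 0" using lt by (intro bounded_component) auto
  have "i \<in> {l..t}" if i: "i \<in> S" for i
  proof -
    obtain l' t' where lt': "l' \<le> i" "i \<le> t'" "l' - 1 \<notin> S" "t' + 1 \<notin> S"
      "\<And>i. l' \<le> i \<Longrightarrow> i \<le> t' \<Longrightarrow> i \<in> S"
      using comp[OF i] by blast
    have "2 * a + of_int l' + of_int t' = 0" using lt' by (intro bounded_component) auto
    with sum have "of_int (l + t) = (of_int (l' + t') :: complex)" by (simp add: algebra_simps) algebra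
    then have "l + t = l' + t'" unfolding of_int_eq_iff .
    moreover have "l' \<le> t + 1 \<Longrightarrow> t' \<le> t" using lt'(5)[of "t + 1"] lt by fastforce
    moreover have "l \<le> t' + 1 \<Longrightarrow> t \<le> t'" using lt(5)[of "t' + 1"] lt' by fastforce
    ultimately show ?thesis using lt(1,2) lt'(1,2) by auto
  qed
  then show ?thesis by blast
qed

text \<open>For large \<open>j\<close> both \<open>L_j\<close> and \<open>L_(-j)\<close> leave the
  support, so their bracket gives \<open>- 2 j (a + k) + (j^3 - j) c = 0\<close>. Two such
  \<open>j\<close> force \<open>a + k = 0\<close>, for every \<open>k\<close> in
  \<open>S\<close>.\<close>

lemma trivial_of_bounded_support:
  assumes "S \<subseteq> {l..t}"
  shows "\<exists>k. S = {k} \<and> a + of_int k = 0"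
proof -
  have zero: "a + of_int k = 0" if k: "k \<in> S" for k
  proof -
    define n where "n = max 1 (t - l + 1)"
    have rel: "- 2 * of_int j * (a + of_int k) + (of_int j ^ 3 - of_int j) * c = 0" if "j \<ge> n" for j
    proof -
      have "k + j \<notin> S" "k - j \<notin> S"
        using that subsetD[OF assms k] subsetD[OF assms, of "k + j"] subsetD[OF assms, of "k - j"]
        by (auto simp: n_def)
      then have "e j k = 0" "e (- j) k = 0" using supp[of j k] supp[of "- j" k] by auto
      then show ?thesis using comm[OF k, of j "- j"] weight[OF k] by simp
    qed
    define x where "x = a + of_int k"
    have "of_int j \<noteq> (0::complex)" if "j \<ge> n" for j using that by (simp add: n_def)
    then have "- 2 * x + (of_int j ^ 2 - 1) * c = 0" if "j \<ge> n" for j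
    proof -
      have "of_int j * (- 2 * x + (of_int j ^ 2 - 1) * c) = 0"
        using rel[OF that] by (simp add: x_def power2_eq_square power3_eq_cube algebra_simps)
      then show ?thesis using \<open>\<And>j. n \<le> j \<Longrightarrow> of_int j \<noteq> (0::complex)\<close>[OF that] by simp
    qed
    from this[of n] this[of "n + 1"] have "(2 * of_int n + 1) * c = 0" "- 2 * x + (of_int n ^ 2 - 1) * c = 0"
      by (simp_all add: power2_eq_square) algebra
    moreover have "2 * of_int n + 1 \<noteq> (0::complex)"
    proof
      assume "2 * of_int n + 1 = (0::complex)"
      then have "of_int (2 * n + 1) = (of_int 0 :: complex)" by simp
      then have "2 * n + 1 = 0" unfolding of_int_eq_iff .
      moreover have "n \<ge> 1" by (simp add: n_def)
      ultimately show False by linarith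
    qed
    ultimately have "x = 0" by auto
    then show ?thesis by (simp add: x_def)
  qed
  obtain k where k: "k \<in> S" using nonempty by blast
  have "S = {k}"
  proof (intro equalityI subsetI)
    fix i assume "i \<in> S"
    then have "of_int i = (of_int k :: complex)" using zero[of i] zero[OF k] by (metis add_left_imp_eq)
    then show "i \<in> {k}" by simp
  qed (use k in auto)
  then show ?thesis using zero k by blast
qed

theorem density:
  "\<exists>\<beta> g. (\<forall>k. g k \<noteq> 0) \<and> (\<forall>k\<in>S. \<forall>m. e m k * g k / g (k + m) = a + of_int k + of_int m * \<beta>)"
proof (cases "(\<exists>k0. \<forall>k\<ge>k0. k \<in> S) \<or> (\<exists>k0. \<forall>k\<le>k0. k \<in> S)")
  case True
  then show ?thesis using density_of_right_ray density_of_left_ray by blast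
next
  case False
  then obtain k where k: "S = {k}" "a + of_int k = 0"
    using bounded_support trivial_of_bounded_support by (metis (no_types, lifting))
  have "e m k = 0" for m
    using supp[of m k] k weight[of k] by (cases "m = 0") auto
  then show ?thesis using k by (intro exI[of _ 0] exI[of _ "\<lambda>_. 1"]) auto
qed

text \<open>\<open>[L_2, L_(-2)]\<close> has central term \<open>6 c\<close>, while density
  coefficients satisfy the relation without it. Products that pass outside \<open>S\<close> fit in,
  since by \<open>E\<close> the density coefficient of an edge leaving \<open>S\<close> is
  0.\<close>

lemma central_charge_zero:
  assumes g: "\<And>k. g k \<noteq> 0"
    and E: "\<And>k m. k \<in> S \<Longrightarrow> e m k * g k / g (k + m) = a + of_int k + of_int m * \<beta>"
  shows "c = 0"
proof -
  interpret G: vir_weights S "\<lambda>m k. e m k * g k / g (k + m)" a c by (rule gauge[OF g])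
  obtain k where k: "k \<in> S" using nonempty by blast
  define f where "f m k = e m k * g k / g (k + m)" for m k
  have "f m (k - m) * f (- m) k = (a + of_int k - of_int m + of_int m * \<beta>) * (a + of_int k - of_int m * \<beta>)" for m
  proof (cases "k - m \<in> S")
    case True
    then show ?thesis using E[OF True, of m] E[OF k, of "- m"] by (simp add: f_def)
  next
    case False
    then have "e (- m) k = 0" using supp[of "- m" k] by auto
    then show ?thesis using E[OF k, of "- m"] by (simp add: f_def)
  qed
  from this[of 2] this[of "- 2"]
  have "f 2 (k - 2) * f (- 2) k = (a + of_int k - 2 + 2 * \<beta>) * (a + of_int k - 2 * \<beta>)"
    "f (- 2) (k + 2) * f 2 k = (a + of_int k + 2 - 2 * \<beta>) * (a + of_int k + 2 * \<beta>)"
    by simp_all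
  moreover have "f 2 (k - 2) * f (- 2) k - f (- 2) (k + 2) * f 2 k = - 4 * (a + of_int k) + 6 * c"
    using G.comm[OF k, of 2 "- 2"] G.weight[OF k] by (simp add: f_def)
  ultimately have "6 * c = 0" by simp algebra
  then show ?thesis by simp
qed

end

section \<open>Weight coefficients of a module over the gap-\<open>p\<close> algebra\<close>

text \<open>In \<open>normal_form\<close>, \<open>G\<close> is the deviation of
  \<open>L_(p j)\<close> from the weight at a fixed \<open>k\<close>. Pairs of modes up to 2 fix the
  small values and remove \<open>C\<close>; brackets with modes 1 and -1 reach the rest.\<close>

lemma slope_linear:
  fixes G :: "int \<Rightarrow> complex"
  assumes rel: "\<And>m n. of_int (n - m) * G (m + n) = of_int n * G n - of_int m * G m
      - (if m + n = 0 then (of_int m ^ 3 - of_int m) * C else 0)"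
    and G0: "G 0 = 0"
  shows "G j = of_int j * G 1" "C = 0"
proof -
  have m1: "G (- 1) = - G 1" using rel[of 1 "- 1"] G0 by simp algebra
  have p2: "G 2 = 2 * G 1" using rel[of 2 "- 1"] m1 by simp
  have m2: "G (- 2) = - 2 * G 1" using rel[of "- 2" 1] m1 by simp
  have C: "6 * C = 0" using rel[of 2 "- 2"] G0 p2 m2 by simp
  then show "C = 0" by simp
  have pos: "G j = of_int j * G 1" if "j \<ge> 2" for j
    using that
  proof (induction j rule: int_ge_induct)
    case base
    then show ?case using p2 by simp
  next
    case (step n)
    have "of_int (n - 1) * G (1 + n) = of_int n * G n - G 1" using rel[of n 1] step.hyps by simp
    then have "of_int (n - 1) * G (n + 1) = of_int (n - 1) * (of_int (n + 1) * G 1)"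
      using step.IH by (simp add: algebra_simps)
    moreover have "of_int (n - 1) \<noteq> (0::complex)" using step.hyps unfolding of_int_eq_0_iff by simp
    ultimately show ?case by (metis mult_cancel_left)
  qed
  have neg: "G j = of_int j * G 1" if "j \<le> - 2" for j
    using that
  proof (induction j rule: int_le_induct)
    case base
    then show ?case using m2 by simp
  next
    case (step n)
    have "of_int (n + 1) * G (- 1 + n) = of_int n * G n - G 1" using rel[of n "- 1"] step.hyps m1 by simp
    then have "of_int (n + 1) * G (n - 1) = of_int (n + 1) * (of_int (n - 1) * G 1)"
      using step.IH by (simp add: algebra_simps)
    moreover have "of_int (n + 1) \<noteq> (0::complex)" using step.hyps unfolding of_int_eq_0_iff by simp
    ultimately show ?case by (metis mult_cancel_left)
  qed
  consider "j \<ge> 2" | "j = 1" | "j = 0" | "j = - 1" | "j \<le> - 2" by linarith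
  then show "G j = of_int j * G 1" using pos neg m1 G0 by cases auto
qed

text \<open>The diagonal is excluded because \<open>[L_m, L_n]\<close> carries the factor
  \<open>n - m\<close>. Multiplying by \<open>z (- 1) = 1\<close> links all neighbours except -1 and
  -2, where \<open>z 1 * z (- 2) = z (- 1)\<close> helps.\<close>

lemma multiplicative_off_diagonal:
  fixes z :: "int \<Rightarrow> complex"
  assumes mult: "\<And>m n. m \<noteq> n \<Longrightarrow> z m * z n = z (m + n)" and z: "z 0 = 1" "z 1 = 1"
  shows "z n = 1"
proof -
  have m1: "z (- 1) = 1" using mult[of 1 "- 1"] z by simp
  have up: "z (n + 1) = z n" if "n \<noteq> - 2" for n using mult[of "n + 1" "- 1"] m1 that by simp
  have down: "z (n - 1) = z n" if "n \<noteq> - 1" for n using mult[of n "- 1"] m1 that by simp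
  show ?thesis
  proof (cases "n \<ge> 0")
    case True
    then show ?thesis by (induction n rule: int_ge_induct) (use up z in auto)
  next
    case False
    then have "n \<le> - 1" by simp
    then show ?thesis
    proof (induction n rule: int_le_induct)
      case (step n)
      then show ?case using down[of n] up[of "- 3"] mult[of 1 "- 2"] z m1 by (cases "n = - 1") auto
    qed (rule m1)
  qed
qed

text \<open>An irreducible module of the series in coordinates: the weights are
  \<open>h + k\<close>, \<open>c0\<close> and \<open>c i\<close> are the scalars of
  \<open>C_0\<close> and the other \<open>C_i\<close>, and \<open>irr\<close> is strong connectivity
  of the graph of nonzero entries.\<close>

locale gap_weights =
  fixes p :: int and S :: "int set" and \<phi> :: "int \<Rightarrow> int \<Rightarrow> complex" and h c0 :: complex and c :: "int \<Rightarrow> complex"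
  assumes p: "p > 1"
    and supp: "\<phi> m k \<noteq> 0 \<Longrightarrow> k \<in> S \<and> k + m \<in> S"
    and weight: "k \<in> S \<Longrightarrow> \<phi> 0 k = h + of_int k"
    and vir: "p dvd m \<Longrightarrow> p dvd n \<Longrightarrow> k \<in> S \<Longrightarrow> \<phi> m (k + n) * \<phi> n k - \<phi> n (k + m) * \<phi> m k =
        of_int (n - m) * \<phi> (m + n) k
        + (if m + n = 0 then (1 / 12) * ((of_int m / of_int p) ^ 3 - of_int m / of_int p) * c0 else 0)"
    and mixed: "p dvd m \<Longrightarrow> \<not> p dvd r \<Longrightarrow> k \<in> S \<Longrightarrow>
        \<phi> m (k + r) * \<phi> r k - \<phi> r (k + m) * \<phi> m k = of_int r * \<phi> (m + r) k"
    and heis: "\<not> p dvd r \<Longrightarrow> \<not> p dvd s \<Longrightarrow> k \<in> S \<Longrightarrow> \<phi> r (k + s) * \<phi> s k - \<phi> s (k + r) * \<phi> r k =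
        (if r + s = 0 then of_int r * c (r mod p) else 0)"
    and irr: "U \<subseteq> S \<Longrightarrow> U \<noteq> {} \<Longrightarrow> (\<And>k m. k \<in> U \<Longrightarrow> \<phi> m k \<noteq> 0 \<Longrightarrow> k + m \<in> U) \<Longrightarrow> U = S"
    and nonempty: "S \<noteq> {}"
begin

lemma zero_outside: "k \<notin> S \<Longrightarrow> \<phi> m k = 0"
  using supp by blast

section \<open>Heisenberg ladders and the vanishing of the centre\<close>

text \<open>The scalar of \<open>L_(-s) L_s\<close> at \<open>k\<close>, the number operator of a
  Heisenberg pair.\<close>

definition N :: "int \<Rightarrow> int \<Rightarrow> complex" where
  "N s k = \<phi> (- s) (k + s) * \<phi> s k"

lemma N_step: "\<not> p dvd s \<Longrightarrow> k \<in> S \<Longrightarrow> N s (k - s) = N s k + of_int s * c (s mod p)"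
  using heis[of s "- s" k] by (simp add: N_def algebra_simps)

lemma N_invariant:
  assumes "\<not> p dvd s" "\<not> p dvd t" "t \<noteq> s" "t \<noteq> - s" "\<phi> t k \<noteq> 0"
  shows "N s (k + t) = N s k"
proof -
  have k: "k \<in> S" using supp assms by blast
  have 1: "\<phi> s (k + t) * \<phi> t k = \<phi> t (k + s) * \<phi> s k" using heis[of s t k] assms k by auto
  have "N s (k + t) * \<phi> t k = \<phi> (- s) (k + s + t) * \<phi> t (k + s) * \<phi> s k"
    using 1 by (simp add: N_def add_ac mult_ac)
  also have "\<dots> = N s k * \<phi> t k"
  proof (cases "\<phi> s k = 0")
    case False
    then have "k + s \<in> S" using supp by blast
    then have "\<phi> (- s) (k + s + t) * \<phi> t (k + s) = \<phi> t k * \<phi> (- s) (k + s)"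
      using heis[of "- s" t "k + s"] assms by auto
    then show ?thesis by (simp add: N_def)
  qed (simp add: N_def)
  finally show ?thesis using assms by simp
qed

text \<open>A step by \<open>L_s\<close> lowers \<open>N s\<close> by \<open>s c\<close>; the
  hypothesis keeps it away from 0, so the next step is possible again. \<open>N t\<close> is carried
  along by \<open>N_invariant\<close>.\<close>

lemma ladder_up:
  assumes "\<not> p dvd s" "\<not> p dvd t" "t \<noteq> s" "t \<noteq> - s"
    and "\<And>j::nat. N s k \<noteq> of_nat j * of_int s * c (s mod p)" and "k \<in> S"
  shows "k + int j * s \<in> S \<and> N s (k + int j * s) = N s k - of_nat j * of_int s * c (s mod p)
    \<and> N t (k + int j * s) = N t k"
proof (induction j)
  case (Suc j)
  let ?k = "k + int j * s"
  have e: "k + int (Suc j) * s = ?k + s" by (simp add: algebra_simps)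
  have "N s ?k \<noteq> 0" using Suc assms(5)[of j] by auto
  then have nz: "\<phi> s ?k \<noteq> 0" by (auto simp: N_def)
  then have S: "?k + s \<in> S" using supp by blast
  show ?case unfolding e
    using S N_step[OF assms(1) S] N_invariant[of t s ?k] nz assms Suc by (auto simp: algebra_simps)
qed (use assms in simp)

lemma ladder_down:
  assumes "\<not> p dvd s" "\<not> p dvd t" "t \<noteq> s" "t \<noteq> - s"
    and "\<And>j::nat. N s k \<noteq> - of_nat (Suc j) * of_int s * c (s mod p)" and "k \<in> S"
  shows "k - int j * s \<in> S \<and> N s (k - int j * s) = N s k + of_nat j * of_int s * c (s mod p)
    \<and> N t (k - int j * s) = N t k"
proof (induction j)
  case (Suc j)
  let ?k = "k - int j * s"
  have e: "k - int (Suc j) * s = ?k - s" by (simp add: algebra_simps)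
  have step: "N s (?k - s) = N s ?k + of_int s * c (s mod p)" using N_step assms(1) Suc by blast
  then have "N s (?k - s) \<noteq> 0" using Suc assms(5)[of j] by (auto simp: algebra_simps eq_neg_iff_add_eq_0)
  then have nz: "\<phi> (- s) ?k \<noteq> 0" "\<phi> s (?k - s) \<noteq> 0" by (auto simp: N_def)
  then have S: "?k - s \<in> S" using supp by blast
  have "N t (?k + - s) = N t ?k" using N_invariant[of t "- s" ?k] nz assms by auto
  then show ?case unfolding e using S step Suc by (auto simp: algebra_simps)
qed (use assms in simp)

text \<open>\<open>L_r\<close> and \<open>L_(r + p)\<close> share the central element
  \<open>C_r\<close>. If it acts by a nonzero scalar, some \<open>l\<close> and
  \<open>l + r * s\<close> are joined by \<open>s\<close> steps of length \<open>r\<close>, which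
  fix \<open>N s\<close>, and by \<open>r\<close> steps of length \<open>s\<close>, which change it
  by \<open>r s c\<close>.\<close>

lemma central_zero_residue:
  assumes r: "1 \<le> r" "r \<le> p - 1"
  shows "c r = 0"
proof (rule ccontr)
  assume c: "c r \<noteq> 0"
  define s where "s = r + p"
  have rs: "\<not> p dvd r" "\<not> p dvd s" "s \<noteq> r" "s \<noteq> - r" "r \<noteq> s" "r \<noteq> - s" "r > 0" "s > 0"
    "r mod p = r" "s mod p = r"
    using r p zdvd_imp_le[of p r] by (auto simp: s_def)
  \<comment> \<open>A number cannot be both a nonnegative and a negative multiple of
    \<open>q c\<close>, so from every point at least one of the two ladders is infinite.\<close>
  have dir: "(\<forall>j::nat. x \<noteq> of_nat j * of_int q * c r) \<or> (\<forall>j::nat. x \<noteq> - of_nat (Suc j) * of_int q * c r)"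
    if "q > 0" for x and q :: int
  proof (rule ccontr)
    assume "\<not> ?thesis"
    then obtain i j :: nat where "x = of_nat i * of_int q * c r" "x = - of_nat (Suc j) * of_int q * c r" by blast
    then have "of_nat i * of_int q * c r = - of_nat (Suc j) * of_int q * c r" by (rule trans[OF sym])
    then have "(of_nat i + of_nat (Suc j)) * (of_int q * c r) = 0" by algebra
    then have "of_nat i + of_nat (Suc j) = (0::complex)" using c that by (simp del: of_nat_Suc)
    then have "of_nat (i + Suc j) = (0::complex)" by (simp only: of_nat_add)
    then show False unfolding of_nat_eq_0_iff by simp
  qed
  obtain k where k: "k \<in> S" using nonempty by blast
  obtain l where l: "l \<in> S" "l + r * s \<in> S" "N s (l + r * s) = N s l"
  proof -
    consider "\<forall>j::nat. N r k \<noteq> of_nat j * of_int r * c r" | "\<forall>j::nat. N r k \<noteq> - of_nat (Suc j) * of_int r * c r"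
      using dir rs by blast
    then show ?thesis
    proof cases
      case 1
      then have "k + int (nat s) * r \<in> S \<and> N s (k + int (nat s) * r) = N s k"
        using ladder_up[of r s k "nat s"] k rs by auto
      then show ?thesis using that[of k] k rs by (auto simp: mult.commute)
    next
      case 2
      then have "k - int (nat s) * r \<in> S \<and> N s (k - int (nat s) * r) = N s k"
        using ladder_down[of r s k "nat s"] k rs by auto
      then show ?thesis using that[of "k - s * r"] k rs by (auto simp: mult.commute)
    qed
  qed
  consider "\<forall>j::nat. N s l \<noteq> of_nat j * of_int s * c r" | "\<forall>j::nat. N s l \<noteq> - of_nat (Suc j) * of_int s * c r"
    using dir rs by blast
  then have "of_nat (nat r) * of_int s * c r = 0"
  proof cases
    case 1
    then show ?thesis using ladder_up[of s r l "nat r"] l rs by auto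
  next
    case 2
    then show ?thesis using ladder_down[of s r "l + r * s" "nat r"] l rs by auto
  qed
  then show False using c rs by auto
qed

lemma commute:
  assumes "\<not> p dvd r" "\<not> p dvd s"
  shows "\<phi> r (k + s) * \<phi> s k = \<phi> s (k + r) * \<phi> r k"
proof (cases "k \<in> S")
  case True
  have "r mod p \<noteq> 0" "0 \<le> r mod p" "r mod p < p" using assms p by (auto simp: dvd_eq_mod_eq_0)
  then have "c (r mod p) = 0" by (intro central_zero_residue) auto
  then show ?thesis using heis[OF assms True] by (auto split: if_splits)
qed (simp add: zero_outside)

lemma mixed_all:
  assumes "p dvd m" "\<not> p dvd r"
  shows "\<phi> m (k + r) * \<phi> r k = \<phi> r (k + m) * \<phi> m k + of_int r * \<phi> (m + r) k"
proof (cases "k \<in> S")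
  case True
  then show ?thesis using mixed[OF assms True] by (simp add: algebra_simps)
qed (simp add: zero_outside)

section \<open>Operators on formal sums of weight vectors\<close>

text \<open>\<open>L_m\<close> on formal sums of the \<open>f k e_k\<close>. These may be infinite,
  because each coefficient of the image comes from a single coefficient of \<open>f\<close>;
  operator identities then hold for arbitrary \<open>f\<close>.\<close>

definition T :: "int \<Rightarrow> (int \<Rightarrow> complex) \<Rightarrow> int \<Rightarrow> complex" where
  "T m f = (\<lambda>k. \<phi> m (k - m) * f (k - m))"

definition \<delta> :: "int \<Rightarrow> int \<Rightarrow> complex" where
  "\<delta> k = (\<lambda>i. if i = k then 1 else 0)"

lemma T_add: "T m (\<lambda>k. f k + g k) = (\<lambda>k. T m f k + T m g k)"
  by (simp add: T_def algebra_simps)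

lemma T_scale: "T m (\<lambda>k. x * f k) = (\<lambda>k. x * T m f k)"
  by (simp add: T_def algebra_simps)

lemma T_zero: "T m (\<lambda>_. 0) = (\<lambda>_. 0)"
  by (simp add: T_def)

lemma T_pow_zero: "(T m ^^ n) (\<lambda>_. 0) = (\<lambda>_. 0)"
  by (induction n) (simp_all add: T_zero)

lemma T_pow_add: "(T m ^^ n) (\<lambda>k. f k + g k) = (\<lambda>k. (T m ^^ n) f k + (T m ^^ n) g k)"
  by (induction n) (simp_all add: T_add)

lemma T_pow_scale: "(T m ^^ n) (\<lambda>k. x * f k) = (\<lambda>k. x * (T m ^^ n) f k)"
  by (induction n) (simp_all add: T_scale)

lemma T_\<delta>: "T m (\<delta> k) = (\<lambda>i. \<phi> m k * \<delta> (k + m) i)"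
  by (auto simp: T_def \<delta>_def fun_eq_iff)

lemma T_commute: "\<not> p dvd r \<Longrightarrow> \<not> p dvd s \<Longrightarrow> T r (T s f) = T s (T r f)"
proof
  fix k assume "\<not> p dvd r" "\<not> p dvd s"
  then show "T r (T s f) k = T s (T r f) k"
    using commute[of r s "k - r - s"] by (simp add: T_def algebra_simps)
qed

lemma T_mixed:
  assumes "p dvd m" "\<not> p dvd r"
  shows "T m (T r f) = (\<lambda>k. T r (T m f) k + of_int r * T (m + r) f k)"
proof
  fix k
  show "T m (T r f) k = T r (T m f) k + of_int r * T (m + r) f k"
    using arg_cong[OF mixed_all[OF assms, of "k - m - r"], of "\<lambda>x. x * f (k - m - r)"]
    by (simp add: T_def algebra_simps)
qed

lemma T_pow_commute: "\<not> p dvd r \<Longrightarrow> \<not> p dvd s \<Longrightarrow> T s ((T r ^^ n) f) = (T r ^^ n) (T s f)"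
  by (induction n) (simp_all add: T_commute)

lemma T_pow_pow_commute:
  "\<not> p dvd r \<Longrightarrow> \<not> p dvd s \<Longrightarrow> (T s ^^ l) ((T r ^^ n) f) = (T r ^^ n) ((T s ^^ l) f)"
  by (induction l) (simp_all add: T_pow_commute)

text \<open>\<open>ad L_m\<close> is a derivation with \<open>[L_m, L_r] = r L_(m + r)\<close>, and
  \<open>L_(m + r)\<close> commutes with \<open>L_r\<close>, so the \<open>n + 1\<close> terms
  agree.\<close>

lemma T_pow_mixed:
  assumes m: "p dvd m" and r: "\<not> p dvd r"
  shows "T m ((T r ^^ Suc n) f) =
    (\<lambda>k. (T r ^^ Suc n) (T m f) k + of_nat (Suc n) * of_int r * (T r ^^ n) (T (m + r) f) k)"
proof (induction n)
  case 0
  show ?case using T_mixed[OF assms] by simp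
next
  case (Suc n)
  have mr: "\<not> p dvd m + r" using m r by (simp add: dvd_add_right_iff)
  have "T m ((T r ^^ Suc (Suc n)) f) = T m (T r ((T r ^^ Suc n) f))" by simp
  also have "\<dots> = (\<lambda>k. T r (T m ((T r ^^ Suc n) f)) k + of_int r * T (m + r) ((T r ^^ Suc n) f) k)"
    by (rule T_mixed[OF assms])
  also have "T (m + r) ((T r ^^ Suc n) f) = (T r ^^ Suc n) (T (m + r) f)"
    by (rule T_pow_commute[OF r mr])
  also have "T r (T m ((T r ^^ Suc n) f)) = (\<lambda>k. (T r ^^ Suc (Suc n)) (T m f) k
      + of_nat (Suc n) * of_int r * (T r ^^ Suc n) (T (m + r) f) k)"
    unfolding Suc.IH by (simp add: T_add T_scale)
  finally show ?case by (simp add: algebra_simps)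
qed

lemma T_pow_coeff: "\<exists>P. \<forall>f k. (T m ^^ n) f k = P k * f (k - int n * m)"
proof (induction n)
  case 0
  show ?case by (intro exI[of _ "\<lambda>_. 1"]) simp
next
  case (Suc n)
  then obtain P where P: "\<And>f k. (T m ^^ n) f k = P k * f (k - int n * m)" by blast
  show ?case
  proof (intro exI allI)
    fix f k
    have "(T m ^^ Suc n) f k = \<phi> m (k - m) * (T m ^^ n) f (k - m)"
      by (simp only: funpow.simps o_apply T_def[of m "(T m ^^ n) f"])
    then show "(T m ^^ Suc n) f k = (\<phi> m (k - m) * P (k - m)) * f (k - int (Suc n) * m)"
      by (simp add: P algebra_simps)
  qed
qed

section \<open>Every class outside p\<int> acts by zero or bijectively\<close>

text \<open>The \<open>k\<close> for which a power of \<open>L_a\<close> kills \<open>e_k\<close>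
  form an invariant set: \<open>L_m\<close> commutes with \<open>L_a\<close> unless \<open>p\<close>
  divides \<open>m\<close>, and then passing it costs one more power by
  \<open>T_pow_mixed\<close>.\<close>

lemma locally_nilpotent:
  assumes a: "\<not> p dvd a" and k0: "k0 \<in> S" "\<phi> a k0 = 0" and k: "k \<in> S"
  shows "\<exists>n. (T a ^^ n) (\<delta> k) = (\<lambda>_. 0)"
proof -
  have "{k\<in>S. \<exists>n. (T a ^^ n) (\<delta> k) = (\<lambda>_. 0)} = S"
  proof (rule irr)
    have "(T a ^^ 1) (\<delta> k0) = (\<lambda>_. 0)" using k0 by (simp add: T_\<delta>)
    then show "{k\<in>S. \<exists>n. (T a ^^ n) (\<delta> k) = (\<lambda>_. 0)} \<noteq> {}" using k0 by blast
  next
    fix k m assume "k \<in> {k\<in>S. \<exists>n. (T a ^^ n) (\<delta> k) = (\<lambda>_. 0)}" and nz: "\<phi> m k \<noteq> 0"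
    then obtain n where n: "(T a ^^ n) (\<delta> k) = (\<lambda>_. 0)" by blast
    have "(T a ^^ Suc n) (T m (\<delta> k)) = (\<lambda>_. 0)"
    proof (cases "p dvd m")
      case True
      then have "\<not> p dvd m + a" using a by (simp add: dvd_add_right_iff)
      then have "(T a ^^ n) (T (m + a) (\<delta> k)) = (\<lambda>_. 0)"
        using T_pow_commute[of a "m + a" n "\<delta> k"] a n by (simp add: T_zero)
      moreover have "T m ((T a ^^ Suc n) (\<delta> k)) = (\<lambda>_. 0)" using n by (simp add: T_zero)
      ultimately show ?thesis using T_pow_mixed[OF True a, of n "\<delta> k"] by (simp add: fun_eq_iff)
    next
      case False
      then show ?thesis using T_pow_commute[OF a False, of "Suc n" "\<delta> k"] n by (simp add: T_zero)
    qed
    then have "\<phi> m k * (T a ^^ Suc n) (\<delta> (k + m)) i = 0" for i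
      unfolding T_\<delta> T_pow_scale by (rule fun_cong)
    then have "(T a ^^ Suc n) (\<delta> (k + m)) = (\<lambda>_. 0)" using nz by (simp add: fun_eq_iff)
    then show "k + m \<in> {k\<in>S. \<exists>n. (T a ^^ n) (\<delta> k) = (\<lambda>_. 0)}" using supp[OF nz] by blast
  qed auto
  then show ?thesis using k by blast
qed

text \<open>Being of degree 0, the monomial \<open>Z\<close> acts on each \<open>e_k\<close> by a
  scalar \<open>y k\<close>. By commutativity \<open>Z^n\<close> contains the factor
  \<open>L_a^n\<close>, which kills \<open>e_k\<close> for some \<open>n\<close>, so
  \<open>y k = 0\<close>.\<close>

lemma degree_zero_monomial_vanishes:
  assumes ab: "\<not> p dvd a" "\<not> p dvd b" and deg: "int (Suc x) * a + b = 0"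
    and nil: "\<And>k. k \<in> S \<Longrightarrow> \<exists>n. (T a ^^ n) (\<delta> k) = (\<lambda>_. 0)"
  shows "(T a ^^ Suc x) (T b f) = (\<lambda>_. 0)"
proof -
  define Z where "Z f = (T a ^^ Suc x) (T b f)" for f
  obtain P where P: "\<And>f k. (T a ^^ Suc x) f k = P k * f (k - int (Suc x) * a)" using T_pow_coeff by blast
  define y where "y k = P k * \<phi> b k" for k
  have Z: "Z f k = y k * f k" for f k
  proof -
    have "int (Suc x) * a = - b" using deg by linarith
    then show ?thesis unfolding Z_def P T_def by (simp only: y_def) simp
  qed
  have Zn: "(Z ^^ n) f k = y k ^ n * f k" for n f k
    by (induction n arbitrary: f) (simp_all add: Z)
  have Zab: "(Z ^^ n) f = (T b ^^ n) ((T a ^^ (Suc x * n)) f)" for n f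
  proof (induction n)
    case (Suc n)
    have "(Z ^^ Suc n) f = Z ((T b ^^ n) ((T a ^^ (Suc x * n)) f))" using Suc by simp
    also have "\<dots> = (T a ^^ Suc x) (T b ((T b ^^ n) ((T a ^^ (Suc x * n)) f)))" by (simp only: Z_def)
    also have "\<dots> = (T a ^^ Suc x) ((T b ^^ Suc n) ((T a ^^ (Suc x * n)) f))" by simp
    also have "\<dots> = (T b ^^ Suc n) ((T a ^^ Suc x) ((T a ^^ (Suc x * n)) f))"
      by (rule T_pow_pow_commute[OF ab(2,1)])
    also have "(T a ^^ Suc x) ((T a ^^ (Suc x * n)) f) = (T a ^^ (Suc x * Suc n)) f"
      by (simp only: mult_Suc_right funpow_add o_apply)
    finally show ?case .
  qed simp
  have y0: "y k = 0" if k: "k \<in> S" for k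
  proof -
    obtain n where n: "(T a ^^ n) (\<delta> k) = (\<lambda>_. 0)" using nil[OF k] by blast
    have "(T a ^^ (Suc x * n)) (\<delta> k) = (T a ^^ (x * n)) ((T a ^^ n) (\<delta> k))"
      by (simp only: mult_Suc add.commute[of n] funpow_add o_apply)
    then have "(Z ^^ n) (\<delta> k) k = 0" unfolding Zab n by (simp add: T_pow_zero)
    then show ?thesis unfolding Zn by (simp add: \<delta>_def)
  qed
  have "y k = 0" for k
    using y0[of k] zero_outside[of k b] by (cases "k \<in> S") (auto simp: y_def)
  then show ?thesis using Z[of f] by (simp add: Z_def fun_eq_iff)
qed

text \<open>
  Applying \<open>ad L\<^bsub>b-a\<^esub>\<close> to \<open>L\<^sub>a\<^bsup>n+1\<^esup> L\<^sub>b\<^bsup>d+1\<^esup> = 0\<close> and multiplying by \<open>L\<^sub>b\<close> trades one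
  factor \<open>L\<^sub>a\<close> for two factors \<open>L\<^sub>b\<close>.
\<close>

lemma trade_factor:
  assumes ab: "\<not> p dvd a" "\<not> p dvd b" "p dvd b - a"
    and X: "\<And>f. (T a ^^ Suc n) ((T b ^^ Suc d) f) = (\<lambda>_. 0)"
  shows "(T a ^^ n) ((T b ^^ (d + 3)) f) = (\<lambda>_. 0)"
proof -
  let ?m = "b - a"
  have mb: "\<not> p dvd ?m + b" using ab by (metis dvd_add_right_iff)
  \<comment> \<open>A spare factor \<open>L_b\<close>: when \<open>ad L_(b-a)\<close> consumes one
    of the others, \<open>d + 1\<close> are left and \<open>X\<close> still applies.\<close>
  let ?g = "T b f"
  have e1: "T ?m ((T a ^^ Suc n) ((T b ^^ Suc d) ?g)) = (\<lambda>k. (T a ^^ Suc n) (T ?m ((T b ^^ Suc d) ?g)) k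
      + of_nat (Suc n) * of_int a * (T a ^^ n) (T b ((T b ^^ Suc d) ?g)) k)"
    using T_pow_mixed[OF ab(3,1), of n "(T b ^^ Suc d) ?g"] by (simp only: diff_add_cancel)
  have e2: "(T a ^^ Suc n) (T ?m ((T b ^^ Suc d) ?g)) = (\<lambda>_. 0)"
  proof -
    have "(T a ^^ Suc n) (T ?m ((T b ^^ Suc d) ?g)) = (\<lambda>k. (T a ^^ Suc n) ((T b ^^ Suc d) (T ?m ?g)) k
        + of_nat (Suc d) * of_int b * (T a ^^ Suc n) ((T b ^^ d) (T (?m + b) ?g)) k)"
      unfolding T_pow_mixed[OF ab(3,2), of d ?g] T_pow_add T_pow_scale ..
    moreover have "(T b ^^ d) (T (?m + b) ?g) = (T b ^^ Suc d) (T (?m + b) f)"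
      by (simp only: T_commute[OF mb ab(2)] funpow_Suc_right o_apply)
    ultimately show ?thesis using X by simp
  qed
  have "of_nat (Suc n) * of_int a * (T a ^^ n) (T b ((T b ^^ Suc d) ?g)) k = 0" for k
    using fun_cong[OF e1, of k] unfolding X e2 T_zero by simp
  moreover have "a \<noteq> 0" using ab by auto
  ultimately have "(T a ^^ n) (T b ((T b ^^ Suc d) ?g)) = (\<lambda>_. 0)"
    unfolding fun_eq_iff by (simp del: of_nat_Suc)
  moreover have "T b ((T b ^^ Suc d) ?g) = (T b ^^ (d + 3)) f"
    by (simp add: funpow_swap1 numeral_3_eq_3)
  ultimately show ?thesis by simp
qed

text \<open>Take the least vanishing power \<open>L_b^(d+1) = 0\<close>. Applying
  \<open>ad L_m\<close> gives \<open>L_(m+b) L_b^d = 0\<close> whenever \<open>p\<close> divides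
  \<open>m\<close>, so each \<open>e_k\<close> occurring in the image of \<open>L_b^d\<close> is
  killed by the whole class; the set of such killed \<open>e_k\<close> is invariant.\<close>

lemma class_vanishes_of_nilpotent:
  assumes b: "\<not> p dvd b" and nil: "\<And>f. (T b ^^ n) f = (\<lambda>_. 0)" and x: "p dvd x - b"
  shows "\<phi> x k = 0"
proof -
  define n0 where "n0 = (LEAST n. \<forall>f. (T b ^^ n) f = (\<lambda>_. 0))"
  have n0: "\<forall>f. (T b ^^ n0) f = (\<lambda>_. 0)" unfolding n0_def by (rule LeastI[of _ n]) (use nil in blast)
  have "n0 \<noteq> 0"
  proof
    assume "n0 = 0"
    then have "\<delta> 0 = (\<lambda>_. 0)" using spec[OF n0, of "\<delta> 0"] by simp
    from fun_cong[OF this, of 0] show False by (simp add: \<delta>_def)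
  qed
  then obtain d where d: "n0 = Suc d" using not0_implies_Suc by blast
  then have "d < n0" by simp
  then have "\<not> (\<forall>f. (T b ^^ d) f = (\<lambda>_. 0))" unfolding n0_def by (rule not_less_Least)
  then obtain f i where fi: "(T b ^^ d) f i \<noteq> 0" by (auto simp: fun_eq_iff)
  have kill: "T (m + b) ((T b ^^ d) g) = (\<lambda>_. 0)" if m: "p dvd m" for m g
  proof -
    have mb: "\<not> p dvd m + b" using m b by (simp add: dvd_add_right_iff)
    have "(\<lambda>k. of_nat (Suc d) * of_int b * (T b ^^ d) (T (m + b) g) k) = (\<lambda>_. 0)"
      using T_pow_mixed[OF m b, of d g] n0 unfolding d by (simp add: T_zero del: funpow.simps)
    moreover have "b \<noteq> 0" using b by auto
    ultimately have "(T b ^^ d) (T (m + b) g) = (\<lambda>_. 0)" unfolding fun_eq_iff by (simp del: of_nat_Suc)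
    then show ?thesis using T_pow_commute[OF b mb] by simp
  qed
  have dead: "\<phi> (m + b) k = 0" if "p dvd m" "(T b ^^ d) g k \<noteq> 0" for m g k
    using fun_cong[OF kill[OF that(1), of g], of "k + m + b"] that by (simp add: T_def)
  define U where "U = {k\<in>S. \<forall>m. p dvd m \<longrightarrow> \<phi> (m + b) k = 0}"
  have "U = S"
  proof (rule irr)
    show "U \<subseteq> S" by (auto simp: U_def)
    show "U \<noteq> {}"
    proof (cases d)
      case 0
      obtain k where "k \<in> S" using nonempty by blast
      moreover have "(T b ^^ d) (\<delta> k) k \<noteq> 0" by (simp add: 0 \<delta>_def)
      ultimately show ?thesis using dead[of _ "\<delta> k" k] by (auto simp: U_def)
    next
      case (Suc d')
      \<comment> \<open>\<open>f\<close> is arbitrary on \<open>\<int>\<close>, but the outermost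
        factor \<open>L_b\<close> forces \<open>i\<close> into \<open>S\<close>.\<close>
      then have "(T b ^^ d) f i = \<phi> b (i - b) * (T b ^^ d') f (i - b)"
        by (simp only: funpow.simps o_apply T_def[of b "(T b ^^ d') f"])
      then have "\<phi> b (i - b) \<noteq> 0" using fi by auto
      then have "i \<in> S" using supp by fastforce
      then show ?thesis using dead[OF _ fi] by (auto simp: U_def)
    qed
  next
    fix k j assume k: "k \<in> U" and nz: "\<phi> j k \<noteq> 0"
    have "\<phi> (m + b) (k + j) = 0" if m: "p dvd m" for m
    proof -
      have mb: "\<not> p dvd m + b" using m b by (simp add: dvd_add_right_iff)
      have z: "\<phi> (m + b) k = 0" using k m by (simp add: U_def)
      have "\<phi> (m + b) (k + j) * \<phi> j k = 0"
      proof (cases "p dvd j")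
        case True
        then have "\<phi> (j + (m + b)) k = 0" using k m dvd_add[of p j m] by (simp add: U_def flip: add.assoc)
        then show ?thesis using mixed_all[OF True mb, of k] z by simp
      next
        case False
        then show ?thesis using commute[OF mb False, of k] z by simp
      qed
      then show ?thesis using nz by simp
    qed
    then show "k + j \<in> U" using supp[OF nz] by (auto simp: U_def)
  qed
  then show ?thesis using x zero_outside[of k x] by (cases "k \<in> S") (auto simp: U_def dest!: spec[of _ "x - b"])
qed

lemma class_dichotomy:
  assumes a: "\<not> p dvd a" and k0: "k0 \<in> S" "\<phi> a k0 = 0" and x: "p dvd x - a"
  shows "\<phi> x k = 0"
proof -
  \<comment> \<open>This \<open>b\<close> is congruent to \<open>a\<close> modulo \<open>p\<close>
    and gives \<open>L_a^(p-1) L_b\<close> degree 0; \<open>Suc d\<close> is the exponent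
    \<open>p - 1\<close>.\<close>
  define b where "b = a * (1 - p)"
  define d where "d = nat (p - 2)"
  have pd: "p = int d + 2" using p by (simp add: d_def)
  have ba: "p dvd b - a" by (simp add: b_def algebra_simps)
  have b: "\<not> p dvd b" using a dvd_diff[OF _ ba, of b] by auto
  have "(T a ^^ Suc d) (T b f) = (\<lambda>_. 0)" for f
  proof (rule degree_zero_monomial_vanishes[OF a b])
    show "int (Suc d) * a + b = 0" by (simp add: b_def pd algebra_simps)
  qed (rule locally_nilpotent[OF a k0])
  then have start: "(T a ^^ Suc d) ((T b ^^ Suc 0) f) = (\<lambda>_. 0)" for f by simp
  \<comment> \<open>\<open>trade_factor\<close> lowers the exponent of \<open>L_a\<close> one by one
    from \<open>Suc d\<close> to 0 and leaves a vanishing power of \<open>L_b\<close>.\<close>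
  have "\<exists>l. \<forall>f. (T a ^^ n) ((T b ^^ Suc l) f) = (\<lambda>_. 0)" if "n \<le> Suc d" for n
    using that
  proof (induction n rule: inc_induct)
    case base
    then show ?case using start by blast
  next
    case (step n)
    then obtain l where l: "\<And>f. (T a ^^ Suc n) ((T b ^^ Suc l) f) = (\<lambda>_. 0)" by blast
    have "(T a ^^ n) ((T b ^^ Suc (l + 2)) f) = (\<lambda>_. 0)" for f
      using trade_factor[OF a b ba l, of f] by (simp add: numeral_3_eq_3 numeral_2_eq_2)
    then show ?case by blast
  qed
  from this[of 0] obtain l where l: "\<And>f. (T b ^^ Suc l) f = (\<lambda>_. 0)" by auto
  have "p dvd x - b" using x ba dvd_diff[of p "x - a" "b - a"] by simp
  then show ?thesis by (rule class_vanishes_of_nilpotent[OF b l])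
qed

lemma gauge:
  assumes g: "\<And>k. g k \<noteq> 0"
  shows "gap_weights p S (\<lambda>m k. \<phi> m k * g k / g (k + m)) h c0 c"
proof -
  have comb: "\<phi> m (k + n) * g (k + n) / g (k + n + m) * (\<phi> n k * g k / g (k + n)) -
      \<phi> n (k + m) * g (k + m) / g (k + m + n) * (\<phi> m k * g k / g (k + m)) =
      (\<phi> m (k + n) * \<phi> n k - \<phi> n (k + m) * \<phi> m k) * (g k / g (k + (m + n)))" for m n k
    using g by (simp add: field_simps add_ac)
  show ?thesis
  proof
    fix m n k assume "p dvd m" "p dvd n" "k \<in> S"
    then show "\<phi> m (k + n) * g (k + n) / g (k + n + m) * (\<phi> n k * g k / g (k + n)) -
      \<phi> n (k + m) * g (k + m) / g (k + m + n) * (\<phi> m k * g k / g (k + m)) =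
      of_int (n - m) * (\<phi> (m + n) k * g k / g (k + (m + n))) +
      (if m + n = 0 then (1 / 12) * ((of_int m / of_int p) ^ 3 - of_int m / of_int p) * c0 else 0)"
      unfolding comb by (cases "m + n = 0") (simp_all add: vir g)
  next
    fix m r k assume "p dvd m" "\<not> p dvd r" "k \<in> S"
    then show "\<phi> m (k + r) * g (k + r) / g (k + r + m) * (\<phi> r k * g k / g (k + r)) -
      \<phi> r (k + m) * g (k + m) / g (k + m + r) * (\<phi> m k * g k / g (k + m)) =
      of_int r * (\<phi> (m + r) k * g k / g (k + (m + r)))"
      unfolding comb by (simp add: mixed)
  next
    fix r s k assume "\<not> p dvd r" "\<not> p dvd s" "k \<in> S"
    then show "\<phi> r (k + s) * g (k + s) / g (k + s + r) * (\<phi> s k * g k / g (k + s)) -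
      \<phi> s (k + r) * g (k + r) / g (k + r + s) * (\<phi> r k * g k / g (k + r)) =
      (if r + s = 0 then of_int r * c (r mod p) else 0)"
      unfolding comb using g by (simp add: heis)
  next
    fix U assume "U \<subseteq> S" "U \<noteq> {}" "\<And>k m. k \<in> U \<Longrightarrow> \<phi> m k * g k / g (k + m) \<noteq> 0 \<Longrightarrow> k + m \<in> U"
    then show "U = S" using g by (intro irr) auto
  qed (use g supp weight nonempty p in auto)
qed

section \<open>The normal form when all classes outside p\<int> act by zero\<close>

text \<open>All of \<open>S\<close> then lies in one class \<open>k0 + p\<int>\<close>, on which the
  operators \<open>L_(p m) / p\<close> satisfy the Virasoro relations, so \<open>density\<close>
  applies. The bracket is divided by \<open>p^2\<close>, whence the central scalar
  \<open>c0 / (12 p^2)\<close>.\<close>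

lemma trivial_action:
  assumes T0: "\<And>r k. \<not> p dvd r \<Longrightarrow> \<phi> r k = 0"
  obtains \<beta> k0 g where "k0 \<in> S" "\<And>k. g k \<noteq> 0" "c0 = 0" "\<And>k. k \<in> S \<Longrightarrow> p dvd k - k0"
    "\<And>k m. k \<in> S \<Longrightarrow> p dvd m \<Longrightarrow> \<phi> m k * g k / g (k + m) = h + of_int k + of_int m * \<beta>"
proof -
  obtain k0 where k0: "k0 \<in> S" using nonempty by blast
  have "{k\<in>S. p dvd k - k0} = S"
  proof (rule irr)
    fix k m assume k: "k \<in> {k\<in>S. p dvd k - k0}" and nz: "\<phi> m k \<noteq> 0"
    then have "p dvd m" using T0 by blast
    then have "p dvd (k - k0) + m" using k by simp
    then show "k + m \<in> {k\<in>S. p dvd k - k0}" using supp[OF nz] by (simp add: algebra_simps)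
  qed (use k0 in auto)
  then have S: "p dvd k - k0" if "k \<in> S" for k using that by blast
  have pz: "of_int p \<noteq> (0::complex)" using p by simp
  interpret V: vir_weights "{i. k0 + p * i \<in> S}" "\<lambda>m i. \<phi> (p * m) (k0 + p * i) / of_int p"
    "(h + of_int k0) / of_int p" "c0 / (12 * of_int p ^ 2)"
  proof
    fix m i assume "\<phi> (p * m) (k0 + p * i) / of_int p \<noteq> 0"
    then show "i \<in> {i. k0 + p * i \<in> S} \<and> i + m \<in> {i. k0 + p * i \<in> S}"
      using supp[of "p * m" "k0 + p * i"] by (simp add: algebra_simps)
  next
    fix i assume "i \<in> {i. k0 + p * i \<in> S}"
    then show "\<phi> (p * 0) (k0 + p * i) / of_int p = (h + of_int k0) / of_int p + of_int i"
      using weight[of "k0 + p * i"] pz by (simp add: field_simps)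
  next
    fix i m n assume "i \<in> {i. k0 + p * i \<in> S}"
    then have i: "k0 + p * i \<in> S" by simp
    have "\<phi> (p * m) (k0 + p * (i + n)) * \<phi> (p * n) (k0 + p * i) - \<phi> (p * n) (k0 + p * (i + m)) * \<phi> (p * m) (k0 + p * i) =
      of_int p * of_int (n - m) * \<phi> (p * (m + n)) (k0 + p * i) +
      (if m + n = 0 then 1 / 12 * (of_int m ^ 3 - of_int m) * c0 else 0)"
    proof -
      have e: "k0 + p * (i + n) = k0 + p * i + p * n" "k0 + p * (i + m) = k0 + p * i + p * m"
        "p * (m + n) = p * m + p * n" by (simp_all add: distrib_left)
      have "p * m + p * n = 0 \<longleftrightarrow> m + n = 0" using p by (simp flip: distrib_left)
      then show ?thesis unfolding e using vir[of "p * m" "p * n", OF _ _ i] pz by (simp add: right_diff_distrib)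
    qed
    then show "\<phi> (p * m) (k0 + p * (i + n)) / of_int p * (\<phi> (p * n) (k0 + p * i) / of_int p) -
      \<phi> (p * n) (k0 + p * (i + m)) / of_int p * (\<phi> (p * m) (k0 + p * i) / of_int p) =
      of_int (n - m) * (\<phi> (p * (m + n)) (k0 + p * i) / of_int p) +
      (if m + n = 0 then (of_int m ^ 3 - of_int m) * (c0 / (12 * of_int p ^ 2)) else 0)"
      using pz by (simp add: divide_simps power2_eq_square mult_ac split: if_splits)
  next
    fix U assume U: "U \<subseteq> {i. k0 + p * i \<in> S}" "U \<noteq> {}"
      "\<And>i m. i \<in> U \<Longrightarrow> \<phi> (p * m) (k0 + p * i) / of_int p \<noteq> 0 \<Longrightarrow> i + m \<in> U"
    have "(\<lambda>i. k0 + p * i) ` U = S"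
    proof (rule irr)
      fix k m assume "k \<in> (\<lambda>i. k0 + p * i) ` U" and nz: "\<phi> m k \<noteq> 0"
      then obtain i where i: "i \<in> U" "k = k0 + p * i" by blast
      from nz T0 have "p dvd m" by blast
      then obtain l where l: "m = p * l" by blast
      have "i + l \<in> U" using U(3)[OF i(1), of l] nz i l pz by simp
      then show "k + m \<in> (\<lambda>i. k0 + p * i) ` U"
        using i l by (intro image_eqI[of _ _ "i + l"]) (simp_all add: algebra_simps)
    qed (use U in auto)
    then show "U = {i. k0 + p * i \<in> S}" using p by auto
  next
    show "{i. k0 + p * i \<in> S} \<noteq> {}" using k0 by (auto intro: exI[of _ 0])
  qed
  obtain \<beta> g where g: "\<And>i. g i \<noteq> 0" "\<And>i m. i \<in> {i. k0 + p * i \<in> S} \<Longrightarrow>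
      \<phi> (p * m) (k0 + p * i) / of_int p * g i / g (i + m) = (h + of_int k0) / of_int p + of_int i + of_int m * \<beta>"
    using V.density by blast
  show ?thesis
  proof (rule that[of k0 "\<lambda>k. g ((k - k0) div p)" \<beta>])
    show "c0 = 0" using V.central_charge_zero[OF g] pz by simp
    fix k m assume k: "k \<in> S" and "p dvd m"
    then obtain l where l: "m = p * l" by blast
    from S[OF k] obtain i where "k - k0 = p * i" by blast
    then have i: "k = k0 + p * i" by simp
    have "(k - k0) div p = i" using i p by simp
    moreover have "(k + m - k0) div p = i + l" using i l p by (simp flip: distrib_left)
    ultimately show "\<phi> m k * g ((k - k0) div p) / g ((k + m - k0) div p) = h + of_int k + of_int m * \<beta>"
      using g(2)[of i l] k i l pz g(1)[of "i + l"] by (simp add: field_simps)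
  qed (use k0 g S in auto)
qed

section \<open>The normal form when some class acts bijectively\<close>

lemma class_nonzero:
  assumes "\<not> p dvd s" "\<phi> s k0 \<noteq> 0" "p dvd x - s" "k \<in> S"
  shows "\<phi> x k \<noteq> 0"
proof
  assume "\<phi> x k = 0"
  moreover have "\<not> p dvd x" using assms(1) dvd_diff[OF _ assms(3), of x] by auto
  moreover have "p dvd s - x" using assms(3) by (metis dvd_diff_commute)
  ultimately have "\<phi> s k0 = 0" using class_dichotomy[of x k s k0] assms(4) by blast
  then show False using assms by simp
qed

text \<open>A nonzero class has no vanishing entry on \<open>S\<close>, so \<open>S\<close> is
  closed under all steps congruent to \<open>s\<close>. The shift by \<open>q\<close> consists of
  \<open>p - 1\<close> steps \<open>s\<close> and one step \<open>s - p * s + q\<close>.\<close>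

lemma support_class:
  assumes s: "\<not> p dvd s" "\<phi> s k0 \<noteq> 0"
  shows "p dvd q \<Longrightarrow> k + q \<in> S \<longleftrightarrow> k \<in> S" and "k \<in> S \<Longrightarrow> k - s \<in> S"
proof -
  have add: "k + x \<in> S" if "k \<in> S" "p dvd x - s" for k x
    using class_nonzero[OF s that(2,1)] supp by blast
  have multiple: "k + int j * s \<in> S" if "k \<in> S" for k j
  proof (induction j)
    case (Suc j)
    have "k + int j * s + s \<in> S" using add[OF Suc, of s] by simp
    then show ?case by (simp add: algebra_simps)
  qed (use that in simp)
  have shift: "k + q \<in> S" if k: "k \<in> S" and q: "p dvd q" for k q
  proof -
    have "k + int (nat (p - 1)) * s + (s - p * s + q) \<in> S"
      by (rule add[OF multiple[OF k]]) (use q in simp)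
    then show ?thesis using p by (simp add: algebra_simps)
  qed
  show "k + q \<in> S \<longleftrightarrow> k \<in> S" if "p dvd q" using shift[of k q] shift[of "k + q" "- q"] that by auto
  show "k - s \<in> S" if "k \<in> S"
    using shift[OF multiple[OF that, of "nat (p - 1)"], of "- (p * s)"] p by (simp add: algebra_simps)
qed

text \<open>The operator \<open>L\<^bsub>s+p\<^esub> L\<^sub>s\<^sup>-\<^sup>1\<close> commutes with every \<open>L\<^sub>r\<close>, \<open>r \<notin> p\<int>\<close>; the gauge turns it
  into the shift by \<open>p\<close>.\<close>

lemma periodic_gauge:
  assumes s: "\<not> p dvd s" "\<phi> s k0 \<noteq> 0"
  obtains g where "\<And>k. g k \<noteq> 0"
    "\<And>r k. \<not> p dvd r \<Longrightarrow> \<phi> r (k + p) * g (k + p) / g (k + p + r) = \<phi> r k * g k / g (k + r)"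
proof -
  have per: "k + p \<in> S \<longleftrightarrow> k \<in> S" for k using support_class(1)[OF s] by simp
  have sp: "\<not> p dvd s + p" using s by simp
  have nz: "\<phi> s (k - s) \<noteq> 0" "\<phi> (s + p) (k - s) \<noteq> 0" if "k \<in> S" for k
    using class_nonzero[OF s] support_class(2)[OF s that] by simp_all
  define \<rho> where "\<rho> k = (if k \<in> S then \<phi> (s + p) (k - s) / \<phi> s (k - s) else 1)" for k
  have "\<rho> k \<noteq> 0" for k using nz by (simp add: \<rho>_def)
  moreover have "p > 0" using p by simp
  ultimately obtain g where g: "\<And>k. g k \<noteq> 0" "\<And>k. g (k + p) = \<rho> k * g k"
    using multiplicative_primitive_step by blast
  show ?thesis
  proof (rule that[OF g(1)])
    fix r k assume r: "\<not> p dvd r"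
    show "\<phi> r (k + p) * g (k + p) / g (k + p + r) = \<phi> r k * g k / g (k + r)"
    proof (cases "k \<in> S \<and> k + r \<in> S")
      case False
      then have "\<phi> r k = 0" "\<phi> r (k + p) = 0"
        using supp[of r k] supp[of r "k + p"] per[of k] per[of "k + r"] by (auto simp: add_ac)
      then show ?thesis by simp
    next
      case True
      define q where "q = k - s"
      have nzq: "\<phi> s q \<noteq> 0" "\<phi> s (q + r) \<noteq> 0" "\<phi> (s + p) (q + r) \<noteq> 0"
        using nz[of k] nz[of "k + r"] True by (simp_all add: q_def algebra_simps)
      have "\<phi> r (q + (s + p)) * \<phi> (s + p) q = \<phi> (s + p) (q + r) * \<phi> r q" by (rule commute[OF r sp])
      moreover have "\<phi> r (q + s) * \<phi> s q = \<phi> s (q + r) * \<phi> r q" by (rule commute[OF r s(1)])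
      ultimately have "\<phi> r (k + p) * \<phi> (s + p) q * \<phi> s (q + r) = \<phi> (s + p) (q + r) * \<phi> r k * \<phi> s q"
        by (simp add: q_def add_ac)
      then have "\<phi> r (k + p) * \<rho> k = \<rho> (k + r) * \<phi> r k"
        using True nzq by (simp add: \<rho>_def divide_simps q_def algebra_simps)
      moreover have "g (k + p + r) = \<rho> (k + r) * g (k + r)" using g(2)[of "k + r"] by (simp add: add_ac)
      moreover have "\<rho> (k + r) \<noteq> 0" using nzq True by (simp add: \<rho>_def q_def algebra_simps)
      ultimately show ?thesis using g by (simp add: frac_eq_eq)
    qed
  qed
qed

lemma periodic_multiple:
  fixes f :: "int \<Rightarrow> 'b"
  assumes per: "\<And>k. f (k + p) = f k" and q: "p dvd q"
  shows "f (k + q) = f k"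
proof -
  have pos: "f (k + p * int n) = f k" for k n
  proof (induction n)
    case (Suc n)
    then show ?case using per[of "k + p * int n"] by (simp add: algebra_simps)
  qed simp
  from q obtain l where l: "q = p * l" by blast
  show ?thesis
  proof (cases "l \<ge> 0")
    case True
    then show ?thesis using pos[of k "nat l"] l by simp
  next
    case False
    then show ?thesis using pos[of "k + q" "nat (- l)"] l by simp
  qed
qed

text \<open>By periodicity \<open>L_r\<close> has the same entry at \<open>k + m\<close> as at
  \<open>k\<close>, so the mixed relation gives the increment of \<open>\<phi> m\<close> along an
  edge; the right side is itself periodic in \<open>k\<close>.\<close>

lemma difference_quotient:
  assumes per: "\<And>r k. \<not> p dvd r \<Longrightarrow> \<phi> r (k + p) = \<phi> r k"
    and "p dvd m" "\<not> p dvd r" "\<phi> r k \<noteq> 0"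
  shows "\<phi> m (k + r) - \<phi> m k = of_int r * \<phi> (m + r) k / \<phi> r k"
proof -
  have "\<phi> r (k + m) = \<phi> r k" using periodic_multiple[of "\<phi> r", OF per] assms by blast
  then show ?thesis using mixed_all[OF assms(2,3), of k] assms(4) by (simp add: field_simps)
qed

text \<open>By \<open>difference_quotient\<close> the increment \<open>\<eta> m\<close> over one
  period is constant along edges outside \<open>p\<int>\<close>. It is also
  \<open>p\<close>-periodic, because \<open>k - s\<close> is joined to both \<open>k\<close> and
  \<open>k + p\<close>. Connectivity makes it constant on \<open>S\<close>.\<close>

lemma slope:
  assumes s: "\<not> p dvd s" "\<phi> s k0 \<noteq> 0"
    and per: "\<And>r k. \<not> p dvd r \<Longrightarrow> \<phi> r (k + p) = \<phi> r k"
  obtains y where "\<And>m k q. p dvd m \<Longrightarrow> p dvd q \<Longrightarrow> k \<in> S \<Longrightarrow> \<phi> m (k + q) = \<phi> m k + of_int q * y m"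
    "y 0 = 1" "\<And>m n. p dvd m \<Longrightarrow> p dvd n \<Longrightarrow> m \<noteq> n \<Longrightarrow> y m * y n = y (m + n)"
proof -
  have Sper: "k + q \<in> S \<longleftrightarrow> k \<in> S" if "p dvd q" for k q using support_class(1)[OF s that] .
  have nz: "\<phi> x k \<noteq> 0" if "p dvd x - s" "k \<in> S" for x k using class_nonzero[OF s that] .
  define \<eta> where "\<eta> m k = \<phi> m (k + p) - \<phi> m k" for m k
  have dq: "\<phi> m (k + r) - \<phi> m k = of_int r * \<phi> (m + r) k / \<phi> r k"
    if "p dvd m" "\<not> p dvd r" "\<phi> r k \<noteq> 0" for m r k
    using difference_quotient[of m r k] per that by blast
  have eta_edge: "\<eta> m (k + r) = \<eta> m k" if "p dvd m" "\<not> p dvd r" "\<phi> r k \<noteq> 0" for m r k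
  proof -
    have mr: "\<not> p dvd m + r" using that by (simp add: dvd_add_right_iff)
    have "\<phi> m (k + p + r) - \<phi> m (k + p) = \<phi> m (k + r) - \<phi> m k"
      using dq[OF that] dq[OF that(1,2), of "k + p"] per[OF that(2)] per[OF mr] that(3) by simp
    then show ?thesis by (simp add: \<eta>_def algebra_simps)
  qed
  have eta_p: "\<eta> m (k + p) = \<eta> m k" if m: "p dvd m" and k: "k \<in> S" for m k
  proof -
    have sp: "\<not> p dvd s + p" using s by simp
    have ks: "k - s \<in> S" by (rule support_class(2)[OF s k])
    have "\<eta> m (k - s + s) = \<eta> m (k - s)" by (rule eta_edge[OF m s(1)]) (use nz ks in simp)
    moreover have "\<eta> m (k - s + (s + p)) = \<eta> m (k - s)" by (rule eta_edge[OF m sp]) (use nz ks in simp)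
    ultimately show ?thesis by (simp add: algebra_simps)
  qed
  have eta_q: "\<eta> m (k + q) = \<eta> m k" if m: "p dvd m" and k: "k \<in> S" and q: "p dvd q" for m k q
  proof -
    have "(if k + p \<in> S then \<eta> m (k + p) else 0) = (if k \<in> S then \<eta> m k else 0)" for k
      using eta_p[OF m] Sper[of p k] by simp
    from periodic_multiple[of "\<lambda>k. if k \<in> S then \<eta> m k else 0", OF this q, of k]
    show ?thesis using k Sper[OF q, of k] by simp
  qed
  obtain k1 where k1: "k1 \<in> S" using nonempty by blast
  have eta_const: "\<eta> m k = \<eta> m k1" if m: "p dvd m" and k: "k \<in> S" for m k
  proof -
    have "{k\<in>S. \<eta> m k = \<eta> m k1} = S"
    proof (rule irr)
      fix k j assume "k \<in> {k\<in>S. \<eta> m k = \<eta> m k1}" and e: "\<phi> j k \<noteq> 0"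
      then show "k + j \<in> {k\<in>S. \<eta> m k = \<eta> m k1}"
        using supp[OF e] eta_edge[OF m _ e] eta_q[OF m, of k j] by (cases "p dvd j") auto
    qed (use k1 in auto)
    then show ?thesis using k by blast
  qed
  have pz: "of_int p \<noteq> (0::complex)" using p by simp
  define y where "y m = \<eta> m k1 / of_int p" for m
  have affine: "\<phi> m (k + q) = \<phi> m k + of_int q * y m" if m: "p dvd m" and q: "p dvd q" and k: "k \<in> S" for m k q
  proof -
    have "(if k + p \<in> S then \<phi> m (k + p) - of_int (k + p) * y m else 0) =
        (if k \<in> S then \<phi> m k - of_int k * y m else 0)" for k
    proof -
      have "of_int p * y m = \<phi> m (k + p) - \<phi> m k" if "k \<in> S"
        using eta_const[OF m that] pz by (simp add: \<eta>_def y_def)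
      then show ?thesis using Sper[of p k] by (auto simp: algebra_simps)
    qed
    from periodic_multiple[of "\<lambda>k. if k \<in> S then \<phi> m k - of_int k * y m else 0", OF this q, of k]
    show ?thesis using k Sper[OF q, of k] by (simp add: algebra_simps)
  qed
  show ?thesis
  proof (rule that[OF affine])
    have "k1 + p \<in> S" using Sper k1 by simp
    then show "y 0 = 1" using weight k1 pz by (simp add: y_def \<eta>_def)
    fix m n assume m: "p dvd m" and n: "p dvd n" and mn: "m \<noteq> n"
    define C where "C = (if m + n = 0 then (1 / 12) * ((of_int m / of_int p) ^ 3 - of_int m / of_int p) * c0 else 0)"
    have rel: "of_int n * y m * \<phi> n k - of_int m * y n * \<phi> m k = of_int (n - m) * \<phi> (m + n) k + C" if k: "k \<in> S" for k
      using vir[OF m n k] affine[OF m n k] affine[OF n m k] unfolding C_def[symmetric] by (simp add: algebra_simps)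
    \<comment> \<open>Subtracting the Virasoro relation at \<open>k1\<close> from the one at
      \<open>k1 + p\<close> cancels the central term and leaves the product rule for
      \<open>y\<close>.\<close>
    have "of_int n * y m * \<phi> n (k1 + p) - of_int m * y n * \<phi> m (k1 + p) = of_int (n - m) * \<phi> (m + n) (k1 + p) + C"
      using rel[of "k1 + p"] Sper[of p k1] k1 by simp
    moreover have "\<phi> n (k1 + p) = \<phi> n k1 + of_int p * y n" "\<phi> m (k1 + p) = \<phi> m k1 + of_int p * y m"
      "\<phi> (m + n) (k1 + p) = \<phi> (m + n) k1 + of_int p * y (m + n)"
      using affine[OF m _ k1, of p] affine[OF n _ k1, of p] affine[of "m + n", OF _ _ k1, of p] m n by simp_all
    ultimately have "of_int (n - m) * (of_int p * y (m + n)) = of_int (n - m) * (of_int p * (y m * y n))"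
      using rel[OF k1] unfolding of_int_diff by algebra
    moreover have "of_int (n - m) \<noteq> (0::complex)" using mn unfolding of_int_eq_0_iff by simp
    ultimately show "y m * y n = y (m + n)" using pz by (metis mult_cancel_left)
  qed
qed

text \<open>By the product rule \<open>y\<close> is an exponential on \<open>p\<int>\<close>, with
  \<open>L * p\<close> a logarithm of \<open>y p\<close>; rescaling \<open>e_k\<close> by
  \<open>exp (L * k)\<close> brings all slopes to 1.\<close>

lemma exponential_gauge:
  assumes s: "\<not> p dvd s" "\<phi> s k0 \<noteq> 0"
    and per: "\<And>r k. \<not> p dvd r \<Longrightarrow> \<phi> r (k + p) = \<phi> r k"
  obtains L where "\<And>m k q. p dvd m \<Longrightarrow> p dvd q \<Longrightarrow> k \<in> S \<Longrightarrow>
    \<phi> m (k + q) * exp (- L * of_int m) = \<phi> m k * exp (- L * of_int m) + of_int q"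
proof -
  obtain y where y: "\<And>m k q. p dvd m \<Longrightarrow> p dvd q \<Longrightarrow> k \<in> S \<Longrightarrow> \<phi> m (k + q) = \<phi> m k + of_int q * y m"
    "y 0 = 1" "\<And>m n. p dvd m \<Longrightarrow> p dvd n \<Longrightarrow> m \<noteq> n \<Longrightarrow> y m * y n = y (m + n)"
    by (rule slope[OF s per]) blast+
  have pz: "of_int p \<noteq> (0::complex)" using p by simp
  have "y p * y (- p) = 1" using y(2) y(3)[of p "- p"] p by simp
  then have yp: "y p \<noteq> 0" by auto
  define L where "L = Complex (ln (cmod (y p))) (Arg (y p)) / of_int p"
  have "exp (Complex (ln (cmod (y p))) (Arg (y p))) = y p"
    using yp rcis_cmod_Arg[of "y p"] by (simp add: exp_eq_polar rcis_def)
  then have L: "exp (L * of_int p) = y p" using pz by (simp add: L_def)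
  define z where "z j = y (p * j) * exp (- L * of_int (p * j))" for j
  have "z j = 1" for j
  proof (rule multiplicative_off_diagonal)
    show "z m * z n = z (m + n)" if "m \<noteq> n" for m n
      using y(3)[of "p * m" "p * n"] that p
      by (simp add: z_def algebra_simps flip: exp_add)
    show "z 0 = 1" using y(2) by (simp add: z_def)
    show "z 1 = 1" using L yp by (simp add: z_def exp_minus)
  qed
  then have "y m * exp (- L * of_int m) = 1" if "p dvd m" for m
    using that unfolding z_def by (metis dvdE)
  then show ?thesis using that[of L] y(1) by (simp add: algebra_simps)
qed

text \<open>The densities of two classes joined by an edge satisfy \<open>\<beta>' - \<beta> \<in> {0, 1}\<close>; going around
  the cycle \<open>k, k + r, \<dots>, k + p r\<close> forces all these differences to vanish.\<close>

lemma normal_form: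
  assumes s: "\<not> p dvd s" "\<phi> s k0 \<noteq> 0"
    and per: "\<And>r k. \<not> p dvd r \<Longrightarrow> \<phi> r (k + p) = \<phi> r k"
    and slope1: "\<And>m k q. p dvd m \<Longrightarrow> p dvd q \<Longrightarrow> k \<in> S \<Longrightarrow> \<phi> m (k + q) = \<phi> m k + of_int q"
  shows "\<exists>\<beta>. c0 = 0 \<and> (\<forall>k\<in>S. \<forall>m. p dvd m \<longrightarrow> \<phi> m k = h + of_int k + of_int m * \<beta>) \<and>
    (\<forall>k\<in>S. \<forall>r m. \<not> p dvd r \<longrightarrow> p dvd m \<longrightarrow> \<phi> (m + r) k = \<phi> r k)"
proof -
  have Sper: "k + q \<in> S \<longleftrightarrow> k \<in> S" if "p dvd q" for k q using support_class(1)[OF s that] .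
  have pz: "of_int p \<noteq> (0::complex)" using p by simp
  \<comment> \<open>The deviation from the density with \<open>\<beta> = 0\<close>; slope 1 turns
    the Virasoro relation at \<open>k\<close> into the equation of
    \<open>slope_linear\<close>.\<close>
  define G where "G k j = \<phi> (p * j) k - (h + of_int k)" for k j
  have G: "G k j = of_int j * G k 1" "c0 = 0" if k: "k \<in> S" for k j
  proof -
    have "of_int (n - m) * G k (m + n) = of_int n * G k n - of_int m * G k m
      - (if m + n = 0 then (of_int m ^ 3 - of_int m) * (c0 / (12 * of_int p)) else 0)" for m n
    proof -
      define X where "X = (if m + n = 0 then 1 / 12 * (of_int m ^ 3 - of_int m) * c0 else 0)"
      have e: "p * m + p * n = 0 \<longleftrightarrow> m + n = 0" "p * (m + n) = p * m + p * n"
        using p by (simp_all flip: distrib_left)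
      have "\<phi> (p * m) (k + p * n) * \<phi> (p * n) k - \<phi> (p * n) (k + p * m) * \<phi> (p * m) k =
          of_int (p * n - p * m) * \<phi> (p * m + p * n) k + X"
        using vir[of "p * m" "p * n", OF _ _ k] pz unfolding e X_def by simp
      then have "of_int p * (of_int (n - m) * G k (m + n)) = of_int p * (of_int n * G k n - of_int m * G k m) - X"
        unfolding slope1[of "p * m" "p * n" k, OF dvd_triv_left dvd_triv_left k]
          slope1[of "p * n" "p * m" k, OF dvd_triv_left dvd_triv_left k] G_def e
        by (simp add: algebra_simps)
      then have "of_int p * (of_int (n - m) * G k (m + n)) =
          of_int p * (of_int n * G k n - of_int m * G k m - X / of_int p)"
        using pz by (simp add: right_diff_distrib)
      then have "of_int (n - m) * G k (m + n) = of_int n * G k n - of_int m * G k m - X / of_int p"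
        using pz by (metis mult_cancel_left)
      then show ?thesis by (simp add: X_def)
    qed
    moreover have "G k 0 = 0" using weight[OF k] by (simp add: G_def)
    ultimately have "G k j = of_int j * G k 1" "c0 / (12 * of_int p) = 0"
      using slope_linear[of "G k" "c0 / (12 * of_int p)"] by blast+
    then show "G k j = of_int j * G k 1" "c0 = 0" using pz by auto
  qed
  define B where "B k = G k 1 / of_int p" for k
  have phi: "\<phi> m k = h + of_int k + of_int m * B k" if k: "k \<in> S" and m: "p dvd m" for k m
  proof -
    from m obtain j where j: "m = p * j" by blast
    show ?thesis using G(1)[OF k, of j] pz unfolding G_def[of k j] B_def j by (simp add: algebra_simps)
  qed
  have Bper: "B (k + q) = B k" if k: "k \<in> S" and q: "p dvd q" for k q
    using slope1[of p q k] phi[OF k, of p] phi[of "k + q" p] Sper[OF q] k q pz by simp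
  have edge: "of_int r * \<phi> (m + r) k = (of_int r + of_int m * (B (k + r) - B k)) * \<phi> r k"
    if r: "\<not> p dvd r" and k: "k \<in> S" and m: "p dvd m" for r k m
  proof (cases "\<phi> r k = 0")
    case True
    then have "\<phi> (m + r) k = 0" using class_dichotomy[OF r k True, of "m + r" k] m by simp
    then show ?thesis using True by simp
  next
    case False
    then have "k + r \<in> S" using supp by blast
    then show ?thesis
      using difference_quotient[of m r k] per m r False phi[OF k m] phi[of "k + r" m] by (simp add: field_simps)
  qed
  have jump: "B (k + r) - B k \<in> {0, 1}" if r: "\<not> p dvd r" and nz: "\<phi> r k \<noteq> 0" for r k
  proof -
    define d where "d = B (k + r) - B k"
    have k: "k \<in> S" and kr: "k + r \<in> S" using supp[OF nz] by auto
    \<comment> \<open>The entry of \<open>L_(2p + r)\<close> is obtained from that of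
      \<open>L_r\<close> directly and through \<open>L_(p + r)\<close>; comparison gives
      \<open>d (d - 1) = 0\<close>.\<close>
    have "B (k + (p + r)) = B (k + r)" using Bper[OF kr, of p] by (simp add: add_ac)
    then have "of_int r * \<phi> (p + r) k = (of_int r + of_int p * d) * \<phi> r k"
      "of_int r * \<phi> (2 * p + r) k = (of_int r + 2 * of_int p * d) * \<phi> r k"
      "of_int (p + r) * \<phi> (2 * p + r) k = (of_int (p + r) + of_int p * d) * \<phi> (p + r) k"
      using edge[OF r k, of p] edge[OF r k, of "2 * p"] edge[of "p + r" k p] r k by (simp_all add: d_def add_ac)
    then have "(of_int p * of_int p * (d * (d - 1))) * \<phi> r k = 0" unfolding of_int_add by algebra
    then show ?thesis using pz nz by (auto simp: d_def)
  qed
  have flat: "B (k + r) = B k" if r: "\<not> p dvd r" and nz: "\<phi> r k \<noteq> 0" for r k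
  proof -
    define f where "f j = B (k + int j * r)" for j
    have nzr: "\<phi> r i \<noteq> 0" if "i \<in> S" for i using class_nonzero[OF r nz, of r i] that by simp
    have "k + int j * r \<in> S" for j
    proof (induction j)
      case (Suc j)
      then have "k + int j * r + r \<in> S" using nzr supp by blast
      then show ?case by (simp add: algebra_simps)
    qed (use supp[OF nz] in simp)
    then have step: "f (Suc j) - f j \<in> {0, 1}" for j
      using jump[OF r nzr, of "k + int j * r"] by (simp add: f_def algebra_simps)
    have "(\<Sum>j<nat p. f (Suc j) - f j) = f (nat p) - f 0" by (rule sum_lessThan_telescope)
    also have "\<dots> = 0" using Bper[of k "p * r"] supp[OF nz] p by (simp add: f_def)
    finally have "(\<Sum>j<nat p. f (Suc j) - f j) = 0" .
    from arg_cong[OF this, of Re] have "(\<Sum>j<nat p. Re (f (Suc j) - f j)) = 0"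
      by (simp only: Re_sum zero_complex.sel)
    moreover have "0 \<le> Re z" if "z \<in> {0, 1}" for z using that by auto
    then have "0 \<le> Re (f (Suc j) - f j)" for j using step by blast
    ultimately have "\<forall>j\<in>{..<nat p}. Re (f (Suc j) - f j) = 0" by (subst (asm) sum_nonneg_eq_0_iff) auto
    then have "Re (f 1 - f 0) = 0" using p by auto
    moreover have "z = 0" if "z \<in> {0, 1}" "Re z = 0" for z using that by auto
    ultimately have "f 1 - f 0 = 0" using step[of 0] unfolding One_nat_def by blast
    then show ?thesis by (simp add: f_def)
  qed
  obtain k1 where k1: "k1 \<in> S" using nonempty by blast
  have "{k\<in>S. B k = B k1} = S"
  proof (rule irr)
    fix k j assume "k \<in> {k\<in>S. B k = B k1}" and e: "\<phi> j k \<noteq> 0"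
    then show "k + j \<in> {k\<in>S. B k = B k1}" using supp[OF e] flat[OF _ e] Bper[of k j] by (cases "p dvd j") auto
  qed (use k1 in auto)
  then have Bc: "B k = B k1" if "k \<in> S" for k using that by blast
  show ?thesis
  proof (intro exI[of _ "B k1"] conjI ballI allI impI)
    show "c0 = 0" using G(2)[OF k1] .
    show "\<phi> m k = h + of_int k + of_int m * B k1" if "k \<in> S" "p dvd m" for k m using phi[OF that] Bc that by simp
    show "\<phi> (m + r) k = \<phi> r k" if k: "k \<in> S" and r: "\<not> p dvd r" and m: "p dvd m" for k r m
    proof (cases "\<phi> r k = 0")
      case True
      then show ?thesis using class_dichotomy[OF r k True, of "m + r" k] m by simp
    next
      case False
      then have "B (k + r) - B k = 0" using flat[OF r False] by simp
      then have "of_int r * \<phi> (m + r) k = of_int r * \<phi> r k" using edge[OF r k m] by simp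
      moreover have "r \<noteq> 0" using r by auto
      ultimately show ?thesis by simp
    qed
  qed
qed

text \<open>Two gauges are composed, the periodic one and \<open>exp (L * k)\<close>. The second
  multiplies the entries of \<open>L_m\<close> by \<open>exp (- L * m)\<close>, independently of
  \<open>k\<close>, and so preserves periodicity.\<close>

lemma nontrivial_action:
  assumes s: "\<not> p dvd s" "\<phi> s k0 \<noteq> 0"
  obtains \<beta> g where "\<And>k. g k \<noteq> 0" "c0 = 0"
    "\<And>k m. k \<in> S \<Longrightarrow> p dvd m \<Longrightarrow> \<phi> m k * g k / g (k + m) = h + of_int k + of_int m * \<beta>"
    "\<And>k r. \<not> p dvd r \<Longrightarrow> \<phi> r (k + p) * g (k + p) / g (k + p + r) = \<phi> r k * g k / g (k + r)"
    "\<And>k r m. k \<in> S \<Longrightarrow> \<not> p dvd r \<Longrightarrow> p dvd m \<Longrightarrow>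
      \<phi> (m + r) k * g k / g (k + (m + r)) = \<phi> r k * g k / g (k + r)"
proof -
  obtain g where g: "\<And>k. g k \<noteq> 0"
    "\<And>r k. \<not> p dvd r \<Longrightarrow> \<phi> r (k + p) * g (k + p) / g (k + p + r) = \<phi> r k * g k / g (k + r)"
    by (rule periodic_gauge[OF s]) (rule that; assumption)
  define f where "f m k = \<phi> m k * g k / g (k + m)" for m k
  interpret F: gap_weights p S f h c0 c unfolding f_def by (rule gauge[OF g(1)])
  have fs: "f s k0 \<noteq> 0" using s g by (simp add: f_def)
  have fper: "f r (k + p) = f r k" if "\<not> p dvd r" for r k using g(2)[OF that] by (simp add: f_def)
  obtain L where L: "\<And>m k q. p dvd m \<Longrightarrow> p dvd q \<Longrightarrow> k \<in> S \<Longrightarrow>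
      f m (k + q) * exp (- L * of_int m) = f m k * exp (- L * of_int m) + of_int q"
    by (rule F.exponential_gauge[OF s(1) fs fper]) (assumption | rule that)+
  define w where "w k = exp (L * of_int k)" for k :: int
  have w: "w k \<noteq> 0" for k by (simp add: w_def)
  have ww: "f m k * w k / w (k + m) = f m k * exp (- L * of_int m)" for m k
  proof -
    have "w (k + m) = w k * exp (L * of_int m)" by (simp add: w_def distrib_left exp_add)
    then show ?thesis using w[of k] by (simp add: exp_minus divide_inverse)
  qed
  interpret W: gap_weights p S "\<lambda>m k. f m k * exp (- L * of_int m)" h c0 c
    using F.gauge[of w, OF w] unfolding ww .
  have "\<exists>\<beta>. c0 = 0 \<and>
      (\<forall>k\<in>S. \<forall>m. p dvd m \<longrightarrow> f m k * exp (- L * of_int m) = h + of_int k + of_int m * \<beta>) \<and>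
      (\<forall>k\<in>S. \<forall>r m. \<not> p dvd r \<longrightarrow> p dvd m \<longrightarrow>
        f (m + r) k * exp (- L * of_int (m + r)) = f r k * exp (- L * of_int r))"
  proof (rule W.normal_form[OF s(1)])
    show "f s k0 * exp (- L * of_int s) \<noteq> 0" using fs by simp
    show "f r (k + p) * exp (- L * of_int r) = f r k * exp (- L * of_int r)" if "\<not> p dvd r" for r k
      using fper[OF that] by simp
  qed (rule L)
  then obtain \<beta> where b: "c0 = 0"
    "\<forall>k\<in>S. \<forall>m. p dvd m \<longrightarrow> f m k * exp (- L * of_int m) = h + of_int k + of_int m * \<beta>"
    "\<forall>k\<in>S. \<forall>r m. \<not> p dvd r \<longrightarrow> p dvd m \<longrightarrow>
      f (m + r) k * exp (- L * of_int (m + r)) = f r k * exp (- L * of_int r)"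
    by (elim exE conjE) (rule that; assumption)
  have fw: "\<phi> m k * (g k * w k) / (g (k + m) * w (k + m)) = f m k * exp (- L * of_int m)" for m k
    unfolding ww[symmetric] by (simp add: f_def)
  show ?thesis
  proof (rule that[of "\<lambda>k. g k * w k" \<beta>]; (unfold fw)?)
    show "g k * w k \<noteq> 0" for k using g(1) w by simp
    show "f r (k + p) * exp (- L * of_int r) = f r k * exp (- L * of_int r)" if "\<not> p dvd r" for r k
      using fper[OF that] by simp
  qed (use b in blast)+
qed

end

section \<open>From modules to weight coefficients\<close>

lemma (in gap_weights) classification:
  obtains \<alpha> \<beta> F k0 g where "cond_I p F" "cond_II p F" "cond_III p F" "c0 = 0" "\<And>k. g k \<noteq> 0"
    "\<And>k. k \<in> S \<Longrightarrow> (k - k0) mod p \<in> oF p F"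
    "\<And>k m. k \<in> S \<Longrightarrow> \<phi> m k * g k / g (k + m) =
      (if p dvd m then \<alpha> + of_int (k - k0) + of_int m * \<beta> else F (m mod p) ((k - k0) mod p))"
proof (cases "\<exists>s k. \<not> p dvd s \<and> \<phi> s k \<noteq> 0")
  case False
  then have T0: "\<phi> r k = 0" if "\<not> p dvd r" for r k using that by blast
  obtain \<beta> k0 g where g: "k0 \<in> S" "\<And>k. g k \<noteq> 0" "c0 = 0" "\<And>k. k \<in> S \<Longrightarrow> p dvd k - k0"
    "\<And>k m. k \<in> S \<Longrightarrow> p dvd m \<Longrightarrow> \<phi> m k * g k / g (k + m) = h + of_int k + of_int m * \<beta>"
    by (rule trivial_action[OF T0]) (assumption | rule that)+
  \<comment> \<open>By the convention for the zero matrix, \<open>oF p F\<close> is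
    \<open>{0}\<close>, the class of \<open>k0\<close>.\<close>
  define F :: "int \<Rightarrow> int \<Rightarrow> complex" where "F = (\<lambda>_ _. 0)"
  have F: "zero_matrix p F" "oF p F = {0}" by (simp_all add: zero_matrix_def oF_def F_def)
  show ?thesis
  proof (rule that[of F g k0 "h + of_int k0" \<beta>])
    show "cond_I p F" "cond_II p F" "cond_III p F"
      using F by (simp_all add: cond_I_def cond_II_def cond_III_def F_def)
    show "(k - k0) mod p \<in> oF p F" if "k \<in> S" for k using g(4)[OF that] F by simp
    show "\<phi> m k * g k / g (k + m) = (if p dvd m then h + of_int k0 + of_int (k - k0) + of_int m * \<beta>
        else F (m mod p) ((k - k0) mod p))" if "k \<in> S" for k m
      using g(5)[OF that, of m] T0[of m k] by (simp add: F_def)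
  qed (fact g)+
next
  case True
  then obtain s k1 where s: "\<not> p dvd s" "\<phi> s k1 \<noteq> 0" by blast
  obtain \<beta> g where g: "\<And>k. g k \<noteq> 0" "c0 = 0"
    "\<And>k m. k \<in> S \<Longrightarrow> p dvd m \<Longrightarrow> \<phi> m k * g k / g (k + m) = h + of_int k + of_int m * \<beta>"
    "\<And>k r. \<not> p dvd r \<Longrightarrow> \<phi> r (k + p) * g (k + p) / g (k + p + r) = \<phi> r k * g k / g (k + r)"
    "\<And>k r m. k \<in> S \<Longrightarrow> \<not> p dvd r \<Longrightarrow> p dvd m \<Longrightarrow>
      \<phi> (m + r) k * g k / g (k + (m + r)) = \<phi> r k * g k / g (k + r)"
    by (rule nontrivial_action[OF s]) (assumption | rule that)+
  define f where "f m k = \<phi> m k * g k / g (k + m)" for m k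
  interpret G: gap_weights p S f h c0 c unfolding f_def by (rule gauge[OF g(1)])
  \<comment> \<open>Counting residues from a point of \<open>S\<close> secures condition
    (I).\<close>
  obtain k0 where k0: "k0 \<in> S" using nonempty by blast
  have fper: "f r (k + q) = f r k" if "\<not> p dvd r" "p dvd q" for r k q
    by (rule periodic_multiple[OF _ that(2)]) (use g(4)[OF that(1)] in \<open>simp add: f_def\<close>)
  have shift: "f r (k mod p + k0) = f r (k + k0)" if "\<not> p dvd r" for r k
  proof -
    have "p dvd k mod p - k" by (simp add: mod_eq_dvd_iff [symmetric])
    from fper[OF that this, of "k + k0"] show ?thesis by (simp add: add.commute)
  qed
  have Sper: "k mod p + k0 \<in> S \<longleftrightarrow> k + k0 \<in> S" for k
  proof -
    have "p dvd k mod p - k" by (simp add: mod_eq_dvd_iff [symmetric])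
    from support_class(1)[OF s this, of "k + k0"] show ?thesis by (simp add: add.commute)
  qed
  have res: "\<not> p dvd i" if "i \<in> {1..p - 1}" for i using that zdvd_imp_le[of p i] by auto
  define F where "F i j = f i (j + k0)" for i j
  define s0 where "s0 = s mod p"
  have s0: "s0 \<in> {1..p - 1}" using residue_range(2)[OF p s(1)] by (simp add: s0_def)
  \<comment> \<open>The row \<open>s0\<close> has no zero on the residues of \<open>S\<close>
    counted from \<open>k0\<close>; this gives conditions (I) and (II).\<close>
  have nz: "F s0 j \<noteq> 0" if "j + k0 \<in> S" for j
  proof -
    have "p dvd s0 - s" by (simp add: s0_def mod_eq_dvd_iff [symmetric])
    then show ?thesis using class_nonzero[OF s _ that, of s0] g(1) by (simp add: F_def f_def)
  qed
  have zm: "\<not> zero_matrix p F" using nz[of 0] k0 s0 p unfolding zero_matrix_def by force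
  have oF: "j mod p \<in> oF p F" if "j + k0 \<in> S" for j
    using zm nz[of "j mod p"] Sper[of j] that s0 p by (auto simp: oF_def)
  show ?thesis
  proof (rule that[of F g k0 "h + of_int k0" \<beta>])
    show "cond_I p F" using oF[of 0] k0 by (simp add: cond_I_def)
    show "cond_II p F" unfolding cond_II_def
    proof (intro ballI impI)
      fix i j assume "F i j \<noteq> 0"
      then have "i + j + k0 \<in> S" using G.supp[of i "j + k0"] by (simp add: F_def add_ac)
      then have "F s0 ((i + j) mod p) \<noteq> 0" using nz Sper by blast
      then show "\<exists>s\<in>{1..p - 1}. F s ((i + j) mod p) \<noteq> 0" using s0 by blast
    qed
    show "cond_III p F" unfolding cond_III_def
    proof (intro ballI)
      fix i r t assume "r \<in> {1..p - 1}" "t \<in> {1..p - 1}"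
      then have "\<not> p dvd r" "\<not> p dvd t" using res by blast+
      then show "F r ((i + t) mod p) * F t i = F t ((i + r) mod p) * F r i"
        using G.commute[of r t "i + k0"] by (simp add: F_def shift) (simp add: add_ac)
    qed
    show "(k - k0) mod p \<in> oF p F" if "k \<in> S" for k using oF[of "k - k0"] that by simp
    show "\<phi> m k * g k / g (k + m) = (if p dvd m then h + of_int k0 + of_int (k - k0) + of_int m * \<beta>
        else F (m mod p) ((k - k0) mod p))" if k: "k \<in> S" for k m
    proof (cases "p dvd m")
      case True
      then show ?thesis using g(3)[OF k True] by simp
    next
      case False
      then have m: "\<not> p dvd m mod p" by (simp add: dvd_mod_iff)
      have "f m k = f (m mod p) k"
        using g(5)[OF k m, of "p * (m div p)"] by (simp add: f_def)
      also have "\<dots> = F (m mod p) ((k - k0) mod p)" using shift[OF m, of "k - k0"] by (simp add: F_def)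
      finally show ?thesis using False by (simp add: f_def)
    qed
  qed (fact g)+
qed

section \<open>Irreducible modules and their weight vectors\<close>

locale irreducible_series =
  fixes p :: int and scale :: "complex \<Rightarrow> 'v::ab_group_add \<Rightarrow> 'v" and V :: "'v set" and act :: "galg \<Rightarrow> 'v \<Rightarrow> 'v"
  assumes p: "p > 1"
    and irreducible: "irreducible_module p scale V act"
    and series: "intermediate_series p scale V act"
begin

lemma gv: "gv_module p scale V act"
  using irreducible by (simp add: irreducible_module_def)

sublocale vs: vector_space scale
  using gv by (simp add: gv_module_def)

lemma subspace_V: "vs.subspace V"
  using gv by (simp add: gv_module_def)

lemma act_closed: "x \<in> gap_virasoro p \<Longrightarrow> v \<in> V \<Longrightarrow> act x v \<in> V"
  using gv by (simp add: gv_module_def)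

lemma act_add_left: "x \<in> gap_virasoro p \<Longrightarrow> y \<in> gap_virasoro p \<Longrightarrow> v \<in> V \<Longrightarrow> act (x + y) v = act x v + act y v"
  using gv by (simp add: gv_module_def)

lemma act_scale_left: "x \<in> gap_virasoro p \<Longrightarrow> v \<in> V \<Longrightarrow> act (cscale c x) v = scale c (act x v)"
  using gv unfolding gv_module_def by blast

lemma act_add_right: "x \<in> gap_virasoro p \<Longrightarrow> v \<in> V \<Longrightarrow> w \<in> V \<Longrightarrow> act x (v + w) = act x v + act x w"
  using gv by (simp add: gv_module_def)

lemma act_scale_right: "x \<in> gap_virasoro p \<Longrightarrow> v \<in> V \<Longrightarrow> act x (scale c v) = scale c (act x v)"
  using gv unfolding gv_module_def by blast

lemma act_bracket: "x \<in> gap_virasoro p \<Longrightarrow> y \<in> gap_virasoro p \<Longrightarrow> v \<in> V \<Longrightarrow>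
    act (bracket p x y) v = act x (act y v) - act y (act x v)"
  using gv unfolding gv_module_def by blast

lemma Lg_mem: "Lg m \<in> gap_virasoro p"
  by (simp add: gap_virasoro_def pm.span_base)

lemma Cg_mem: "i \<in> {0..p - 1} \<Longrightarrow> Cg p i \<in> gap_virasoro p"
  by (simp add: gap_virasoro_def pm.span_base)

lemma subspace_algebra: "pm.subspace (gap_virasoro p)"
  by (simp add: gap_virasoro_def pm.subspace_span)

lemma act_zero_left: "v \<in> V \<Longrightarrow> act 0 v = 0"
  using act_scale_left[OF Lg_mem, of v 0 0] by simp

lemma act_zero_right: "x \<in> gap_virasoro p \<Longrightarrow> act x 0 = 0"
  using act_scale_right[of x 0 0] vs.subspace_0[OF subspace_V] by simp

lemma algebra_induct:
  assumes "x \<in> gap_virasoro p" and "pm.subspace {x \<in> gap_virasoro p. P x}"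
    and "\<And>m. P (Lg m)" and "\<And>i. i \<in> {0..p - 1} \<Longrightarrow> P (Cg p i)"
  shows "P x"
proof -
  have "x \<in> pm.span (range Lg \<union> Cg p ` {0..p - 1})" using assms(1) by (simp add: gap_virasoro_def)
  then have "x \<in> {x \<in> gap_virasoro p. P x}"
    by (rule pm.span_subspace_induct[OF _ assms(2)]) (use assms Lg_mem Cg_mem in auto)
  then show ?thesis by simp
qed

lemma submodule_eq_V:
  assumes W: "W \<subseteq> V" "vs.subspace W"
    and L: "\<And>m w. w \<in> W \<Longrightarrow> act (Lg m) w \<in> W"
    and C: "\<And>i w. i \<in> {0..p - 1} \<Longrightarrow> w \<in> W \<Longrightarrow> act (Cg p i) w \<in> W"
    and nz: "v \<in> W" "v \<noteq> 0"
  shows "W = V"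
proof -
  have "act x w \<in> W" if x: "x \<in> gap_virasoro p" and w: "w \<in> W" for x w
    using x
  proof (rule algebra_induct)
    show "pm.subspace {x \<in> gap_virasoro p. act x w \<in> W}"
    proof (rule pm.subspaceI)
      show "0 \<in> {x \<in> gap_virasoro p. act x w \<in> W}"
        using w W act_zero_left vs.subspace_0 pm.subspace_0[OF subspace_algebra] by auto
    next
      fix x y assume "x \<in> {x \<in> gap_virasoro p. act x w \<in> W}" "y \<in> {x \<in> gap_virasoro p. act x w \<in> W}"
      then show "x + y \<in> {x \<in> gap_virasoro p. act x w \<in> W}"
        using w W act_add_left[of x y w] vs.subspace_add[OF W(2)] pm.subspace_add[OF subspace_algebra] by auto
    next
      fix c x assume "x \<in> {x \<in> gap_virasoro p. act x w \<in> W}"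
      then show "cscale c x \<in> {x \<in> gap_virasoro p. act x w \<in> W}"
        using w W act_scale_left[of x w c] vs.subspace_scale[OF W(2)] pm.subspace_scale[OF subspace_algebra] by auto
    qed
  qed (use L C w in auto)
  then have "submodule p scale V act W" using W by (simp add: submodule_def)
  then show ?thesis using irreducible nz by (auto simp: irreducible_module_def)
qed

lemma span_invariant:
  assumes w: "w \<in> vs.span B" and B: "\<And>b. b \<in> B \<Longrightarrow> b \<in> V \<and> act (Lg m) b \<in> vs.span B"
  shows "act (Lg m) w \<in> vs.span B"
proof -
  have "w \<in> {w \<in> V. act (Lg m) w \<in> vs.span B}"
    using w
  proof (rule vs.span_subspace_induct)
    show "vs.subspace {w \<in> V. act (Lg m) w \<in> vs.span B}"
      using vs.subspace_0[OF subspace_V] vs.subspace_add[OF subspace_V] vs.subspace_scale[OF subspace_V]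
      by (intro vs.subspaceI)
        (simp_all add: act_zero_right act_add_right act_scale_right Lg_mem vs.span_zero vs.span_add vs.span_scale)
  qed (use B in blast)
  then show ?thesis by simp
qed

lemma weight_vector:
  obtains \<mu> v where "v \<in> weight_space p scale V act \<mu>" "v \<noteq> 0"
proof (rule ccontr)
  assume "\<not> thesis"
  then have "(\<Union>\<mu>. weight_space p scale V act \<mu>) \<subseteq> {0}" using that by blast
  then have "vs.span (\<Union>\<mu>. weight_space p scale V act \<mu>) \<subseteq> {0}" by (rule vs.span_minimal) simp
  then have "V \<subseteq> {0}" using series by (simp add: intermediate_series_def)
  moreover have "0 \<in> V" by (rule vs.subspace_0[OF subspace_V])
  ultimately show False using irreducible by (auto simp: irreducible_module_def)
qed

lemma central_commute:
  assumes "i \<in> {0..p - 1}" "x \<in> gap_virasoro p" "v \<in> V"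
  shows "act (Cg p i) (act x v) = act x (act (Cg p i) v)"
  using act_bracket[OF Cg_mem[OF assms(1)] assms(2,3)] act_zero_left[OF assms(3)]
    bracket_displayed(4)[OF p] by simp

text \<open>A weight is a function on the whole Cartan subalgebra. The elements acting on all of
  \<open>A\<close> by one scalar form a subspace, so \<open>L_0\<close> and the \<open>C_i\<close>
  suffice.\<close>

lemma cartan_eigenvalue:
  assumes "0 \<in> A" "A \<subseteq> V" and h: "\<And>v. v \<in> A \<Longrightarrow> act (Lg 0) v = scale h v"
    and c: "\<And>v i. v \<in> A \<Longrightarrow> i \<in> {0..p - 1} \<Longrightarrow> act (Cg p i) v = scale (c i) v"
  shows "\<exists>\<mu>. A \<subseteq> weight_space p scale V act \<mu>"
proof -
  have "\<exists>\<mu>. \<forall>v\<in>A. act x v = scale \<mu> v" if "x \<in> cartan p" for x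
  proof -
    have sub: "pm.subspace {x \<in> gap_virasoro p. \<exists>\<mu>. \<forall>v\<in>A. act x v = scale \<mu> v}"
    proof (rule pm.subspaceI)
      show "0 \<in> {x \<in> gap_virasoro p. \<exists>\<mu>. \<forall>v\<in>A. act x v = scale \<mu> v}"
        using assms(2) act_zero_left pm.subspace_0[OF subspace_algebra] by (auto intro!: exI[of _ 0])
    next
      fix x y assume "x \<in> {x \<in> gap_virasoro p. \<exists>\<mu>. \<forall>v\<in>A. act x v = scale \<mu> v}"
        "y \<in> {x \<in> gap_virasoro p. \<exists>\<mu>. \<forall>v\<in>A. act x v = scale \<mu> v}"
      then obtain a b where "x \<in> gap_virasoro p" "y \<in> gap_virasoro p"
        "\<forall>v\<in>A. act x v = scale a v" "\<forall>v\<in>A. act y v = scale b v" by blast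
      then show "x + y \<in> {x \<in> gap_virasoro p. \<exists>\<mu>. \<forall>v\<in>A. act x v = scale \<mu> v}"
        using assms(2) act_add_left[of x y] pm.subspace_add[OF subspace_algebra]
        by (auto intro!: exI[of _ "a + b"] simp: vs.scale_left_distrib subset_iff)
    next
      fix d x assume "x \<in> {x \<in> gap_virasoro p. \<exists>\<mu>. \<forall>v\<in>A. act x v = scale \<mu> v}"
      then obtain a where "x \<in> gap_virasoro p" "\<forall>v\<in>A. act x v = scale a v" by blast
      then show "cscale d x \<in> {x \<in> gap_virasoro p. \<exists>\<mu>. \<forall>v\<in>A. act x v = scale \<mu> v}"
        using assms(2) act_scale_left[of x _ d] pm.subspace_scale[OF subspace_algebra]
        by (auto intro!: exI[of _ "d * a"] simp: subset_iff)
    qed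
    have "x \<in> pm.span (insert (Lg 0) (Cg p ` {0..p - 1}))" using that by (simp add: cartan_def)
    then have "x \<in> {x \<in> gap_virasoro p. \<exists>\<mu>. \<forall>v\<in>A. act x v = scale \<mu> v}"
      by (rule pm.span_subspace_induct[OF _ sub]) (use h c Lg_mem Cg_mem in blast)
    then show ?thesis by blast
  qed
  then obtain \<mu> where "\<forall>x\<in>cartan p. \<forall>v\<in>A. act x v = scale (\<mu> x) v" by metis
  then show ?thesis using assms(2) by (intro exI[of _ \<mu>]) (auto simp: weight_space_def)
qed

text \<open>By irreducibility all weights lie in one coset of \<open>\<int>\<close> and the centre acts by scalars; \<open>e k\<close> spans
  the space of weight \<open>h + k\<close> (and is \<open>0\<close> if this is not a weight).\<close>

lemma weight_basis:
  obtains h c e where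
    "\<And>k. e k \<in> V" "\<And>k. act (Lg 0) (e k) = scale (h + of_int k) (e k)"
    "\<And>v i. v \<in> V \<Longrightarrow> i \<in> {0..p - 1} \<Longrightarrow> act (Cg p i) v = scale (c i) v"
    "\<And>m k. \<exists>x. act (Lg m) (e k) = scale x (e (k + m))"
    "vs.span (range e) = V"
proof -
  obtain \<mu> v where v: "v \<in> weight_space p scale V act \<mu>" "v \<noteq> 0" by (rule weight_vector)
  define h where "h = \<mu> (Lg 0)"
  define c where "c i = \<mu> (Cg p i)" for i
  have vV: "v \<in> V" using v by (simp add: weight_space_def)
  have vL: "act (Lg 0) v = scale h v" "\<And>i. i \<in> {0..p - 1} \<Longrightarrow> act (Cg p i) v = scale (c i) v"
    using v by (auto simp: weight_space_def h_def c_def cartan_def pm.span_base)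
  define W where "W = {v \<in> V. \<forall>i\<in>{0..p - 1}. act (Cg p i) v = scale (c i) v}"
  have "W = V"
  proof (rule submodule_eq_V)
    show "vs.subspace W"
    proof (rule vs.subspaceI)
      show "0 \<in> W" using vs.subspace_0[OF subspace_V] act_zero_right Cg_mem by (simp add: W_def)
      show "x + y \<in> W" if "x \<in> W" "y \<in> W" for x y
        using that vs.subspace_add[OF subspace_V] act_add_right Cg_mem by (simp add: W_def vs.scale_right_distrib)
      show "scale d x \<in> W" if "x \<in> W" for d x
        using that vs.subspace_scale[OF subspace_V] act_scale_right Cg_mem by (simp add: W_def mult.commute)
    qed
    show "act (Lg m) w \<in> W" if "w \<in> W" for m w
      using that act_closed Lg_mem central_commute act_scale_right by (simp add: W_def)
    show "act (Cg p i) w \<in> W" if "i \<in> {0..p - 1}" "w \<in> W" for i w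
      using that vs.subspace_scale[OF subspace_V] Cg_mem central_commute act_scale_right by (simp add: W_def)
    show "v \<in> W" using vV vL by (simp add: W_def)
  qed (use v in \<open>auto simp: W_def\<close>)
  then have C: "act (Cg p i) v = scale (c i) v" if "v \<in> V" "i \<in> {0..p - 1}" for v i
  proof -
    have "v \<in> W" using that \<open>W = V\<close> by simp
    then show ?thesis using that by (simp add: W_def)
  qed
  define E where "E k = {v \<in> V. act (Lg 0) v = scale (h + of_int k) v}" for k :: int
  have E0: "0 \<in> E k" for k using vs.subspace_0[OF subspace_V] act_zero_right Lg_mem by (simp add: E_def)
  have Esum: "scale d x \<in> E k" if "x \<in> E k" for d x k
    using that vs.subspace_scale[OF subspace_V] act_scale_right Lg_mem by (simp add: E_def mult.commute)
  have EL: "act (Lg m) x \<in> E (k + m)" if "x \<in> E k" for m x k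
  proof -
    have xV: "x \<in> V" using that by (simp add: E_def)
    have "bracket p (Lg 0) (Lg m) = cscale (of_int m) (Lg m)"
      using bracket_displayed(1,2)[OF p, of 0 m] by (cases "p dvd m") auto
    then have "scale (of_int m) (act (Lg m) x) = act (bracket p (Lg 0) (Lg m)) x"
      using act_scale_left[OF Lg_mem xV, of "of_int m" m] by (simp only:)
    also have "\<dots> = act (Lg 0) (act (Lg m) x) - act (Lg m) (act (Lg 0) x)"
      by (rule act_bracket[OF Lg_mem Lg_mem xV])
    also have "act (Lg 0) x = scale (h + of_int k) x" using that by (simp add: E_def)
    also have "act (Lg m) (scale (h + of_int k) x) = scale (h + of_int k) (act (Lg m) x)"
      by (rule act_scale_right[OF Lg_mem xV])
    finally have "scale (of_int m) (act (Lg m) x) = act (Lg 0) (act (Lg m) x) - scale (h + of_int k) (act (Lg m) x)" .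
    then have "act (Lg 0) (act (Lg m) x) = scale (of_int m + (h + of_int k)) (act (Lg m) x)"
      by (simp only: eq_diff_eq vs.scale_left_distrib)
    moreover have "of_int m + (h + of_int k) = h + of_int (k + m)" by simp
    ultimately show ?thesis using act_closed[OF Lg_mem xV] by (simp only: E_def mem_Collect_eq)
  qed
  have "\<exists>u\<in>E k. E k \<subseteq> vs.span {u}" for k
  proof (cases "E k = {0}")
    case True
    then show ?thesis by auto
  next
    case False
    then obtain u where u: "u \<in> E k" "u \<noteq> 0" using E0 by blast
    \<comment> \<open>As the centre acts by scalars, the \<open>L_0\<close>-eigenspace
      \<open>E k\<close> lies in a single weight space, so its dimension is at most one.\<close>
    have "\<exists>\<nu>. E k \<subseteq> weight_space p scale V act \<nu>"
    proof (rule cartan_eigenvalue[OF E0])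
      show "E k \<subseteq> V" by (auto simp: E_def)
      show "act (Lg 0) v = scale (h + of_int k) v" if "v \<in> E k" for v using that by (simp add: E_def)
      show "act (Cg p i) v = scale (c i) v" if "v \<in> E k" "i \<in> {0..p - 1}" for v i
        using that C by (simp add: E_def)
    qed
    then obtain \<nu> where "E k \<subseteq> weight_space p scale V act \<nu>" by blast
    then obtain w where w: "E k \<subseteq> vs.span {w}" using series unfolding intermediate_series_def by blast
    then obtain d where d: "u = scale d w" using u by (auto simp: vs.span_singleton)
    then have "d \<noteq> 0" using u by auto
    then have "w = scale (1 / d) u" using d by simp
    then have "w \<in> vs.span {u}" by (metis vs.span_base vs.span_scale singletonI)
    then have "vs.span {w} \<subseteq> vs.span {u}" by (intro vs.span_minimal) auto
    then show ?thesis using u w by blast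
  qed
  then obtain e where e: "\<And>k. e k \<in> E k" "\<And>k. E k \<subseteq> vs.span {e k}" by metis
  show ?thesis
  proof (rule that[of e h c])
    show eV: "e k \<in> V" for k using e(1)[of k] by (simp add: E_def)
    show "act (Lg 0) (e k) = scale (h + of_int k) (e k)" for k using e(1)[of k] by (simp add: E_def)
    show Lx: "\<exists>x. act (Lg m) (e k) = scale x (e (k + m))" for m k
      using EL[OF e(1), of m k] e(2)[of "k + m"] by (auto simp: vs.span_singleton)
    show "vs.span (range e) = V"
    proof (rule submodule_eq_V)
      show sub: "vs.span (range e) \<subseteq> V" using eV subspace_V by (intro vs.span_minimal) auto
      show "act (Lg m) w \<in> vs.span (range e)" if "w \<in> vs.span (range e)" for m w
        using that
      proof (rule span_invariant)
        fix w assume "w \<in> range e"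
        then obtain k where k: "w = e k" by blast
        obtain x where "act (Lg m) (e k) = scale x (e (k + m))" using Lx by blast
        then show "w \<in> V \<and> act (Lg m) w \<in> vs.span (range e)"
          using k eV by (simp add: vs.span_scale vs.span_base)
      qed
      show "act (Cg p i) w \<in> vs.span (range e)" if "i \<in> {0..p - 1}" "w \<in> vs.span (range e)" for i w
        using C[of w i] that sub by (auto simp: vs.span_scale)
      have "v \<in> E 0" using vV vL by (simp add: E_def)
      then have "v \<in> vs.span {e 0}" using e(2) by blast
      also have "\<dots> \<subseteq> vs.span (range e)" by (rule vs.span_mono) auto
      finally show "v \<in> vs.span (range e)" .
    qed (use v in auto)
  qed (use C in auto)
qed

section \<open>Coordinates with respect to weight vectors\<close>

definition lc :: "(int \<Rightarrow> 'v) \<Rightarrow> (int \<Rightarrow>\<^sub>0 complex) \<Rightarrow> 'v" where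
  "lc b z = (\<Sum>k\<in>Poly_Mapping.keys z. scale (Poly_Mapping.lookup z k) (b k))"

lemma lc_eq:
  assumes "finite A" "Poly_Mapping.keys z \<subseteq> A"
  shows "lc b z = (\<Sum>k\<in>A. scale (Poly_Mapping.lookup z k) (b k))"
  unfolding lc_def using assms by (intro sum.mono_neutral_left) (auto simp: in_keys_iff)

lemma lc_add: "lc b (y + z) = lc b y + lc b z"
  using Poly_Mapping.keys_add[of y z]
  by (simp add: lc_eq[of "Poly_Mapping.keys y \<union> Poly_Mapping.keys z"] lookup_add vs.scale_left_distrib sum.distrib)

lemma lc_scale: "lc b (cscale d z) = scale d (lc b z)"
  using keys_cscale[of d z] by (simp add: lc_eq[of "Poly_Mapping.keys z"] vs.scale_sum_right)

lemma lc_single: "lc b (Poly_Mapping.single k d) = scale d (b k)"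
  by (simp add: lc_eq[of "{k}"])

lemma lc_zero: "lc b 0 = 0"
  by (simp add: lc_def)

lemma lc_diff: "lc b (y - z) = lc b y - lc b z"
  using lc_add[of b "y - z" z] by (simp add: algebra_simps)

definition supported :: "int set \<Rightarrow> (int \<Rightarrow>\<^sub>0 complex) set" where
  "supported U = pm.span ((\<lambda>k. Poly_Mapping.single k 1) ` U)"

lemma keys_supported: "z \<in> supported U \<Longrightarrow> Poly_Mapping.keys z \<subseteq> U"
proof -
  assume "z \<in> supported U"
  then have "z \<in> {z. Poly_Mapping.keys z \<subseteq> U}"
    unfolding supported_def
  proof (rule pm.span_subspace_induct)
    show "pm.subspace {z. Poly_Mapping.keys z \<subseteq> U}"
    proof (rule pm.subspaceI)
      show "x + y \<in> {z. Poly_Mapping.keys z \<subseteq> U}"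
        if "x \<in> {z. Poly_Mapping.keys z \<subseteq> U}" "y \<in> {z. Poly_Mapping.keys z \<subseteq> U}" for x y
        using that Poly_Mapping.keys_add[of x y] by blast
      show "cscale d x \<in> {z. Poly_Mapping.keys z \<subseteq> U}" if "x \<in> {z. Poly_Mapping.keys z \<subseteq> U}" for d x
        using that keys_cscale[of d x] by blast
    qed simp
  qed auto
  then show ?thesis by simp
qed

lemma lc_image: "lc b ` supported U = vs.span (b ` U)"
proof
  show "lc b ` supported U \<subseteq> vs.span (b ` U)"
  proof
    fix w assume "w \<in> lc b ` supported U"
    then obtain z where z: "z \<in> supported U" "w = lc b z" by blast
    have "scale (Poly_Mapping.lookup z k) (b k) \<in> vs.span (b ` U)" if "k \<in> Poly_Mapping.keys z" for k
      using that keys_supported[OF z(1)] by (intro vs.span_scale vs.span_base) auto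
    then show "w \<in> vs.span (b ` U)" unfolding z lc_def by (intro vs.span_sum)
  qed
  show "vs.span (b ` U) \<subseteq> lc b ` supported U"
  proof (rule vs.span_minimal)
    show "b ` U \<subseteq> lc b ` supported U"
    proof
      fix w assume "w \<in> b ` U"
      then obtain k where k: "k \<in> U" "w = b k" by blast
      then have "w = lc b (Poly_Mapping.single k 1)" by (simp add: lc_single)
      moreover have "Poly_Mapping.single k 1 \<in> supported U"
        unfolding supported_def using k by (intro pm.span_base) auto
      ultimately show "w \<in> lc b ` supported U" by blast
    qed
    show "vs.subspace (lc b ` supported U)"
    proof (rule vs.subspaceI)
      show "0 \<in> lc b ` supported U"
        by (rule image_eqI[of _ _ 0]) (simp_all add: lc_zero supported_def pm.span_zero)
      show "x + y \<in> lc b ` supported U" if "x \<in> lc b ` supported U" "y \<in> lc b ` supported U" for x y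
      proof -
        from that obtain u v where "u \<in> supported U" "v \<in> supported U" "x = lc b u" "y = lc b v" by blast
        then show ?thesis by (intro image_eqI[of _ _ "u + v"]) (simp_all add: lc_add supported_def pm.span_add)
      qed
      show "scale d x \<in> lc b ` supported U" if "x \<in> lc b ` supported U" for d x
      proof -
        from that obtain u where "u \<in> supported U" "x = lc b u" by blast
        then show ?thesis by (intro image_eqI[of _ _ "cscale d u"]) (simp_all add: lc_scale supported_def pm.span_scale)
      qed
    qed
  qed
qed

text \<open>Eigenvectors of \<open>L_0\<close> for distinct eigenvalues are independent: applying
  \<open>L_0 - (h + j)\<close> removes \<open>j\<close> from the support of \<open>z\<close> and
  keeps the other indices.\<close>

lemma lc_injective:
  assumes b: "\<And>k. b k \<in> V" "\<And>k. act (Lg 0) (b k) = scale (h + of_int k) (b k)"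
    and nz: "\<And>k. k \<in> Poly_Mapping.keys z \<Longrightarrow> b k \<noteq> 0" and z: "lc b z = 0"
  shows "z = 0"
  using nz z
proof (induction "card (Poly_Mapping.keys z)" arbitrary: z rule: less_induct)
  case less
  show ?case
  proof (rule ccontr)
    assume "z \<noteq> 0"
    then obtain j where j: "j \<in> Poly_Mapping.keys z" by (metis all_not_in_conv keys_eq_empty)
    let ?K = "Poly_Mapping.keys z"
    define y where "y = (\<Sum>k\<in>?K. Poly_Mapping.single k (of_int (k - j) * Poly_Mapping.lookup z k))"
    have y: "Poly_Mapping.lookup y k = of_int (k - j) * Poly_Mapping.lookup z k" for k
      unfolding y_def lookup_sum by (cases "k \<in> ?K") (auto simp: lookup_single when_def in_keys_iff sum.delta)
    have keys: "Poly_Mapping.keys y = ?K - {j}" by (auto simp: in_keys_iff y)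
    have partial: "act (Lg 0) (\<Sum>k\<in>A. scale (Poly_Mapping.lookup z k) (b k)) =
        (\<Sum>k\<in>A. scale (Poly_Mapping.lookup z k * (h + of_int k)) (b k)) \<and>
        (\<Sum>k\<in>A. scale (Poly_Mapping.lookup z k) (b k)) \<in> V" if "finite A" for A
      using that
    proof induction
      case empty
      then show ?case using act_zero_right[OF Lg_mem] vs.subspace_0[OF subspace_V] by simp
    next
      case (insert k A)
      then show ?case
        using act_add_right[OF Lg_mem] act_scale_right[OF Lg_mem] vs.subspace_scale[OF subspace_V]
          vs.subspace_add[OF subspace_V] b by simp
    qed
    have "lc b y = (\<Sum>k\<in>?K. scale (of_int (k - j) * Poly_Mapping.lookup z k) (b k))"
      by (subst lc_eq[of ?K]) (auto simp: keys y)
    also have "\<dots> = (\<Sum>k\<in>?K. scale (Poly_Mapping.lookup z k * (h + of_int k)) (b k)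
        - scale (h + of_int j) (scale (Poly_Mapping.lookup z k) (b k)))"
    proof (rule sum.cong[OF refl])
      fix k
      have "of_int (k - j) * Poly_Mapping.lookup z k =
          Poly_Mapping.lookup z k * (h + of_int k) - (h + of_int j) * Poly_Mapping.lookup z k"
        by (simp add: algebra_simps)
      then show "scale (of_int (k - j) * Poly_Mapping.lookup z k) (b k) =
          scale (Poly_Mapping.lookup z k * (h + of_int k)) (b k)
          - scale (h + of_int j) (scale (Poly_Mapping.lookup z k) (b k))"
        by (simp only: vs.scale_left_diff_distrib vs.scale_scale)
    qed
    also have "\<dots> = act (Lg 0) (lc b z) - scale (h + of_int j) (lc b z)"
      using partial[of ?K] by (simp only: lc_def sum_subtractf vs.scale_sum_right finite_keys)
    also have "\<dots> = 0" using less.prems(2) act_zero_right[OF Lg_mem] by simp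
    finally have "lc b y = 0" .
    moreover have "card (Poly_Mapping.keys y) < card ?K" unfolding keys using j by (intro card_Diff1_less) simp_all
    ultimately have "y = 0" using less.hyps[of y] less.prems(1) keys by simp
    then have "?K = {j}" using keys j by auto
    then have "lc b z = scale (Poly_Mapping.lookup z j) (b j)" by (simp add: lc_def)
    then show False using less.prems j by (simp add: in_keys_iff)
  qed
qed

section \<open>The embedding into V(\<alpha>, \<beta>, F)\<close>

lemma iso_density_module:
  "\<exists>\<alpha> \<beta> (F :: int \<Rightarrow> int \<Rightarrow> complex). cond_I p F \<and> cond_II p F \<and> cond_III p F \<and>
    iso_subquotient p scale V act cscale (VF p F) (VF_act p \<alpha> \<beta> F)"
proof -
  obtain h c e where eV: "\<And>k. e k \<in> V" and e0: "\<And>k. act (Lg 0) (e k) = scale (h + of_int k) (e k)"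
    and central: "\<And>v i. v \<in> V \<Longrightarrow> i \<in> {0..p - 1} \<Longrightarrow> act (Cg p i) v = scale (c i) v"
    and step: "\<And>m k. \<exists>x. act (Lg m) (e k) = scale x (e (k + m))" and spanV: "vs.span (range e) = V"
    by (rule weight_basis) (assumption | rule that)+
  define S where "S = {k. e k \<noteq> 0}"
  obtain x where x: "\<And>m k. act (Lg m) (e k) = scale (x m k) (e (k + m))" using step by metis
  \<comment> \<open>\<open>x m k\<close> is arbitrary when one of the two vectors is 0; the value 0
    there gives \<open>supp\<close>.\<close>
  define \<phi> where "\<phi> m k = (if k \<in> S \<and> k + m \<in> S then x m k else 0)" for m k
  have act_e: "act (Lg m) (e k) = scale (\<phi> m k) (e (k + m))" for m k
    using x[of m k] act_zero_right[OF Lg_mem] by (auto simp: \<phi>_def S_def)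
  have bracket_e: "act (bracket p (Lg m) (Lg n)) (e k) =
      scale (\<phi> m (k + n) * \<phi> n k - \<phi> n (k + m) * \<phi> m k) (e (k + (m + n)))" for m n k
  proof -
    have "act (Lg m) (act (Lg n) (e k)) = scale (\<phi> m (k + n) * \<phi> n k) (e (k + (m + n)))" for m n
      unfolding act_e act_scale_right[OF Lg_mem eV] by (simp add: mult.commute add_ac)
    from this[of m n] this[of n m] show ?thesis
      unfolding act_bracket[OF Lg_mem Lg_mem eV] by (simp only: vs.scale_left_diff_distrib add.commute[of n m])
  qed
  have rel: "\<phi> m (k + n) * \<phi> n k - \<phi> n (k + m) * \<phi> m k = d"
    if "k \<in> S" "act (bracket p (Lg m) (Lg n)) (e k) = scale d (e (k + (m + n)))" "k + (m + n) \<notin> S \<Longrightarrow> d = 0" for k m n d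
  proof (cases "k + (m + n) \<in> S")
    case True
    then show ?thesis using that(2) unfolding bracket_e by (simp add: S_def)
  next
    case False
    then have "k + n + m \<notin> S" "k + m + n \<notin> S" by (simp_all add: add_ac)
    then show ?thesis using that(3)[OF False] by (simp add: \<phi>_def)
  qed
  interpret G: gap_weights p S \<phi> h "c 0" c
  proof
    show "p > 1" by (rule p)
    show "k \<in> S \<and> k + m \<in> S" if "\<phi> m k \<noteq> 0" for m k using that by (auto simp: \<phi>_def split: if_splits)
    show "\<phi> 0 k = h + of_int k" if "k \<in> S" for k using act_e[of 0 k] e0[of k] that by (simp add: S_def)
  next
    fix m n k assume mn: "p dvd m" "p dvd n" and k: "k \<in> S"
    define q where "q = (1 / 12) * ((of_int m / of_int p) ^ 3 - of_int m / of_int p :: complex)"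
    have "act (bracket p (Lg m) (Lg n)) (e k) =
        scale (of_int (n - m) * \<phi> (m + n) k + (if m + n = 0 then q * c 0 else 0)) (e (k + (m + n)))"
    proof (cases "m + n = 0")
      case True
      have "act (bracket p (Lg m) (Lg n)) (e k) =
          act (cscale (of_int (n - m)) (Lg (m + n))) (e k) + act (cscale q (Cg p 0)) (e k)"
      proof -
        have "cscale (of_int (n - m)) (Lg (m + n)) \<in> gap_virasoro p" "cscale q (Cg p 0) \<in> gap_virasoro p"
          using p by (auto intro!: pm.subspace_scale[OF subspace_algebra] Lg_mem Cg_mem)
        from act_add_left[OF this eV] show ?thesis
          unfolding bracket_displayed(1)[OF p mn] q_def[symmetric] using True by simp
      qed
      also have "\<dots> = scale (of_int (n - m)) (act (Lg (m + n)) (e k)) + scale q (act (Cg p 0) (e k))"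
        using p by (simp add: act_scale_left[OF Lg_mem eV] act_scale_left[OF Cg_mem[of 0] eV])
      also have "act (Cg p 0) (e k) = scale (c 0) (e k)" using p central[OF eV] by simp
      finally show ?thesis unfolding act_e using True by (simp add: vs.scale_left_distrib)
    next
      case False
      then show ?thesis
        unfolding bracket_displayed(1)[OF p mn] by (simp add: act_scale_left[OF Lg_mem eV] act_e)
    qed
    then show "\<phi> m (k + n) * \<phi> n k - \<phi> n (k + m) * \<phi> m k = of_int (n - m) * \<phi> (m + n) k +
        (if m + n = 0 then 1 / 12 * ((of_int m / of_int p) ^ 3 - of_int m / of_int p) * c 0 else 0)"
      unfolding q_def[symmetric] by (rule rel[OF k]) (use k in \<open>auto simp: \<phi>_def\<close>)
  next
    fix m r k assume "p dvd m" "\<not> p dvd r" and k: "k \<in> S"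
    then have "act (bracket p (Lg m) (Lg r)) (e k) = scale (of_int r * \<phi> (m + r) k) (e (k + (m + r)))"
      by (simp add: bracket_displayed(2)[OF p] act_scale_left[OF Lg_mem eV] act_e)
    then show "\<phi> m (k + r) * \<phi> r k - \<phi> r (k + m) * \<phi> m k = of_int r * \<phi> (m + r) k"
      by (rule rel[OF k]) (simp add: \<phi>_def)
  next
    fix r s k assume rs: "\<not> p dvd r" "\<not> p dvd s" and k: "k \<in> S"
    have i: "r mod p \<in> {0..p - 1}" by (rule residue_range(1)[OF p])
    have "act (bracket p (Lg r) (Lg s)) (e k) =
        scale (if r + s = 0 then of_int r * c (r mod p) else 0) (e (k + (r + s)))"
      unfolding bracket_displayed(3)[OF p rs]
      using act_scale_left[OF Cg_mem[OF i] eV] central[OF eV i] act_zero_left[OF eV] by simp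
    then show "\<phi> r (k + s) * \<phi> s k - \<phi> s (k + r) * \<phi> r k = (if r + s = 0 then of_int r * c (r mod p) else 0)"
      by (rule rel[OF k]) (use k in auto)
  next
    fix U assume U: "U \<subseteq> S" "U \<noteq> {}" and closed: "\<And>k m. k \<in> U \<Longrightarrow> \<phi> m k \<noteq> 0 \<Longrightarrow> k + m \<in> U"
    obtain u where u: "u \<in> U" using U by blast
    have sub: "vs.span (e ` U) \<subseteq> V" using eV subspace_V by (intro vs.span_minimal) auto
    \<comment> \<open>A closed \<open>U\<close> spans a submodule, which must be \<open>V\<close>;
      independence of the weight vectors then recovers \<open>U = S\<close>.\<close>
    have "vs.span (e ` U) = V"
    proof (rule submodule_eq_V[OF sub])
      show "act (Lg m) w \<in> vs.span (e ` U)" if "w \<in> vs.span (e ` U)" for m w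
        using that
      proof (rule span_invariant)
        fix w assume "w \<in> e ` U"
        then obtain k where k: "k \<in> U" "w = e k" by blast
        show "w \<in> V \<and> act (Lg m) w \<in> vs.span (e ` U)"
          using k eV closed[of k m] unfolding k act_e
          by (cases "\<phi> m k = 0") (auto intro: vs.span_zero vs.span_scale vs.span_base)
      qed
      show "act (Cg p i) w \<in> vs.span (e ` U)" if "i \<in> {0..p - 1}" "w \<in> vs.span (e ` U)" for i w
      proof -
        have "w \<in> V" using that sub by blast
        then show ?thesis using central[OF _ that(1)] that(2) by (simp add: vs.span_scale)
      qed
      show "e u \<in> vs.span (e ` U)" using u by (simp add: vs.span_base)
      show "e u \<noteq> 0" using u U by (auto simp: S_def)
    qed simp
    then have eU: "lc e ` supported U = V" by (simp add: lc_image)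
    show "U = S"
    proof (rule antisym[OF U(1)], rule subsetI)
      fix k assume k: "k \<in> S"
      obtain z where z: "z \<in> supported U" "e k = lc e z" using eU eV[of k] by blast
      have "Poly_Mapping.single k 1 - z = 0"
      proof (rule lc_injective[of e h, OF eV e0])
        show "e i \<noteq> 0" if "i \<in> Poly_Mapping.keys (Poly_Mapping.single k 1 - z)" for i
          using that keys_supported[OF z(1)] U(1) k
          by (auto simp: in_keys_iff lookup_minus lookup_single when_def S_def split: if_splits)
        show "lc e (Poly_Mapping.single k 1 - z) = 0" using z(2) by (simp add: lc_diff lc_single)
      qed
      then have "z = Poly_Mapping.single k 1" by simp
      then have "Poly_Mapping.keys z = {k}" by (simp only:) simp
      then show "k \<in> U" using keys_supported[OF z(1)] by simp
    qed
  next
    show "S \<noteq> {}"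
    proof
      assume "S = {}"
      then have "range e \<subseteq> {0}" by (auto simp: S_def)
      then have "V \<subseteq> {0}" using vs.span_minimal[of "range e" "{0}"] spanV by simp
      then show False using irreducible vs.subspace_0[OF subspace_V] by (auto simp: irreducible_module_def)
    qed
  qed
  obtain \<alpha> \<beta> F k0 g where F: "cond_I p F" "cond_II p F" "cond_III p F" and c0: "c 0 = 0" and g: "\<And>k. g k \<noteq> 0"
    and mem: "\<And>k. k \<in> S \<Longrightarrow> (k - k0) mod p \<in> oF p F"
    and coeff: "\<And>k m. k \<in> S \<Longrightarrow> \<phi> m k * g k / g (k + m) =
      (if p dvd m then \<alpha> + of_int (k - k0) + of_int m * \<beta> else F (m mod p) ((k - k0) mod p))"
    by (rule G.classification) (assumption | rule that)+
  define A where "A = VF_act p \<alpha> \<beta> F"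
  \<comment> \<open>Rescaled by \<open>g\<close> and indexed from \<open>k0\<close>, the weight
    vectors have the structure constants of the standard basis of \<open>VF p F\<close>;
    \<open>M\<close> is spanned by the basis vectors that correspond to weights of
    \<open>V\<close>.\<close>
  define b where "b k = scale (g (k + k0)) (e (k + k0))" for k
  define M where "M = supported {k. k + k0 \<in> S}"
  have bV: "b k \<in> V" for k using eV vs.subspace_scale[OF subspace_V] by (simp add: b_def)
  have b0: "act (Lg 0) (b k) = scale (h + of_int k0 + of_int k) (b k)" for k
    unfolding b_def act_scale_right[OF Lg_mem eV] e0 by (simp add: ac_simps)
  have subM: "pm.subspace M" by (simp add: M_def supported_def pm.subspace_span)
  have image: "lc b ` M = V"
  proof -
    have "vs.span (b ` {k. k + k0 \<in> S}) = V"
    proof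
      show "vs.span (b ` {k. k + k0 \<in> S}) \<subseteq> V" using bV subspace_V by (intro vs.span_minimal) auto
      have "e k \<in> vs.span (b ` {k. k + k0 \<in> S})" for k
      proof (cases "k \<in> S")
        case True
        then have "b (k - k0) \<in> vs.span (b ` {k. k + k0 \<in> S})" by (intro vs.span_base) auto
        moreover have "e k = scale (1 / g k) (b (k - k0))" using g by (simp add: b_def)
        ultimately show ?thesis by (simp add: vs.span_scale)
      qed (simp add: S_def vs.span_zero)
      then have "vs.span (range e) \<subseteq> vs.span (b ` {k. k + k0 \<in> S})" by (intro vs.span_minimal) auto
      then show "V \<subseteq> vs.span (b ` {k. k + k0 \<in> S})" using spanV by simp
    qed
    then show ?thesis by (simp add: M_def lc_image)
  qed
  have inj: "y = z" if "y \<in> M" "z \<in> M" "lc b y = lc b z" for y z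
  proof -
    have "y - z \<in> M" using that pm.subspace_diff[OF subM] by blast
    have "y - z = 0"
    proof (rule lc_injective[of b "h + of_int k0", OF bV b0])
      show "b k \<noteq> 0" if "k \<in> Poly_Mapping.keys (y - z)" for k
        using that keys_supported \<open>y - z \<in> M\<close> g by (auto simp: M_def b_def S_def)
      show "lc b (y - z) = 0" using that by (simp add: lc_diff)
    qed
    then show ?thesis by simp
  qed
  have basis: "A (Lg m) (Poly_Mapping.single k 1) \<in> M \<and>
      lc b (A (Lg m) (Poly_Mapping.single k 1)) = act (Lg m) (b k)" if k: "k + k0 \<in> S" for m k
  proof -
    define q where "q = \<phi> m (k + k0) * g (k + k0) / g (k + m + k0)"
    have "A (Lg m) (Poly_Mapping.single k 1) = Poly_Mapping.single (k + m) q"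
      using coeff[OF k, of m] by (simp add: A_def VF_act_def Lg_def q_def add_ac)
    moreover have "Poly_Mapping.single (k + m) q \<in> M"
    proof (cases "k + m + k0 \<in> S")
      case True
      then show ?thesis unfolding M_def supported_def
        by (subst single_conv_cscale) (intro pm.span_scale pm.span_base, auto)
    next
      case False
      \<comment> \<open>If the target is not a weight of \<open>V\<close>, the coefficient vanishes
        in \<open>VF p F\<close> too; hence \<open>M\<close> is invariant.\<close>
      then have "q = 0" using G.supp[of m "k + k0"] by (auto simp: q_def add_ac)
      then show ?thesis using pm.subspace_0[OF subM] by simp
    qed
    moreover have "scale q (b (k + m)) = act (Lg m) (b k)"
      using g unfolding b_def act_scale_right[OF Lg_mem eV] act_e by (simp add: q_def add_ac mult_ac)
    ultimately show ?thesis by (simp add: lc_single)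
  qed
  have A_lin: "A x (y + z) = A x y + A x z" "A x (cscale d z) = cscale d (A x z)" "A x 0 = 0"
    "A (x + x') z = A x z + A x' z" "A (cscale d x) z = cscale d (A x z)" "A 0 z = 0" for x x' y z d
    by (simp_all add: A_def VF_act_def bilin_simps)
  have MV: "lc b z \<in> V" if "z \<in> M" for z using image that by blast
  have hom: "\<forall>z\<in>M. A x z \<in> M \<and> lc b (A x z) = act x (lc b z)" if "x \<in> gap_virasoro p" for x
    using that
  proof (rule algebra_induct)
    show "pm.subspace {x \<in> gap_virasoro p. \<forall>z\<in>M. A x z \<in> M \<and> lc b (A x z) = act x (lc b z)}"
      using pm.subspace_0[OF subspace_algebra] pm.subspace_add[OF subspace_algebra] pm.subspace_scale[OF subspace_algebra]
        pm.subspace_0[OF subM] pm.subspace_add[OF subM] pm.subspace_scale[OF subM]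
      by (intro pm.subspaceI) (simp_all add: A_lin lc_zero lc_add lc_scale act_zero_left act_add_left act_scale_left MV)
  next
    fix m
    show "\<forall>z\<in>M. A (Lg m) z \<in> M \<and> lc b (A (Lg m) z) = act (Lg m) (lc b z)"
    proof
      fix z assume "z \<in> M"
      then have "z \<in> {z \<in> M. A (Lg m) z \<in> M \<and> lc b (A (Lg m) z) = act (Lg m) (lc b z)}"
        unfolding M_def supported_def
      proof (rule pm.span_subspace_induct, fold supported_def, fold M_def)
        show "pm.subspace {z \<in> M. A (Lg m) z \<in> M \<and> lc b (A (Lg m) z) = act (Lg m) (lc b z)}"
          using pm.subspace_0[OF subM] pm.subspace_add[OF subM] pm.subspace_scale[OF subM]
          by (intro pm.subspaceI)
            (simp_all add: A_lin lc_zero lc_add lc_scale act_zero_right act_add_right act_scale_right Lg_mem MV)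
        fix y :: "int \<Rightarrow>\<^sub>0 complex" assume "y \<in> (\<lambda>k. Poly_Mapping.single k 1) ` {k. k + k0 \<in> S}"
        then obtain k where k: "k + k0 \<in> S" "y = Poly_Mapping.single k 1" by blast
        have "y \<in> M" unfolding M_def supported_def k using k by (intro pm.span_base) auto
        then show "y \<in> {z \<in> M. A (Lg m) z \<in> M \<and> lc b (A (Lg m) z) = act (Lg m) (lc b z)}"
          using basis[OF k(1), of m] by (simp add: k lc_single)
      qed
      then show "A (Lg m) z \<in> M \<and> lc b (A (Lg m) z) = act (Lg m) (lc b z)" by simp
    qed
  next
    fix i assume i: "i \<in> {0..p - 1}"
    have "A (Cg p i) z = 0" for z by (simp add: A_def VF_act_def Cg_def bilin_def)
    moreover have "c i = 0" using c0 G.central_zero_residue[of i] i by (cases "i = 0") auto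
    ultimately show "\<forall>z\<in>M. A (Cg p i) z \<in> M \<and> lc b (A (Cg p i) z) = act (Cg p i) (lc b z)"
      using central[OF MV i] pm.subspace_0[OF subM] by (simp add: lc_zero)
  qed
  have MVF: "M \<subseteq> VF p F" unfolding M_def supported_def VF_def
  proof (rule pm.span_mono, rule subsetI)
    fix y :: "int \<Rightarrow>\<^sub>0 complex" assume "y \<in> (\<lambda>k. Poly_Mapping.single k 1) ` {k. k + k0 \<in> S}"
    then obtain k where k: "k + k0 \<in> S" "y = Poly_Mapping.single k 1" by blast
    then have "y = Poly_Mapping.single (k mod p + p * (k div p)) 1" "k mod p \<in> oF p F"
      using mem[OF k(1)] by simp_all
    then show "y \<in> {Poly_Mapping.single (j + p * k) 1 |j k. j \<in> oF p F}" by blast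
  qed
  \<comment> \<open>\<open>V\<close> is isomorphic to \<open>M\<close> itself: the cosets of
    \<open>{0}\<close> are singletons, and \<open>the_elem\<close> unwraps them.\<close>
  have "iso_quotient p scale V act cscale M A {0}" unfolding iso_quotient_def
  proof (intro exI[of _ "\<lambda>X. lc b (the_elem X)"] conjI ballI allI)
    have coset: "coset {0} y = {y}" for y :: "int \<Rightarrow>\<^sub>0 complex" by (simp add: coset_def)
    show "bij_betw (\<lambda>X. lc b (the_elem X)) (coset {0} ` M) V"
      unfolding bij_betw_def
    proof
      show "inj_on (\<lambda>X. lc b (the_elem X)) (coset {0} ` M)" using inj by (auto simp: inj_on_def coset)
      show "(\<lambda>X. lc b (the_elem X)) ` coset {0} ` M = V" unfolding image[symmetric] by (simp add: image_image coset)
    qed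
    fix y z d assume "y \<in> M" "z \<in> M"
    show "lc b (the_elem (coset {0} (y + z))) = lc b (the_elem (coset {0} y)) + lc b (the_elem (coset {0} z))"
      by (simp add: coset lc_add)
    show "lc b (the_elem (coset {0} (cscale d z))) = scale d (lc b (the_elem (coset {0} z)))"
      by (simp add: coset lc_scale)
    fix x assume "x \<in> gap_virasoro p"
    then show "lc b (the_elem (coset {0} (A x z))) = act x (lc b (the_elem (coset {0} z)))"
      using hom \<open>z \<in> M\<close> by (simp add: coset)
  qed
  moreover have "submodule p cscale (VF p F) A M"
    using MVF subM hom by (simp add: submodule_def)
  moreover have "submodule p cscale (VF p F) A {0}"
    by (simp add: submodule_def A_lin VF_def pm.span_zero)
  moreover have "{0} \<subseteq> M" using pm.subspace_0[OF subM] by simp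
  ultimately show ?thesis unfolding iso_subquotient_def A_def using F by blast
qed

end

theorem theorem4p3:
  fixes p :: int
    and scale :: "complex \<Rightarrow> 'v::ab_group_add \<Rightarrow> 'v"
    and V :: "'v set"
    and act :: "galg \<Rightarrow> 'v \<Rightarrow> 'v"
  assumes "p > 1"
    and "irreducible_module p scale V act"
    and "intermediate_series p scale V act"
  shows "\<exists>\<alpha> \<beta> (F :: int \<Rightarrow> int \<Rightarrow> complex).
           cond_I p F \<and> cond_II p F \<and> cond_III p F \<and>
           iso_subquotient p scale V act cscale (VF p F) (VF_act p \<alpha> \<beta> F)"
proof -
  interpret irreducible_series p scale V act using assms by unfold_locales
  show ?thesis by (rule iso_density_module)
qed

end
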